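(* Let $E$ be a finite set and let $\lambda : E\to\mathbf{R}_+$ be a generic length function such that $\mathrm{Pol}(E,\lambda)\neq\emptyset$. Let $\mathcal{I}$ be a bending set for $\mathrm{Pol}(E,\lambda)$. Let $N(\lambda,\mathcal{I})$ be the minimal number of lopsided subsets which are necessary for a partition of $E$ which is coarser than $\mathcal{M}_{\mathcal{I}}$ (that is, the minimal number of blocks in a partition of $E$ into lopsided subsets which is coarser than $\mathcal{M}_{\mathcal{I}}$). Then the maximal dimension $n(\lambda,\mathcal{I})$ of a bending torus for $\mathrm{Pol}(E,\lambda)$ containing $T_{\mathcal{I}}$ is $$n(\lambda,\mathcal{I})=|E|-\max\{3,N(\lambda,\mathcal{I})\}.$$
   Context: For a finite set $E$ and a function $\lambda:E\to\mathbf{R}_+$ with strictly positive values (the length function), put $\widetilde{\mathrm{Pol}}(E,\lambda)=\{\rho:E\to\mathbf{R}^3 \mid \sum_{e\in E}\rho(e)=0,\ |\rho(e)|=\lambda(e)\ \forall e\in E\}$ and $\mathrm{Pol}(E,\lambda)=\widetilde{\mathrm{Pol}}(E,\lambda)/SO(3)$ (the polygon space). $\lambda$ is generic if there is no $\varepsilon:E\to\{\pm1\}$ with $\sum_{e\in E}\varepsilon(e)\lambda(e)=0$. For $\lambda$ generic and $\mathrm{Pol}(E,\lambda)\ne\emptyset$, $\mathrm{Pol}(E,\lambda)$ is a closed smooth symplectic manifold of dimension $2(|E|-3)$; its symplectic structure is that of the symplectic reduction at $0$ of $\prod_{e\in E}\mathcal{O}(\lambda(e))$ by the diagonal action of $SO(3)$,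 where $\mathcal{O}(s)$ is the coadjoint orbit of $SO(3)$ identified with the sphere of radius $s$ centered at $0$ in $\mathfrak{so}(3)^*\cong\mathbf{R}^3$, and the moment map is $(z_e)\mapsto\sum_{e\in E} z_e$. A subset $I\subset E$ is lopsided if there is $e_0\in I$ with $\lambda(e_0)>\sum_{e\in I-\{e_0\}}\lambda(e)$ (every singleton is lopsided). For $I\subset E$ let $f_I:\mathrm{Pol}(E,\lambda)\to\mathbf{R}$ be $f_I(\rho)=|\sum_{e\in I}\rho(e)|$. If $I$ is lopsided, $f_I$ is nowhere zero and smooth; its Hamiltonian flow $\Phi_I^t$ is the bending flow associated to $I$; it is periodic and rotates the vectors $\{\rho(e)\mid e\in I\}$ at constant speed around the axis $\rho_I=\sum_{e\in I}\rho(e)$. A Hamiltonian torus is a sub-torus of the group of symplectomorphisms of $\mathrm{Pol}(E,\lambda)$ (acting in a Hamiltonian fashion). A bending torus is a Hamiltonian torus generated by bending flows of lopsided subsets (the trivial torus, of dimension $0$, is allowed). A bending set is a set $\mathcal{I}$ of lopsided subsets of $E$ which contains every singleton $\{e\}$, $e\in E$, and such that for all $A,B\in\mathcal{I}$ either $A\cap B=\emptyset$ or one of $A,B$ is contained in the other. The bending flows $\{\Phi_I^t\mid I\in\mathcal{I}\}$ of a bending set commute and generate a bending torus, denoted $T_{\mathcal{I}}$. $\mathcal{M}_{\mathcal{I}}$ denotes the family of elements of $\mathcal{I}$ that are maximal for inclusion; it is a partition of $E$. A partition $\mathcal{L}$ of $E$ is coarser than a partition $\mathcal{K}$ if each element of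 $\mathcal{L}$ is a union of elements of $\mathcal{K}$ (so a partition is coarser than itself). *)

theory Defs
  imports "HOL-Algebra.Bij" "HOL-Algebra.Generated_Groups" "HOL-Library.Disjoint_Sets"
    "HOL-Analysis.Analysis"
begin

unbundle cross3_syntax


section \<open>Length functions, lopsided subsets, bending sets\<close>

text \<open>
  The finite set $E$ is rendered as a type \<open>'e\<close> of class \<open>finite\<close>.  Types are
  nonempty; this excludes nothing, since the empty length function is not generic.
\<close>

definition generic :: "('e::finite \<Rightarrow> real) \<Rightarrow> bool" where
  "generic len \<longleftrightarrow>
     \<not> (\<exists>\<epsilon>::'e \<Rightarrow> real. (\<forall>e. \<epsilon> e \<in> {-1, 1}) \<and> (\<Sum>e\<in>UNIV. \<epsilon> e * len e) = 0)"

definition lopsided :: "('e::finite \<Rightarrow> real) \<Rightarrow> 'e set \<Rightarrow> bool" where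
  "lopsided len A \<longleftrightarrow> (\<exists>e0\<in>A. len e0 > (\<Sum>e\<in>A - {e0}. len e))"

definition bending_set :: "('e::finite \<Rightarrow> real) \<Rightarrow> 'e set set \<Rightarrow> bool" where
  "bending_set len I \<longleftrightarrow>
     (\<forall>A\<in>I. lopsided len A) \<and> (\<forall>e. {e} \<in> I) \<and>
     (\<forall>A\<in>I. \<forall>B\<in>I. A \<inter> B = {} \<or> A \<subseteq> B \<or> B \<subseteq> A)"

definition maximal_members :: "'a set set \<Rightarrow> 'a set set" where
  "maximal_members I = {A\<in>I. \<not> (\<exists>B\<in>I. A \<subset> B)}"

definition coarser :: "'a set set \<Rightarrow> 'a set set \<Rightarrow> bool" where
  "coarser L K \<longleftrightarrow> (\<forall>B\<in>L. \<exists>K'\<subseteq>K. B = \<Union>K')"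

definition min_lopsided_blocks :: "('e::finite \<Rightarrow> real) \<Rightarrow> 'e set set \<Rightarrow> nat" where
  "min_lopsided_blocks len I =
     (LEAST N. \<exists>L. partition_on UNIV L \<and> (\<forall>B\<in>L. lopsided len B) \<and>
                   coarser L (maximal_members I) \<and> card L = N)"


section \<open>The polygon space\<close>

type_synonym 'e config = "(real^3)^'e"

definition polt :: "('e::finite \<Rightarrow> real) \<Rightarrow> 'e config set" where
  "polt len = {\<rho>. (\<Sum>e\<in>UNIV. \<rho> $ e) = 0 \<and> (\<forall>e. norm (\<rho> $ e) = len e)}"

definition rot_act :: "real^3^3 \<Rightarrow> 'e::finite config \<Rightarrow> 'e config" where
  "rot_act R \<rho> = (\<chi> e. R *v (\<rho> $ e))"

definition SO3_rel :: "('e::finite \<Rightarrow> real) \<Rightarrow> 'e config rel" where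
  "SO3_rel len =
     {(\<rho>, \<sigma>). \<rho> \<in> polt len \<and> \<sigma> \<in> polt len \<and> (\<exists>R. rotation_matrix R \<and> \<sigma> = rot_act R \<rho>)}"

definition Pol :: "('e::finite \<Rightarrow> real) \<Rightarrow> 'e config set set" where
  "Pol len = polt len // SO3_rel len"

definition cls :: "('e::finite \<Rightarrow> real) \<Rightarrow> 'e config \<Rightarrow> 'e config set" where
  "cls len \<rho> = SO3_rel len `` {\<rho>}"


section \<open>Smooth functions\<close>

text \<open>
  For open \<open>U\<close>, \<open>Ck n U f\<close> says that \<open>f\<close> is of class $C^n$ on \<open>U\<close>.
\<close>

primrec Ck :: "nat \<Rightarrow> 'a::euclidean_space set \<Rightarrow> ('a \<Rightarrow> 'b::real_normed_vector) \<Rightarrow> bool" where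
  "Ck 0 U f \<longleftrightarrow> continuous_on U f"
| "Ck (Suc n) U f \<longleftrightarrow>
     (\<forall>x\<in>U. f differentiable (at x)) \<and> (\<forall>v. Ck n U (\<lambda>x. frechet_derivative f (at x) v))"

definition smooth_on :: "'a::euclidean_space set \<Rightarrow> ('a \<Rightarrow> 'b::real_normed_vector) \<Rightarrow> bool" where
  "smooth_on U f \<longleftrightarrow> (\<forall>n. Ck n U f)"

text \<open>
  A smooth function on \<open>Pol len\<close> is represented by a rotation-invariant lift \<open>F\<close> to
  \<open>polt len\<close> which is the restriction of a smooth function on an open neighbourhood.  As
  \<open>polt len\<close> is a closed submanifold for generic \<open>len\<close> and \<open>SO(3)\<close> acts freely on it, every
  smooth function on the quotient has such a lift.
\<close>

definition smooth_fun_Pol :: "('e::finite \<Rightarrow> real) \<Rightarrow> ('e config \<Rightarrow> real) \<Rightarrow> bool" where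
  "smooth_fun_Pol len F \<longleftrightarrow>
     (\<exists>U. open U \<and> polt len \<subseteq> U \<and> smooth_on U F) \<and>
     (\<forall>\<rho>\<in>polt len. \<forall>R. rotation_matrix R \<longrightarrow> F (rot_act R \<rho>) = F \<rho>)"


section \<open>The symplectic structure\<close>

text \<open>
  Kirillov--Kostant--Souriau form of the coadjoint orbit through \<open>z\<close>, the sphere of radius
  \<open>s = norm z\<close>, on its tangent vectors, which are the vectors orthogonal to \<open>z\<close>.  The lemma
  checks it against its usual description on the generators \<open>a \<times> z\<close> of the
  coadjoint action.
\<close>

definition kks :: "real \<Rightarrow> real^3 \<Rightarrow> real^3 \<Rightarrow> real^3 \<Rightarrow> real" where
  "kks s z u v = (z \<bullet> (u \<times> v)) / s\<^sup>2"

lemma kks_generators: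
  assumes "norm z = s" "s > 0"
  shows "kks s z (a \<times> z) (b \<times> z) = z \<bullet> (a \<times> b)"
proof -
  have s2: "z \<bullet> z = s\<^sup>2"
    using assms by (simp add: power2_norm_eq_inner[symmetric])
  have "z \<bullet> ((a \<times> z) \<times> (b \<times> z)) = (z \<bullet> z) * (z \<bullet> (a \<times> b))"
    by (simp add: cross3_simps)
  then show ?thesis
    using assms s2 by (simp add: kks_def)
qed

definition orbit_prod_form ::
    "('e::finite \<Rightarrow> real) \<Rightarrow> 'e config \<Rightarrow> 'e config \<Rightarrow> 'e config \<Rightarrow> real" where
  "orbit_prod_form len \<rho> v w = (\<Sum>e\<in>UNIV. kks (len e) (\<rho> $ e) (v $ e) (w $ e))"

text \<open>
  Tangent space at \<open>\<rho>\<close> of \<open>polt len\<close>, the zero level of the moment map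
  $z \mapsto \sum_e z_e$ on the product of orbits: the vectors tangent to the
  product of spheres which are killed by the derivative of the moment map
  (\<open>0\<close> is a regular value for generic \<open>len\<close>).
\<close>

definition polt_tangent :: "('e::finite \<Rightarrow> real) \<Rightarrow> 'e config \<Rightarrow> 'e config set" where
  "polt_tangent len \<rho> = {w. (\<forall>e. (w $ e) \<bullet> (\<rho> $ e) = 0) \<and> (\<Sum>e\<in>UNIV. w $ e) = 0}"

text \<open>
  The symplectic form of the reduced space \<open>Pol len\<close> is the unique form whose pullback to
  \<open>polt len\<close> is the restriction of \<open>orbit_prod_form len\<close>.  Everything about it is therefore
  expressed upstairs, with maps into \<open>Pol len\<close> replaced by (local) lifts to \<open>polt len\<close>.
\<close>

definition symplectic_map ::
    "('e::finite \<Rightarrow> real) \<Rightarrow> ('e config set \<Rightarrow> 'e config set) \<Rightarrow> bool" where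
  "symplectic_map len \<phi> \<longleftrightarrow>
     (\<forall>\<rho>\<in>polt len. \<exists>U G. open U \<and> \<rho> \<in> U \<and> smooth_on U G \<and>
        (\<forall>\<sigma>\<in>U \<inter> polt len. G \<sigma> \<in> polt len \<and> cls len (G \<sigma>) = \<phi> (cls len \<sigma>)) \<and>
        (\<forall>\<sigma>\<in>U \<inter> polt len. \<forall>v\<in>polt_tangent len \<sigma>. \<forall>w\<in>polt_tangent len \<sigma>.
           orbit_prod_form len (G \<sigma>)
             (frechet_derivative G (at \<sigma>) v) (frechet_derivative G (at \<sigma>) w)
           = orbit_prod_form len \<sigma> v w))"

definition symplectomorphisms ::
    "('e::finite \<Rightarrow> real) \<Rightarrow> ('e config set \<Rightarrow> 'e config set) set" where
  "symplectomorphisms len =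
     {\<phi> \<in> carrier (BijGroup (Pol len)).
        symplectic_map len \<phi> \<and> symplectic_map len (inv\<^bsub>BijGroup (Pol len)\<^esub> \<phi>)}"

text \<open>
  \<open>\<Phi>\<close> is the flow on \<open>Pol len\<close> of the Hamiltonian vector field \<open>X\<close>, $\omega(X,\cdot) = dF$, of
  the function represented by \<open>F\<close>: each trajectory lifts to a curve \<open>\<gamma>\<close> in \<open>polt len\<close> whose
  velocity satisfies this equation against all vectors tangent to \<open>polt len\<close>.
\<close>

definition hamiltonian_flow :: "('e::finite \<Rightarrow> real) \<Rightarrow> ('e config \<Rightarrow> real) \<Rightarrow>
    (real \<Rightarrow> 'e config set \<Rightarrow> 'e config set) \<Rightarrow> bool" where
  "hamiltonian_flow len F \<Phi> \<longleftrightarrow>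
     (\<forall>t. \<Phi> t \<in> carrier (BijGroup (Pol len))) \<and>
     (\<forall>\<rho>\<in>polt len. \<exists>\<gamma> \<gamma>'. \<gamma> 0 = \<rho> \<and>
        (\<forall>t. \<gamma> t \<in> polt len \<and> cls len (\<gamma> t) = \<Phi> t (cls len \<rho>) \<and>
             (\<gamma> has_vector_derivative \<gamma>' t) (at t) \<and>
             (\<forall>w\<in>polt_tangent len (\<gamma> t).
                orbit_prod_form len (\<gamma> t) (\<gamma>' t) w = frechet_derivative F (at (\<gamma> t)) w)))"


section \<open>Bending flows and bending tori\<close>

definition bending_hamiltonian :: "'e::finite set \<Rightarrow> 'e config \<Rightarrow> real" where
  "bending_hamiltonian A \<rho> = norm (\<Sum>e\<in>A. \<rho> $ e)"

definition bending_flow ::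
    "('e::finite \<Rightarrow> real) \<Rightarrow> 'e set \<Rightarrow> real \<Rightarrow> 'e config set \<Rightarrow> 'e config set" where
  "bending_flow len A = (THE \<Phi>. hamiltonian_flow len (bending_hamiltonian A) \<Phi>)"

definition generated_by_bendings ::
    "('e::finite \<Rightarrow> real) \<Rightarrow> 'e set set \<Rightarrow> ('e config set \<Rightarrow> 'e config set) set" where
  "generated_by_bendings len J =
     generate (BijGroup (Pol len)) (\<Union>A\<in>J. range (bending_flow len A))"

text \<open>
  \<open>T\<close> is a sub-torus of dimension \<open>k\<close> of the group of symplectomorphisms, acting in a
  Hamiltonian fashion with moment map \<open>\<mu>\<close> (every one-parameter subgroup
  \<open>t \<mapsto> \<theta> (t \<xi>)\<close> is the Hamiltonian flow of the pairing of \<open>\<mu>\<close> with \<open>\<xi>\<close>).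
  The torus is parametrized by $\mathbf{R}^k / \mathbf{Z}^k$.  As \<open>k\<close> is not fixed,
  \<open>\<theta>\<close> is defined on all sequences; by the kernel condition and additivity it depends only
  on the coordinates below \<open>k\<close> and is an injective homomorphism on $\mathbf{R}^k / \mathbf{Z}^k$.
\<close>

definition hamiltonian_torus ::
    "('e::finite \<Rightarrow> real) \<Rightarrow> nat \<Rightarrow> ('e config set \<Rightarrow> 'e config set) set \<Rightarrow> bool" where
  "hamiltonian_torus len k T \<longleftrightarrow>
     T \<subseteq> symplectomorphisms len \<and>
     (\<exists>(\<theta> :: (nat \<Rightarrow> real) \<Rightarrow> 'e config set \<Rightarrow> 'e config set) (\<mu> :: nat \<Rightarrow> 'e config \<Rightarrow> real).
        range \<theta> = T \<and>
        (\<forall>\<xi> \<eta>. \<theta> (\<lambda>i. \<xi> i + \<eta> i) = \<theta> \<xi> \<otimes>\<^bsub>BijGroup (Pol len)\<^esub> \<theta> \<eta>) \<and>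
        (\<forall>\<xi>. \<theta> \<xi> = \<one>\<^bsub>BijGroup (Pol len)\<^esub> \<longleftrightarrow> (\<forall>i<k. \<xi> i \<in> \<int>)) \<and>
        (\<forall>i<k. smooth_fun_Pol len (\<mu> i)) \<and>
        (\<forall>i<k. \<forall>\<xi>. \<forall>\<rho>\<in>polt len. \<forall>\<sigma>\<in>polt len.
            cls len \<sigma> = \<theta> \<xi> (cls len \<rho>) \<longrightarrow> \<mu> i \<sigma> = \<mu> i \<rho>) \<and>
        (\<forall>\<xi>. hamiltonian_flow len (\<lambda>\<rho>. \<Sum>i<k. \<xi> i * \<mu> i \<rho>) (\<lambda>t. \<theta> (\<lambda>i. t * \<xi> i))))"

definition bending_torus ::
    "('e::finite \<Rightarrow> real) \<Rightarrow> nat \<Rightarrow> ('e config set \<Rightarrow> 'e config set) set \<Rightarrow> bool" where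
  "bending_torus len k T \<longleftrightarrow>
     hamiltonian_torus len k T \<and>
     (\<exists>J. (\<forall>A\<in>J. lopsided len A) \<and> T = generated_by_bendings len J)"

definition bending_torus_dims :: "('e::finite \<Rightarrow> real) \<Rightarrow> 'e set set \<Rightarrow> nat set" where
  "bending_torus_dims len I =
     {k. \<exists>T. bending_torus len k T \<and> generated_by_bendings len I \<subseteq> T}"

end

theory Submission
  imports Defs
begin

text \<open>
  The proof turns the question about tori into one about families of subsets of the edge set,
  and answers the latter by counting.

  The Hamiltonian flow of \<open>|\<rho>\<^sub>A|\<close> rotates the edges of \<open>A\<close> about \<open>\<rho>\<^sub>A\<close> as long as \<open>\<rho>\<^sub>A\<close> never
  vanishes, which holds for lopsided \<open>A\<close> and, since the edges of a polygon add up to \<open>0\<close>, for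
  their complements (\<open>bending_flow_eq\<close>).  The flows of \<open>A\<close> and \<open>B\<close> commute only if the two sets do
  not cross, i.e. \<open>A\<close> or its complement is nested with \<open>B\<close>
  (\<open>commuting_bendings_not_crossing\<close>).  A complement has the same flow as the set, and a single
  edge has trivial flow, so a family without crossings generates the same group as a family \<open>K\<close> of
  nested sets which avoid a base point and have at least two elements inside and two outside.
  The flows of such a family are periodic, and in a polygon in general position a composition of
  them is trivial only if each one makes full turns; hence they generate a torus whose dimension
  is the number of members of \<open>K\<close> (\<open>hamiltonian_torus_nested\<close>).  The dimension is an invariant of
  the group, as it can be read off from the number of involutions.  So the dimensions in question
  are the numbers of such members for the families without crossings of lopsided sets which
  contain the given bending set (\<open>bending_torus_dims_eq\<close>).

  A nested family of sets with at least two elements in a set of \<open>p\<close> elements has at most \<open>p - 1\<close>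
  members (\<open>card_nested_family\<close>).  Picture a family without crossings as a tree whose leaves are
  the edges of the polygon and whose inner edges are its members, each directed away from a
  lopsided side.  At a sink of the tree the branches form a partition \<open>L\<close> of \<open>E\<close> into lopsided
  sets (\<open>partition_compatible\<close>).  Each member or its complement lies in a block of \<open>L\<close>, so there
  are at most \<open>|E| - |L|\<close> members.  As \<open>L\<close> can be chosen coarser than the partition into maximal
  members of the bending set, and with at least three blocks unless there are at most two such
  members, this is the upper bound.  Conversely, a partition into the least number of lopsided
  blocks can be refined inside its blocks by nested lopsided sets as finely as possible, because
  a subset of a lopsided set is lopsided if it contains the dominant edge
  (\<open>large_nested_family\<close>).
\<close>


section \<open>Rotations of three-space\<close>

text \<open>
  Rodrigues' formula for the rotation by the angle \<open>t\<close> about a unit vector \<open>u\<close>.  For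
  \<open>u = 0\<close> it is only a linear map, so most facts carry the hypothesis \<open>norm u = 1\<close>.
\<close>

definition rot :: "real^3 \<Rightarrow> real \<Rightarrow> real^3 \<Rightarrow> real^3" where
  "rot u t x = cos t *\<^sub>R x + sin t *\<^sub>R (u \<times> x) + ((1 - cos t) * (u \<bullet> x)) *\<^sub>R u"

lemma triple_rotate: "x \<bullet> (y \<times> z) = y \<bullet> (z \<times> (x::real^3))"
  by (simp add: cross3_simps)

lemma triple_swap: "x \<bullet> (y \<times> z) = - (y \<bullet> (x \<times> (z::real^3)))"
  by (simp add: cross3_simps)

lemma cross_cross_right: "x \<times> (y \<times> z) = (x \<bullet> z) *\<^sub>R y - (x \<bullet> y) *\<^sub>R (z::real^3)"
  by (simp add: cross3_simps; simp add: forall_3 algebra_simps)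

lemma cross_cross_left: "(x \<times> y) \<times> z = (x \<bullet> z) *\<^sub>R y - (y \<bullet> z) *\<^sub>R (x::real^3)"
  by (simp add: cross3_simps; simp add: forall_3 algebra_simps)

lemma inner_cross_cross:
  "(x \<times> y) \<bullet> (z \<times> w) = (x \<bullet> z) * (y \<bullet> w) - (x \<bullet> w) * (y \<bullet> (z::real^3))"
  by (simp add: cross3_simps)

lemma linear_rot: "linear (rot u t)"
  by (rule linearI)
    (simp_all add: rot_def cross_add_right cross_mult_right algebra_simps inner_add_right)

lemmas rot_add = linear_add[OF linear_rot]
  and rot_diff = linear_diff[OF linear_rot]
  and rot_scaleR = linear_scale[OF linear_rot]
  and rot_minus = linear_neg[OF linear_rot]
  and rot_sum = linear_sum[OF linear_rot]

lemma rot_zero_right [simp]: "rot u t 0 = 0"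
  by (rule linear_0[OF linear_rot])

lemma rot_zero_angle [simp]: "rot u 0 x = x"
  by (simp add: rot_def)

lemma rot_full_turns [simp]: "rot u (2 * pi * of_int n) x = x"
proof -
  have "cos (2 * pi * of_int n) = (1::real)" "sin (2 * pi * of_int n) = (0::real)"
    using cos_int_2pin[of n] sin_int_2pin[of n] by (simp_all add: mult_ac)
  then show ?thesis by (simp add: rot_def)
qed

lemma rot_uminus_axis: "rot (- u) t x = rot u (- t) x"
  by (simp add: rot_def)

lemma rot_axis: "norm u = 1 \<Longrightarrow> rot u t u = u"
  by (simp add: rot_def norm_eq_1 algebra_simps flip: scaleR_add_left)

lemma rot_sgn_self: "rot (sgn v) t v = v"
proof (cases "v = 0")
  case False
  then have "rot (sgn v) t (norm v *\<^sub>R sgn v) = norm v *\<^sub>R sgn v"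
    by (simp only: rot_scaleR) (simp add: rot_axis norm_sgn)
  then show ?thesis using False by (simp add: sgn_div_norm)
qed simp



lemma rot_add_angle:
  assumes "norm u = 1"
  shows "rot u s (rot u t x) = rot u (s + t) x"
proof -
  have uu: "u \<bullet> u = 1" using assms by (simp add: norm_eq_1)
  have cr: "u \<times> rot u t x = cos t *\<^sub>R (u \<times> x) + sin t *\<^sub>R ((u \<bullet> x) *\<^sub>R u - x)"
    by (simp add: rot_def cross_add_right cross_mult_right cross_cross_right uu)
  have ip: "u \<bullet> rot u t x = u \<bullet> x"
    by (simp add: rot_def inner_add_right uu dot_cross_self algebra_simps)
  show ?thesis
    unfolding rot_def[of u s] cr ip
    by (simp add: rot_def cos_add sin_add algebra_simps)
qed

lemma rot_inverse: "norm u = 1 \<Longrightarrow> rot u (- t) (rot u t x) = x"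
  by (simp add: rot_add_angle)

lemma rot_inner:
  assumes "norm u = 1"
  shows "rot u t x \<bullet> rot u t y = x \<bullet> y"
proof -
  have uu: "u \<bullet> u = 1" using assms by (simp add: norm_eq_1)
  have adj: "rot u t x \<bullet> z = x \<bullet> rot u (- t) z" for z
  proof -
    have "(u \<times> x) \<bullet> z = - (x \<bullet> (u \<times> z))"
      by (simp add: inner_commute[of _ z] triple_rotate[of z u x] triple_swap[of u x z])
    then show ?thesis
      by (simp add: rot_def inner_add_left inner_diff_right inner_add_right inner_commute)
  qed
  show ?thesis
    using adj rot_inverse[OF assms] by simp
qed

lemma norm_rot: "norm u = 1 \<Longrightarrow> norm (rot u t x) = norm x"
  by (simp add: norm_eq_sqrt_inner rot_inner)

lemma rot_matrix: "matrix (rot u t) *v x = rot u t x"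
  by (simp add: matrix_works linear_rot)

text \<open>
  The determinant of an orthogonal matrix is \<open>\<plusminus>1\<close>; here it is a square, because the rotation
  by \<open>t\<close> is the square of the rotation by \<open>t/2\<close>.
\<close>

lemma rotation_matrix_rot:
  assumes "norm u = 1"
  shows "rotation_matrix (matrix (rot u t))"
proof -
  have "orthogonal_transformation (rot u s)" for s
    using assms by (simp add: orthogonal_transformation_def rot_inner linear_rot)
  then have orth: "orthogonal_matrix (matrix (rot u s))" for s
    by (simp add: orthogonal_transformation_matrix)
  have "matrix (rot u (t/2)) ** matrix (rot u (t/2)) = matrix (rot u t)"
    using assms by (simp add: matrix_eq rot_matrix rot_add_angle flip: matrix_vector_mul_assoc)
  then have "det (matrix (rot u t)) = det (matrix (rot u (t/2))) * det (matrix (rot u (t/2)))"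
    by (metis det_mul)
  then have "det (matrix (rot u t)) = 1"
    using det_orthogonal_matrix[OF orth[of "t/2"]] by auto
  then show ?thesis by (simp add: rotation_matrix_def orth)
qed

lemma rot_cross: "norm u = 1 \<Longrightarrow> rot u t (x \<times> y) = rot u t x \<times> rot u t y"
  using cross_rotation_matrix[OF rotation_matrix_rot] by (metis rot_matrix)



lemma rotation_matrix_id: "rotation_matrix (mat 1 :: real^3^3)"
  by (simp add: rotation_matrix_def orthogonal_matrix_id)

lemma rotation_matrix_mul:
  "rotation_matrix R \<Longrightarrow> rotation_matrix S \<Longrightarrow> rotation_matrix (R ** S :: real^3^3)"
  by (simp add: rotation_matrix_def orthogonal_matrix_mul det_mul)

lemma rotation_matrix_transpose:
  "rotation_matrix R \<Longrightarrow> rotation_matrix (transpose R :: real^3^3)"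
  by (simp add: rotation_matrix_def orthogonal_matrix_transpose)

lemma transpose_rotation_cancel:
  assumes "rotation_matrix (R :: real^3^3)"
  shows "transpose R *v (R *v x) = x" "R *v (transpose R *v x) = x"
  using assms by (simp_all only: rotation_matrix_def orthogonal_matrix_def matrix_vector_mul_assoc
      matrix_vector_mul_lid)

lemma rotation_matrix_inner:
  assumes "rotation_matrix (R :: real^3^3)"
  shows "(R *v x) \<bullet> (R *v y) = x \<bullet> y"
proof -
  have "(R *v x) \<bullet> (R *v y) = (transpose R *v (R *v x)) \<bullet> y"
    by (simp only: dot_lmul_matrix[symmetric] transpose_matrix_vector)
  then show ?thesis by (simp only: transpose_rotation_cancel[OF assms])
qed

lemma rotation_matrix_norm: "rotation_matrix (R :: real^3^3) \<Longrightarrow> norm (R *v x) = norm x"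
  by (simp only: norm_eq_sqrt_inner rotation_matrix_inner)

lemma matrix_vector_scaleR: "R *v (c *\<^sub>R x) = c *\<^sub>R ((R :: real^3^3) *v x)"
  by (rule linear_scale[OF matrix_vector_mul_linear])

lemma rotation_matrix_sgn: "rotation_matrix (R :: real^3^3) \<Longrightarrow> sgn (R *v x) = R *v sgn x"
  by (simp only: sgn_div_norm rotation_matrix_norm matrix_vector_scaleR)

lemma rot_conjugate:
  assumes "rotation_matrix R"
  shows "R *v rot u t x = rot (R *v u) t (R *v x)"
  by (simp add: rot_def matrix_vector_right_distrib matrix_vector_scaleR
      cross_rotation_matrix[OF assms] rotation_matrix_inner[OF assms])

lemma orthogonal_to_frame_eq_0:
  assumes "z \<bullet> a = 0" "z \<bullet> b = 0" "z \<bullet> (a \<times> b) = 0" "a \<times> b \<noteq> 0"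
  shows "z = (0::real^3)"
proof -
  have "z \<times> (a \<times> b) = 0" using assms by (simp add: cross_cross_right)
  moreover have "(norm (z \<times> (a \<times> b)))\<^sup>2 + (z \<bullet> (a \<times> b))\<^sup>2 = (norm z * norm (a \<times> b))\<^sup>2"
    by (rule norm_cross_dot)
  ultimately show ?thesis using assms by simp
qed

text \<open>The component of \<open>x\<close> orthogonal to the axis is multiplied by \<open>cos t\<close>, up to a vector
  orthogonal to it.\<close>

lemma rot_fixed_imp_full_turns:
  assumes "norm u = 1" "rot u t x = x" "u \<times> x \<noteq> 0"
  shows "\<exists>n::int. t = 2 * pi * of_int n"
proof -
  have "(u \<times> x) \<bullet> (u \<times> rot u t x) = (u \<times> x) \<bullet> (cos t *\<^sub>R (u \<times> x))"
    by (simp add: rot_def cross_add_right cross_mult_right inner_add_right cross_cross_right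
        dot_cross_self inner_diff_right)
  then have "(1 - cos t) * ((u \<times> x) \<bullet> (u \<times> x)) = 0"
    using assms(2) by (simp add: algebra_simps)
  then have "cos t = 1" using assms(3) by simp
  then show ?thesis using cos_one_2pi_int[of t] by (auto simp: mult_ac)
qed

text \<open>
  The sum and the difference of the displacements for \<open>t\<close> and \<open>-t\<close> are nonzero and orthogonal to
  each other, so no nonzero \<open>w\<close> is parallel to both displacements.
\<close>

lemma rot_displacement_not_parallel:
  assumes "norm u = 1" "u \<times> x \<noteq> 0" "w \<noteq> 0" "0 < t" "t < pi"
  shows "(rot u t x - x) \<times> w \<noteq> 0 \<or> (rot u (- t) x - x) \<times> w \<noteq> 0"
proof (rule ccontr)
  define p q where "p = u \<times> x" and "q = u \<times> p"
  have uu: "u \<bullet> u = 1" using assms by (simp add: norm_eq_1)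
  have d: "rot u s x - x = sin s *\<^sub>R p + (1 - cos s) *\<^sub>R q" for s
    by (simp add: p_def q_def rot_def cross_cross_right uu algebra_simps)
  assume "\<not> ?thesis"
  then have e: "sin t *\<^sub>R (p \<times> w) + (1 - cos t) *\<^sub>R (q \<times> w) = 0"
    "sin (- t) *\<^sub>R (p \<times> w) + (1 - cos (- t)) *\<^sub>R (q \<times> w) = 0"
    unfolding d by (simp_all only: cross_add_left cross_mult_left de_Morgan_disj not_not)
  have "sin t > 0" using assms by (simp add: sin_gt_zero)
  moreover have "cos t \<noteq> 1"
  proof
    assume "cos t = 1"
    then have "(sin t)\<^sup>2 = 0" using sin_cos_squared_add[of t] by simp
    then show False using \<open>sin t > 0\<close> by simp
  qed
  moreover have "(1 - cos t) *\<^sub>R (q \<times> w) = sin t *\<^sub>R (p \<times> w)" using e(2) by simp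
  moreover from this e(1) have "2 *\<^sub>R (sin t *\<^sub>R (p \<times> w)) = 0"
    by (simp only: scaleR_2)
  ultimately have pw: "p \<times> w = 0" "q \<times> w = 0" by auto
  have pq: "p \<bullet> q = 0" "q \<bullet> q = p \<bullet> p"
    by (simp_all add: q_def dot_cross_self inner_cross_cross uu) (simp add: p_def dot_cross_self)
  have "q \<times> (w \<times> p) = (q \<bullet> p) *\<^sub>R w - (q \<bullet> w) *\<^sub>R p" by (simp add: cross_cross_right)
  then have "(q \<bullet> w) *\<^sub>R p = 0" using pw pq by (simp add: cross_skew[of w p] inner_commute)
  moreover have "q \<times> (w \<times> q) = (q \<bullet> q) *\<^sub>R w - (q \<bullet> w) *\<^sub>R q" by (simp add: cross_cross_right)
  then have "(q \<bullet> q) *\<^sub>R w = (q \<bullet> w) *\<^sub>R q" using pw by (simp add: cross_skew[of w q])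
  ultimately show False using assms pq by (auto simp: p_def)
qed


section \<open>Calculus of smooth functions\<close>

lemma Ck_cong:
  assumes "open U" "\<And>x. x \<in> U \<Longrightarrow> f x = g x"
  shows "Ck n U f \<longleftrightarrow> Ck n U g"
  using assms(2)
proof (induction n arbitrary: f g)
  case 0
  then show ?case by (simp cong: continuous_on_cong)
next
  case (Suc n)
  have tr: "(f has_derivative D) (at x) \<longleftrightarrow> (g has_derivative D) (at x)" if "x \<in> U" for x D
    using has_derivative_transform_within_open[OF _ assms(1) that] Suc.prems by metis
  have "f differentiable (at x) \<longleftrightarrow> g differentiable (at x)"
    "frechet_derivative f (at x) = frechet_derivative g (at x)" if "x \<in> U" for x
    using tr[OF that] by (auto simp: differentiable_def frechet_derivative_def)
  then show ?case
    using Suc.IH[of "\<lambda>x. frechet_derivative f (at x) _" "\<lambda>x. frechet_derivative g (at x) _"]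
    by auto
qed

lemma Ck_SucI:
  assumes "open U" "\<And>x. x \<in> U \<Longrightarrow> (f has_derivative D x) (at x)"
    and "\<And>v. Ck n U (\<lambda>x. D x v)"
  shows "Ck (Suc n) U f"
proof -
  have "frechet_derivative f (at x) = D x" if "x \<in> U" for x
    using frechet_derivative_at[OF assms(2)[OF that]] by simp
  then have "Ck n U (\<lambda>x. frechet_derivative f (at x) v) \<longleftrightarrow> Ck n U (\<lambda>x. D x v)" for v
    by (intro Ck_cong assms(1)) simp
  then show ?thesis
    using assms(2,3) by (auto simp: differentiable_def)
qed

lemma Ck_has_derivative:
  "Ck (Suc n) U f \<Longrightarrow> x \<in> U \<Longrightarrow> (f has_derivative frechet_derivative f (at x)) (at x)"
  by (simp add: frechet_derivative_works)

lemma Ck_SucD: "Ck (Suc n) U f \<Longrightarrow> Ck n U f"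
proof (induction n arbitrary: f)
  case 0
  then show ?case
    by (auto intro!: differentiable_imp_continuous_on differentiable_at_imp_differentiable_on)
next
  case (Suc n)
  then show ?case by (metis Ck.simps(2))
qed

lemma Ck_subset: "Ck n U f \<Longrightarrow> V \<subseteq> U \<Longrightarrow> Ck n V f"
  by (induction n arbitrary: f) (auto intro: continuous_on_subset)

lemma Ck_const: "open U \<Longrightarrow> Ck n U (\<lambda>x. c)"
proof (induction n arbitrary: c)
  case (Suc n)
  show ?case by (rule Ck_SucI[where D = "\<lambda>x v. 0"]) (use Suc in auto)
qed simp

lemma Ck_linear: "open U \<Longrightarrow> bounded_linear L \<Longrightarrow> Ck n U L"
proof (cases n)
  case (Suc m)
  assume "open U" "bounded_linear L"
  then show ?thesis unfolding Suc
    by (intro Ck_SucI[where D = "\<lambda>x. L"])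
      (auto intro: bounded_linear_imp_has_derivative Ck_const)
qed (auto intro: linear_continuous_on)

lemma Ck_linear_compose:
  assumes "open U" "bounded_linear L" "Ck n U f"
  shows "Ck n U (\<lambda>x. L (f x))"
  using assms(3)
proof (induction n arbitrary: f)
  case 0
  then show ?case using bounded_linear.continuous_on[OF assms(2)] by auto
next
  case (Suc n)
  show ?case
    by (rule Ck_SucI[OF assms(1)
          bounded_linear.has_derivative[OF assms(2) Ck_has_derivative[OF Suc.prems]]])
      (use Suc in auto)
qed

lemma Ck_add:
  assumes "open U" "Ck n U f" "Ck n U g"
  shows "Ck n U (\<lambda>x. f x + g x)"
  using assms(2,3)
proof (induction n arbitrary: f g)
  case 0
  then show ?case by (auto intro: continuous_intros)
next
  case (Suc n)
  show ?case
    by (rule Ck_SucI[OF assms(1) has_derivative_add[OF Ck_has_derivative[OF Suc.prems(1)]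
            Ck_has_derivative[OF Suc.prems(2)]]])
      (use Suc in auto)
qed

lemma Ck_sum:
  assumes "open U" "finite S" "\<And>i. i \<in> S \<Longrightarrow> Ck n U (f i)"
  shows "Ck n U (\<lambda>x. \<Sum>i\<in>S. f i x)"
  using assms(2,3)
proof (induction S rule: finite_induct)
  case (insert i S)
  then show ?case by (simp add: Ck_add assms(1))
qed (simp add: Ck_const assms(1))

lemma Ck_bilinear:
  assumes "open U" "bounded_bilinear B" "Ck n U f" "Ck n U g"
  shows "Ck n U (\<lambda>x. B (f x) (g x))"
  using assms(3,4)
proof (induction n arbitrary: f g)
  case 0
  then show ?case using bounded_bilinear.continuous_on[OF assms(2)] by auto
next
  case (Suc n)
  show ?case
    by (rule Ck_SucI[OF assms(1) bounded_bilinear.FDERIV[OF assms(2)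
            Ck_has_derivative[OF Suc.prems(1)] Ck_has_derivative[OF Suc.prems(2)]]])
      (use Suc Ck_SucD[OF Suc.prems(1)] Ck_SucD[OF Suc.prems(2)] in
        \<open>auto intro!: Ck_add assms(1)\<close>)
qed

lemma Ck_compose:
  assumes "open U" "open V" "Ck n V g" "Ck n U f" "f ` U \<subseteq> V"
  shows "Ck n U (\<lambda>x. g (f x))"
  using assms(3,4)
proof (induction n arbitrary: g)
  case 0
  then show ?case using assms(5) continuous_on_compose2 by auto
next
  case (Suc n)
  let ?Df = "\<lambda>x. frechet_derivative f (at x)" and ?Dg = "\<lambda>x. frechet_derivative g (at x)"
  have D: "((\<lambda>x. g (f x)) has_derivative (\<lambda>v. ?Dg (f x) (?Df x v))) (at x)" if "x \<in> U" for x
  proof -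
    have "f x \<in> V" using that assms(5) by auto
    from has_derivative_compose[OF Ck_has_derivative[OF Suc.prems(2) that]
        Ck_has_derivative[OF Suc.prems(1) this]]
    show ?thesis .
  qed
  \<comment> \<open>Expanding the direction in a basis reduces the chain rule to directional derivatives of
    \<open>g\<close>, to which the induction hypothesis applies.\<close>
  have "Ck n U (\<lambda>x. ?Dg (f x) (?Df x v))" for v
  proof -
    have "Ck n U (\<lambda>x. \<Sum>b\<in>Basis. (?Df x v \<bullet> b) *\<^sub>R ?Dg (f x) b)"
      by (intro Ck_sum Ck_bilinear[OF _ bounded_bilinear_scaleR]
          Ck_linear_compose[OF _ bounded_linear_inner_left] Suc.IH assms(1) finite_Basis)
        (use Suc.prems Ck_SucD in auto)
    moreover have "(\<Sum>b\<in>Basis. (?Df x v \<bullet> b) *\<^sub>R ?Dg (f x) b) = ?Dg (f x) (?Df x v)"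
      if "x \<in> U" for x
    proof -
      have "f x \<in> V" using that assms(5) by auto
      from has_derivative_linear[OF Ck_has_derivative[OF Suc.prems(1) this]]
      have "linear (?Dg (f x))" .
      then have "?Dg (f x) (\<Sum>b\<in>Basis. (?Df x v \<bullet> b) *\<^sub>R b)
          = (\<Sum>b\<in>Basis. (?Df x v \<bullet> b) *\<^sub>R ?Dg (f x) b)"
        by (simp add: linear_sum linear_scale)
      then show ?thesis by (simp add: euclidean_representation)
    qed
    ultimately show ?thesis using Ck_cong[OF assms(1)] by (metis (no_types, lifting))
  qed
  with D show ?case by (intro Ck_SucI[OF assms(1)])
qed

lemma Ck_inverse_norm:
  fixes L :: "'a::euclidean_space \<Rightarrow> 'b::real_inner"
  assumes "open U" "bounded_linear L" "\<And>x. x \<in> U \<Longrightarrow> L x \<noteq> 0"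
  shows "Ck n U (\<lambda>x. inverse (norm (L x)))"
proof (induction n)
  case 0
  have "continuous_on U L" by (rule linear_continuous_on[OF assms(2)])
  then show ?case using assms(3) by (auto intro!: continuous_intros)
next
  case (Suc n)
  let ?f = "\<lambda>x. inverse (norm (L x))"
  have D: "(?f has_derivative (\<lambda>v. - (?f x * (?f x * (?f x * (L x \<bullet> L v)))))) (at x)"
    if "x \<in> U" for x
  proof -
    have "((\<lambda>x. norm (L x)) has_derivative (\<lambda>v. sgn (L x) \<bullet> L v)) (at x)"
      using has_derivative_compose[OF bounded_linear_imp_has_derivative[OF assms(2)]
          has_derivative_norm[OF assms(3)[OF that]]] by (simp add: inner_commute)
    from Deriv.has_derivative_inverse[OF _ this] assms(3)[OF that]
    show ?thesis by (simp add: sgn_div_norm algebra_simps)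
  qed
  have "bounded_bilinear ((*) :: real \<Rightarrow> real \<Rightarrow> real)" by (rule bounded_bilinear_mult)
  note mult = Ck_bilinear[OF assms(1) this]
  have lin: "Ck n U (\<lambda>x. L x \<bullet> L v)" for v
    by (rule Ck_linear[OF assms(1) bounded_linear_compose[OF bounded_linear_inner_left assms(2)]])
  have "Ck n U (\<lambda>x. - (?f x * (?f x * (?f x * (L x \<bullet> L v)))))" for v
    by (rule Ck_linear_compose[OF assms(1) bounded_linear_minus[OF bounded_linear_ident]
          mult[OF Suc mult[OF Suc mult[OF Suc lin]]]])
  with D show ?case by (rule Ck_SucI[OF assms(1)])
qed

lemma Ck_sgn:
  fixes L :: "'a::euclidean_space \<Rightarrow> 'b::real_inner"
  assumes "open U" "bounded_linear L" "\<And>x. x \<in> U \<Longrightarrow> L x \<noteq> 0"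
  shows "Ck n U (\<lambda>x. sgn (L x))"
  unfolding sgn_div_norm
  by (rule Ck_bilinear[OF assms(1) bounded_bilinear_scaleR Ck_inverse_norm[OF assms]
        Ck_linear[OF assms(1,2)]])

lemma Ck_norm:
  fixes L :: "'a::euclidean_space \<Rightarrow> 'b::real_inner"
  assumes "open U" "bounded_linear L" "\<And>x. x \<in> U \<Longrightarrow> L x \<noteq> 0"
  shows "Ck n U (\<lambda>x. norm (L x))"
proof -
  have "Ck n U (\<lambda>x. L x \<bullet> sgn (L x))"
    by (rule Ck_bilinear[OF assms(1) bounded_bilinear_inner Ck_linear[OF assms(1,2)]
          Ck_sgn[OF assms]])
  moreover have "L x \<bullet> sgn (L x) = norm (L x)" for x
    by (simp add: sgn_div_norm power2_norm_eq_inner[symmetric] power2_eq_square divide_simps)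
  ultimately show ?thesis by simp
qed


section \<open>The polygon space\<close>

abbreviation ssum :: "'e::finite set \<Rightarrow> 'e config \<Rightarrow> real^3" where
  "ssum A \<rho> \<equiv> \<Sum>e\<in>A. \<rho> $ e"

lemma ssum_Un: "A \<inter> B = {} \<Longrightarrow> ssum (A \<union> B) \<rho> = ssum A \<rho> + ssum B \<rho>"
  by (simp add: sum.union_disjoint)

lemma ssum_split: "B \<subseteq> A \<Longrightarrow> ssum A \<rho> = ssum B \<rho> + ssum (A - B) \<rho>"
  by (metis Diff_disjoint Un_Diff_cancel Un_absorb1 ssum_Un)

lemma ssum_rot_act: "ssum A (rot_act R \<rho>) = R *v ssum A \<rho>"
  by (simp add: rot_act_def linear_sum[OF matrix_vector_mul_linear])

lemma rot_act_mult: "rot_act (R ** S) \<rho> = rot_act R (rot_act S \<rho>)"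
  by (simp add: rot_act_def matrix_vector_mul_assoc)

lemma rot_act_id [simp]: "rot_act (mat 1) \<rho> = \<rho>"
  by (simp add: rot_act_def vec_eq_iff)

lemma poltI: "ssum UNIV \<rho> = 0 \<Longrightarrow> (\<And>e. norm (\<rho> $ e) = len e) \<Longrightarrow> \<rho> \<in> polt len"
  by (simp add: polt_def)

lemma polt_sum: "\<rho> \<in> polt len \<Longrightarrow> ssum UNIV \<rho> = 0"
  and polt_norm: "\<rho> \<in> polt len \<Longrightarrow> norm (\<rho> $ e) = len e"
  by (simp_all add: polt_def)

lemma polt_Compl: "\<rho> \<in> polt len \<Longrightarrow> ssum (- A) \<rho> = - ssum A \<rho>"
  using ssum_split[of A UNIV \<rho>] polt_sum[of \<rho> len]
  by (simp add: Compl_eq_Diff_UNIV eq_neg_iff_add_eq_0 add.commute)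

lemma polt_rot_act: "rotation_matrix R \<Longrightarrow> \<rho> \<in> polt len \<Longrightarrow> rot_act R \<rho> \<in> polt len"
  by (rule poltI)
    (simp add: ssum_rot_act polt_sum, simp add: rot_act_def rotation_matrix_norm polt_norm)

lemma equiv_SO3_rel: "equiv (polt len) (SO3_rel len)"
proof (rule equivI)
  show "refl_on (polt len) (SO3_rel len)"
    using rotation_matrix_id by (auto simp: refl_on_def SO3_rel_def intro!: exI[of _ "mat 1"])
  show "sym (SO3_rel len)"
  proof (rule symI)
    fix \<rho> \<sigma> :: "'a config" assume "(\<rho>, \<sigma>) \<in> SO3_rel len"
    then obtain R where R: "\<rho> \<in> polt len" "\<sigma> \<in> polt len" "rotation_matrix R" "\<sigma> = rot_act R \<rho>"
      by (auto simp: SO3_rel_def)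
    have "rot_act (transpose R) \<sigma> = (\<chi> e. transpose R *v (R *v (\<rho> $ e)))"
      by (simp add: R(4) rot_act_def del: transpose_matrix_vector)
    then have "\<rho> = rot_act (transpose R) \<sigma>"
      by (simp only: transpose_rotation_cancel[OF R(3)] vec_lambda_eta)
    then show "(\<sigma>, \<rho>) \<in> SO3_rel len"
      using R rotation_matrix_transpose by (auto simp: SO3_rel_def)
  qed
  show "trans (SO3_rel len)"
  proof (rule transI)
    fix \<rho> \<sigma> \<tau> :: "'a config" assume "(\<rho>, \<sigma>) \<in> SO3_rel len" "(\<sigma>, \<tau>) \<in> SO3_rel len"
    then obtain R S where "\<rho> \<in> polt len" "\<tau> \<in> polt len" "rotation_matrix R" "rotation_matrix S"
      "\<tau> = rot_act (S ** R) \<rho>"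
      by (auto simp: SO3_rel_def rot_act_mult)
    then show "(\<rho>, \<tau>) \<in> SO3_rel len"
      using rotation_matrix_mul[of S R] unfolding SO3_rel_def by blast
  qed
qed (auto simp: SO3_rel_def)

lemma cls_in_Pol: "\<rho> \<in> polt len \<Longrightarrow> cls len \<rho> \<in> Pol len"
  by (simp add: Pol_def cls_def quotientI)

lemma Pol_cases:
  assumes "c \<in> Pol len"
  obtains \<rho> where "\<rho> \<in> polt len" "c = cls len \<rho>"
  using assms by (auto simp: Pol_def cls_def elim: quotientE)

lemma cls_eq_iff:
  assumes "\<rho> \<in> polt len" "\<sigma> \<in> polt len"
  shows "cls len \<rho> = cls len \<sigma> \<longleftrightarrow> (\<exists>R. rotation_matrix R \<and> \<sigma> = rot_act R \<rho>)"
  using eq_equiv_class_iff[OF equiv_SO3_rel assms] assms by (auto simp: cls_def SO3_rel_def)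

lemma cls_rot_act:
  "rotation_matrix R \<Longrightarrow> \<rho> \<in> polt len \<Longrightarrow> cls len (rot_act R \<rho>) = cls len \<rho>"
  by (metis cls_eq_iff polt_rot_act)


subsection \<open>Maps of the polygon space induced by equivariant maps\<close>

definition equivariant :: "('e::finite \<Rightarrow> real) \<Rightarrow> ('e config \<Rightarrow> 'e config) \<Rightarrow> bool" where
  "equivariant len G \<longleftrightarrow>
     (\<forall>\<rho>\<in>polt len. G \<rho> \<in> polt len \<and>
        (\<forall>R. rotation_matrix R \<longrightarrow> G (rot_act R \<rho>) = rot_act R (G \<rho>)))"

definition induced_map ::
    "('e::finite \<Rightarrow> real) \<Rightarrow> ('e config \<Rightarrow> 'e config) \<Rightarrow> 'e config set \<Rightarrow> 'e config set" where
  "induced_map len G = (\<lambda>c\<in>Pol len. cls len (G (SOME \<rho>. \<rho> \<in> polt len \<and> c = cls len \<rho>)))"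

lemma induced_map_cls:
  assumes "equivariant len G" "\<rho> \<in> polt len"
  shows "induced_map len G (cls len \<rho>) = cls len (G \<rho>)"
proof -
  define \<sigma> where "\<sigma> = (SOME \<sigma>. \<sigma> \<in> polt len \<and> cls len \<rho> = cls len \<sigma>)"
  have \<sigma>: "\<sigma> \<in> polt len" "cls len \<rho> = cls len \<sigma>"
    using someI[of "\<lambda>\<sigma>. \<sigma> \<in> polt len \<and> cls len \<rho> = cls len \<sigma>" \<rho>] assms(2)
    by (simp_all add: \<sigma>_def)
  then obtain R where "rotation_matrix R" "\<sigma> = rot_act R \<rho>"
    using cls_eq_iff assms(2) by metis
  then have "cls len (G \<sigma>) = cls len (G \<rho>)"
    using assms by (simp add: equivariant_def cls_rot_act)
  then show ?thesis
    using assms(2) by (simp add: induced_map_def cls_in_Pol \<sigma>_def)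
qed

lemma induced_map_eqI:
  assumes "equivariant len G" "\<phi> \<in> extensional (Pol len)"
    and "\<And>\<rho>. \<rho> \<in> polt len \<Longrightarrow> \<phi> (cls len \<rho>) = cls len (G \<rho>)"
  shows "\<phi> = induced_map len G"
proof (rule extensionalityI[OF assms(2)])
  show "induced_map len G \<in> extensional (Pol len)" by (simp add: induced_map_def)
  fix c assume "c \<in> Pol len"
  then show "\<phi> c = induced_map len G c"
    using assms by (metis Pol_cases induced_map_cls)
qed

lemma induced_map_cong:
  assumes "equivariant len H" "\<And>\<rho>. \<rho> \<in> polt len \<Longrightarrow> cls len (G \<rho>) = cls len (H \<rho>)"
    "equivariant len G"
  shows "induced_map len G = induced_map len H"
  using assms by (intro induced_map_eqI) (auto simp: induced_map_cls, simp add: induced_map_def)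

lemma equivariant_compose:
  "equivariant len G \<Longrightarrow> equivariant len H \<Longrightarrow> equivariant len (\<lambda>\<rho>. G (H \<rho>))"
  by (simp add: equivariant_def)

lemma equivariant_id: "equivariant len (\<lambda>\<rho>. \<rho>)"
  by (simp add: equivariant_def)

lemma induced_map_id: "induced_map len (\<lambda>\<rho>. \<rho>) = \<one>\<^bsub>BijGroup (Pol len)\<^esub>"
  by (rule induced_map_eqI[OF equivariant_id, symmetric]) (auto simp: BijGroup_def cls_in_Pol)

lemma induced_map_Bij:
  assumes "equivariant len G" "equivariant len H"
    and "\<And>\<rho>. \<rho> \<in> polt len \<Longrightarrow> G (H \<rho>) = \<rho>" "\<And>\<rho>. \<rho> \<in> polt len \<Longrightarrow> H (G \<rho>) = \<rho>"
  shows "induced_map len G \<in> carrier (BijGroup (Pol len))"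
proof -
  have "bij_betw (induced_map len G) (Pol len) (Pol len)"
  proof (rule bij_betw_byWitness[where f' = "induced_map len H"])
    show "\<forall>c\<in>Pol len. induced_map len H (induced_map len G c) = c"
      "\<forall>c\<in>Pol len. induced_map len G (induced_map len H c) = c"
      "induced_map len G ` Pol len \<subseteq> Pol len" "induced_map len H ` Pol len \<subseteq> Pol len"
      using assms by (auto elim!: Pol_cases simp: induced_map_cls equivariant_def cls_in_Pol)
  qed
  then show ?thesis by (simp add: BijGroup_def Bij_def induced_map_def)
qed

lemma mult_cls:
  assumes "\<phi> \<in> carrier (BijGroup (Pol len))" "\<psi> \<in> carrier (BijGroup (Pol len))" "\<rho> \<in> polt len"
  shows "(\<phi> \<otimes>\<^bsub>BijGroup (Pol len)\<^esub> \<psi>) (cls len \<rho>) = \<phi> (\<psi> (cls len \<rho>))"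
  using assms by (simp add: BijGroup_def compose_def cls_in_Pol)

lemma induced_map_mult:
  assumes "equivariant len G" "equivariant len H"
    and "induced_map len G \<in> carrier (BijGroup (Pol len))"
    and "induced_map len H \<in> carrier (BijGroup (Pol len))"
  shows "induced_map len G \<otimes>\<^bsub>BijGroup (Pol len)\<^esub> induced_map len H
       = induced_map len (\<lambda>\<rho>. G (H \<rho>))"
proof (rule induced_map_eqI[OF equivariant_compose[OF assms(1,2)]])
  interpret group "BijGroup (Pol len)" by (rule group_BijGroup)
  have "induced_map len G \<otimes>\<^bsub>BijGroup (Pol len)\<^esub> induced_map len H
    \<in> carrier (BijGroup (Pol len))" using assms by simp
  then show "induced_map len G \<otimes>\<^bsub>BijGroup (Pol len)\<^esub> induced_map len H \<in> extensional (Pol len)"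
    by (simp add: BijGroup_def Bij_def)
  fix \<rho> assume "\<rho> \<in> polt len"
  then show "(induced_map len G \<otimes>\<^bsub>BijGroup (Pol len)\<^esub> induced_map len H) (cls len \<rho>)
      = cls len (G (H \<rho>))"
    using assms by (simp add: mult_cls induced_map_cls equivariant_def)
qed


subsection \<open>Genericity\<close>

text \<open>A collinear polygon would exhibit a choice of signs annihilating the lengths.\<close>

lemma polt_not_collinear:
  assumes "\<And>e. len e > 0" "generic len" "\<rho> \<in> polt len"
  obtains e f where "\<rho> $ e \<times> \<rho> $ f \<noteq> 0"
proof -
  have "\<exists>e f. \<rho> $ e \<times> \<rho> $ f \<noteq> 0"
  proof (rule ccontr)
    assume "\<not> ?thesis"
    then have par: "\<rho> $ e \<times> \<rho> $ f = 0" for e f by blast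
    obtain e0 :: 'a where True by blast
    define x where "x = \<rho> $ e0"
    have x: "norm x = len e0" using assms(3) by (simp add: x_def polt_norm)
    have ab: "\<bar>\<rho> $ e \<bullet> x\<bar> = len e * len e0" for e
    proof (rule power2_eq_imp_eq)
      have "\<rho> $ e \<times> x = 0" unfolding x_def by (rule par)
      then show "\<bar>\<rho> $ e \<bullet> x\<bar>\<^sup>2 = (len e * len e0)\<^sup>2"
        using norm_cross_dot[of "\<rho> $ e" x] by (simp add: x polt_norm[OF assms(3)])
      show "0 \<le> len e * len e0" by (simp add: assms(1) less_imp_le)
    qed simp
    define \<epsilon> where "\<epsilon> e = sgn (\<rho> $ e \<bullet> x)" for e
    have eq: "\<epsilon> e * len e * len e0 = \<rho> $ e \<bullet> x" for e
      unfolding \<epsilon>_def mult.assoc ab[symmetric] by (rule sgn_mult_abs)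
    have "(\<Sum>e\<in>UNIV. \<epsilon> e * len e) * len e0 = ssum UNIV \<rho> \<bullet> x"
      by (simp add: sum_distrib_right eq inner_sum_left)
    then have "(\<Sum>e\<in>UNIV. \<epsilon> e * len e) = 0"
      using polt_sum[OF assms(3)] assms(1)[of e0] by simp
    moreover have "\<epsilon> e \<in> {-1, 1}" for e
      using ab[of e] assms(1)[of e] assms(1)[of e0] by (auto simp: \<epsilon>_def sgn_if split: if_splits)
    ultimately show False using assms(2) by (auto simp: generic_def)
  qed
  with that show ?thesis by blast
qed

text \<open>
  The rotation is the one that matches the frames spanned by two independent vectors and their
  cross product; the triple products exclude a reflection for the remaining vectors.
\<close>

lemma same_products_imp_rotation:
  fixes \<sigma> \<tau> :: "'e::finite config"
  assumes ip: "\<And>e f. \<sigma> $ e \<bullet> \<sigma> $ f = \<tau> $ e \<bullet> \<tau> $ f"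
    and tp: "\<And>e f g. \<sigma> $ e \<bullet> (\<sigma> $ f \<times> \<sigma> $ g) = \<tau> $ e \<bullet> (\<tau> $ f \<times> \<tau> $ g)"
    and nc: "\<sigma> $ a \<times> \<sigma> $ b \<noteq> 0"
  shows "\<exists>R. rotation_matrix R \<and> \<tau> = rot_act R \<sigma>"
proof -
  define M :: "real^3^3" where "M = vector [\<sigma> $ a, \<sigma> $ b, \<sigma> $ a \<times> \<sigma> $ b]"
  define N :: "real^3^3" where "N = vector [\<tau> $ a, \<tau> $ b, \<tau> $ a \<times> \<tau> $ b]"
  have Mv: "M *v x = vector [\<sigma> $ a \<bullet> x, \<sigma> $ b \<bullet> x, (\<sigma> $ a \<times> \<sigma> $ b) \<bullet> x]" for x
    by (simp add: M_def vec_eq_iff forall_3 matrix_vector_mul_component)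
  have Nv: "N *v x = vector [\<tau> $ a \<bullet> x, \<tau> $ b \<bullet> x, (\<tau> $ a \<times> \<tau> $ b) \<bullet> x]" for x
    by (simp add: N_def vec_eq_iff forall_3 matrix_vector_mul_component)
  have detM: "det M = (\<sigma> $ a \<times> \<sigma> $ b) \<bullet> (\<sigma> $ a \<times> \<sigma> $ b)"
    unfolding M_def dot_cross_det[symmetric]
    by (metis triple_rotate inner_commute)
  have detN: "det N = (\<tau> $ a \<times> \<tau> $ b) \<bullet> (\<tau> $ a \<times> \<tau> $ b)"
    unfolding N_def dot_cross_det[symmetric]
    by (metis triple_rotate inner_commute)
  have "(X ** transpose X) $ i $ j = X $ i \<bullet> X $ j" for X :: "real^3^3" and i j
    by (simp add: matrix_matrix_mult_def transpose_def inner_vec_def)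
  then have MN: "M ** transpose M = N ** transpose N"
    by (simp add: vec_eq_iff forall_3)
      (simp add: M_def N_def dot_cross_self inner_cross_cross ip)
  have "det M = det N"
    by (simp add: detM detN inner_cross_cross ip)
  have "det M \<noteq> 0" using nc detM by simp
  then obtain M' where M': "M ** M' = mat 1" "M' ** M = mat 1"
    by (metis invertible_det_nz invertible_def)
  have "det N \<noteq> 0" using \<open>det M = det N\<close> \<open>det M \<noteq> 0\<close> by simp
  then obtain N' where N': "N ** N' = mat 1" "N' ** N = mat 1"
    by (metis invertible_det_nz invertible_def)
  define R where "R = N' ** M"
  have "R ** transpose R = N' ** (M ** transpose M) ** transpose N'"
    by (simp add: R_def matrix_transpose_mul matrix_mul_assoc)
  also have "\<dots> = (N' ** N) ** transpose (N' ** N)"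
    by (simp add: MN matrix_transpose_mul matrix_mul_assoc)
  finally have "R ** transpose R = mat 1" by (simp add: N' transpose_mat)
  then have orth: "orthogonal_matrix R"
    by (metis matrix_left_right_inverse orthogonal_matrix)
  have "det N' * det M = 1"
    using \<open>det M = det N\<close> N'(2) by (metis det_I det_mul)
  then have rot: "rotation_matrix R"
    by (simp add: rotation_matrix_def orth) (simp add: R_def det_mul)
  have "R *v \<sigma> $ e = \<tau> $ e" for e
  proof -
    have "M *v \<sigma> $ e = N *v \<tau> $ e"
      using tp[of e a b] by (simp add: Mv Nv ip inner_commute)
    then have "R *v \<sigma> $ e = (N' ** N) *v \<tau> $ e"
      by (simp add: R_def flip: matrix_vector_mul_assoc)
    then show ?thesis by (simp add: N')
  qed
  then show ?thesis using rot by (intro exI[of _ R]) (simp add: rot_act_def vec_eq_iff)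
qed


section \<open>Bending\<close>

text \<open>
  If the sum over \<open>A\<close> vanishes, the axis is \<open>0\<close> and the formula is not a rotation; polygons with
  this property are excluded by \<open>nonvanishing\<close> below.
\<close>

definition bend :: "'e::finite set \<Rightarrow> real \<Rightarrow> 'e config \<Rightarrow> 'e config" where
  "bend A t \<rho> = (\<chi> e. if e \<in> A then rot (sgn (ssum A \<rho>)) t (\<rho> $ e) else \<rho> $ e)"

lemma bend_nth:
  "bend A t \<rho> $ e = (if e \<in> A then rot (sgn (ssum A \<rho>)) t (\<rho> $ e) else \<rho> $ e)"
  by (simp add: bend_def)

lemma config_eqI: "(\<And>e. \<rho> $ e = \<sigma> $ e) \<Longrightarrow> \<rho> = (\<sigma> :: 'e::finite config)"
  by (simp add: vec_eq_iff[of \<rho>])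

definition nonvanishing :: "('e::finite \<Rightarrow> real) \<Rightarrow> 'e set \<Rightarrow> bool" where
  "nonvanishing len A \<longleftrightarrow> (\<forall>\<rho>\<in>polt len. ssum A \<rho> \<noteq> 0)"

lemma nonvanishingD: "nonvanishing len A \<Longrightarrow> \<rho> \<in> polt len \<Longrightarrow> ssum A \<rho> \<noteq> 0"
  by (simp add: nonvanishing_def)

lemma norm_sgn_ssum: "nonvanishing len A \<Longrightarrow> \<rho> \<in> polt len \<Longrightarrow> norm (sgn (ssum A \<rho>)) = 1"
  by (simp add: norm_sgn nonvanishingD)

lemma nonvanishing_Compl: "nonvanishing len A \<Longrightarrow> nonvanishing len (- A)"
  by (simp add: nonvanishing_def polt_Compl)

text \<open>The dominant edge of a lopsided set cannot be cancelled by the others.\<close>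

lemma lopsided_nonvanishing:
  assumes "lopsided len A"
  shows "nonvanishing len A"
  unfolding nonvanishing_def
proof
  fix \<rho> assume \<rho>: "\<rho> \<in> polt len"
  obtain e0 where e0: "e0 \<in> A" "len e0 > (\<Sum>e\<in>A - {e0}. len e)"
    using assms by (auto simp: lopsided_def)
  have "norm (ssum (A - {e0}) \<rho>) \<le> (\<Sum>e\<in>A - {e0}. len e)"
    by (rule order_trans[OF norm_sum]) (simp add: polt_norm[OF \<rho>])
  then have "norm (ssum (A - {e0}) \<rho>) < norm (\<rho> $ e0)" using e0 by (simp add: polt_norm[OF \<rho>])
  moreover have "ssum A \<rho> = \<rho> $ e0 + ssum (A - {e0}) \<rho>" using e0 by (simp add: sum.remove)
  ultimately show "ssum A \<rho> \<noteq> 0"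
    by (metis add_eq_0_iff norm_minus_cancel order_less_irrefl)
qed

lemma bend_zero [simp]: "bend A 0 \<rho> = \<rho>"
  by (simp add: bend_def vec_eq_iff)

lemma bend_full_turns: "bend A (2 * pi * of_int n) \<rho> = \<rho>"
  by (simp add: bend_def vec_eq_iff)

lemma ssum_bend_subset:
  "B \<subseteq> A \<Longrightarrow> ssum B (bend A t \<rho>) = rot (sgn (ssum A \<rho>)) t (ssum B \<rho>)"
  by (simp add: bend_def rot_sum subset_iff cong: sum.cong)

lemma ssum_bend_disjoint: "B \<inter> A = {} \<Longrightarrow> ssum B (bend A t \<rho>) = ssum B \<rho>"
  by (rule sum.cong) (auto simp: bend_def)

lemma ssum_bend_superset: "A \<subseteq> B \<Longrightarrow> ssum B (bend A t \<rho>) = ssum B \<rho>"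
  using ssum_split[of A B "bend A t \<rho>"] ssum_split[of A B \<rho>]
  by (simp add: ssum_bend_disjoint Diff_Int_distrib2 ssum_bend_subset rot_sgn_self)

lemma bend_polt:
  assumes "\<rho> \<in> polt len" "ssum A \<rho> \<noteq> 0"
  shows "bend A t \<rho> \<in> polt len"
proof (rule poltI)
  show "ssum UNIV (bend A t \<rho>) = 0" by (simp add: ssum_bend_superset polt_sum[OF assms(1)])
  show "norm (bend A t \<rho> $ e) = len e" for e
    using assms by (simp add: bend_def norm_rot norm_sgn polt_norm)
qed

lemma bend_add_angle:
  "ssum A \<rho> \<noteq> 0 \<Longrightarrow> bend A s (bend A t \<rho>) = bend A (s + t) \<rho>"
  by (rule config_eqI, simp only: bend_nth[of A s "bend A t \<rho>"] ssum_bend_superset subset_refl)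
    (simp add: bend_nth rot_add_angle norm_sgn)

lemma bend_rot_act:
  "rotation_matrix R \<Longrightarrow> bend A t (rot_act R \<rho>) = rot_act R (bend A t \<rho>)"
  by (simp add: bend_def ssum_rot_act rotation_matrix_sgn vec_eq_iff)
    (simp add: rot_act_def rot_conjugate)

lemma equivariant_bend: "nonvanishing len A \<Longrightarrow> equivariant len (bend A t)"
  by (simp add: equivariant_def bend_polt bend_rot_act nonvanishingD)

lemma rot_rot: "norm b = 1 \<Longrightarrow> rot b t (rot u s x) = rot (rot b t u) s (rot b t x)"
  using rot_conjugate[OF rotation_matrix_rot, of b t u s x] by (simp add: rot_matrix)

lemma sgn_rot: "norm b = 1 \<Longrightarrow> sgn (rot b t v) = rot b t (sgn v)"
  by (simp add: sgn_div_norm norm_rot rot_scaleR)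

text \<open>Bending along the larger set carries the axis of the smaller set along with its edges.\<close>

lemma bend_commute_subset:
  assumes "A \<subseteq> B" "ssum B \<rho> \<noteq> 0"
  shows "bend A s (bend B t \<rho>) = bend B t (bend A s \<rho>)"
proof -
  have b: "norm (sgn (ssum B \<rho>)) = 1" using assms by (simp add: norm_sgn)
  show ?thesis
    using assms(1)
    by (intro config_eqI, simp only: bend_nth[of A s "bend B t \<rho>"] bend_nth[of B t "bend A s \<rho>"]
        ssum_bend_subset[OF assms(1)] ssum_bend_superset[OF assms(1)] sgn_rot[OF b])
      (auto simp: bend_nth rot_rot[OF b])
qed

lemma bend_commute_disjoint:
  assumes "A \<inter> B = {}"
  shows "bend A s (bend B t \<rho>) = bend B t (bend A s \<rho>)"
proof -
  have s: "ssum A (bend B t \<rho>) = ssum A \<rho>" "ssum B (bend A s \<rho>) = ssum B \<rho>"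
    using assms by (simp_all add: ssum_bend_disjoint Int_commute)
  show ?thesis
    using assms
    by (intro config_eqI, simp only: bend_nth[of A s "bend B t \<rho>"] bend_nth[of B t "bend A s \<rho>"] s)
      (auto simp: bend_nth)
qed

lemma bend_commute:
  assumes "A \<inter> B = {} \<or> A \<subseteq> B \<or> B \<subseteq> A" "ssum A \<rho> \<noteq> 0" "ssum B \<rho> \<noteq> 0"
  shows "bend A s (bend B t \<rho>) = bend B t (bend A s \<rho>)"
  using assms bend_commute_subset bend_commute_disjoint by metis

text \<open>
  Rotating the complement about its own axis, which is opposite, is rotating \<open>A\<close> up to a global
  rotation.
\<close>

lemma bend_Compl:
  assumes "\<rho> \<in> polt len" "ssum A \<rho> \<noteq> 0"
  shows "bend (- A) t \<rho> = rot_act (matrix (rot (sgn (ssum A \<rho>)) (- t))) (bend A t \<rho>)"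
  by (rule config_eqI, simp only: bend_nth[of "- A"] polt_Compl[OF assms(1)] sgn_minus rot_uminus_axis)
    (simp add: rot_act_def rot_matrix bend_nth rot_inverse norm_sgn assms)


section \<open>Hamiltonian flows\<close>

lemma bounded_bilinear_cross: "bounded_bilinear (\<times>)"
  using bilinear_cross bilinear_conv_bounded_bilinear by blast

lemma kks_generator: "norm z = s \<Longrightarrow> s > 0 \<Longrightarrow> z \<bullet> w = 0 \<Longrightarrow> kks s z (u \<times> z) w = u \<bullet> w"
proof -
  assume "norm z = s" "s > 0" "z \<bullet> w = 0"
  then show ?thesis
    by (simp add: kks_def cross_cross_left power2_norm_eq_inner[symmetric] inner_diff_right)
qed

lemma kks_cross: "kks s z v w = w \<bullet> (z \<times> v) / s\<^sup>2"
  unfolding kks_def by (metis triple_rotate)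

lemma orbit_prod_form_diff:
  "orbit_prod_form len \<rho> (v - v') w = orbit_prod_form len \<rho> v w - orbit_prod_form len \<rho> v' w"
  by (simp add: orbit_prod_form_def kks_cross Cross3.right_diff_distrib inner_diff_right
      diff_divide_distrib sum_subtractf)

text \<open>
  The kernel of the form on the zero level consists of the directions of the group orbit.  The
  form pairs \<open>v\<close> with \<open>w\<close> as the sum of \<open>w\<^sub>e \<bullet> y\<^sub>e\<close>; a functional of this shape which vanishes
  whenever the \<open>w\<^sub>e\<close> add up to \<open>0\<close> depends only on their sum.  The vectors \<open>p c\<close> and \<open>q c\<close>
  realize a prescribed sum \<open>c\<close> on two independent edges.
\<close>

lemma orbit_prod_form_kernel:
  fixes len :: "'e::finite \<Rightarrow> real"
  assumes len: "\<And>e. len e > 0" "generic len" and \<rho>: "\<rho> \<in> polt len"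
    and v: "v \<in> polt_tangent len \<rho>"
    and z: "\<And>w. w \<in> polt_tangent len \<rho> \<Longrightarrow> orbit_prod_form len \<rho> v w = 0"
  shows "\<exists>\<xi>. \<forall>e. v $ e = \<xi> \<times> \<rho> $ e"
proof -
  obtain a b where ab: "\<rho> $ a \<times> \<rho> $ b \<noteq> 0"
    using polt_not_collinear[OF len \<rho>] by blast
  then have "a \<noteq> b" by auto
  define n d where "n = \<rho> $ a \<times> \<rho> $ b" and "d = \<rho> $ b \<times> n"
  have da: "d \<bullet> \<rho> $ a = n \<bullet> n"
    unfolding d_def by (metis inner_commute n_def triple_rotate)
  have db: "d \<bullet> \<rho> $ b = 0" by (simp add: d_def dot_cross_self)
  have nn: "n \<bullet> n \<noteq> 0" using ab by (simp add: n_def)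
  define q where "q c = ((c \<bullet> \<rho> $ a) / (n \<bullet> n)) *\<^sub>R d" for c
  define p where "p c = c - q c" for c
  have pa: "p c \<bullet> \<rho> $ a = 0" and qb: "q c \<bullet> \<rho> $ b = 0" for c
    using nn by (simp_all add: p_def q_def inner_diff_left da db)
  define y where "y e = (1 / (len e)\<^sup>2) *\<^sub>R (\<rho> $ e \<times> v $ e)" for e
  have form: "orbit_prod_form len \<rho> v w = (\<Sum>e\<in>UNIV. w $ e \<bullet> y e)" for w
    by (simp add: orbit_prod_form_def kks_cross y_def)
  define h where "h c = p c \<bullet> y a + q c \<bullet> y b" for c
  have "linear h"
    by (rule linearI)
      (simp_all add: h_def p_def q_def inner_add_left inner_diff_left add_divide_distrib
        scaleR_add_left algebra_simps)
  define \<xi> where "\<xi> = adjoint h 1"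
  have \<xi>: "h c = \<xi> \<bullet> c" for c
    using adjoint_works[OF \<open>linear h\<close>, of c 1] by (simp add: \<xi>_def inner_commute)
  have y\<xi>: "x \<bullet> y e = x \<bullet> \<xi>" if x: "x \<bullet> \<rho> $ e = 0" for e x
  proof -
    define w where "w = axis e x - axis a (p x) - axis b (q x)"
    have wf: "w $ f = (if f = e then x else 0) - (if f = a then p x else 0)
        - (if f = b then q x else 0)" for f
      by (simp add: w_def axis_def)
    have "w $ f \<bullet> \<rho> $ f = 0" for f
      by (simp add: wf inner_diff_left x pa qb)
    moreover have "ssum UNIV w = 0"
      by (simp add: wf sum_subtractf p_def)
    ultimately have "orbit_prod_form len \<rho> v w = 0"
      by (intro z) (simp add: polt_tangent_def)
    moreover have "w $ f \<bullet> y f = (if f = e then x \<bullet> y e else 0) - (if f = a then p x \<bullet> y a else 0)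
        - (if f = b then q x \<bullet> y b else 0)" for f
      by (simp add: wf inner_diff_left)
    ultimately have "x \<bullet> y e = h x"
      by (simp add: form sum_subtractf h_def)
    then show ?thesis by (simp add: \<xi> inner_commute)
  qed
  have "v $ e = \<xi> \<times> \<rho> $ e" for e
  proof -
    define r where "r = (y e - \<xi>) \<times> \<rho> $ e"
    have "(r \<times> \<rho> $ e) \<bullet> (y e - \<xi>) = 0"
      using y\<xi>[of "r \<times> \<rho> $ e" e] by (simp add: dot_cross_self inner_diff_right)
    moreover have "(r \<times> \<rho> $ e) \<bullet> (y e - \<xi>) = - (r \<bullet> r)"
      by (subst (3) r_def) (metis cross_skew inner_commute inner_minus_right triple_rotate)
    ultimately have "r = 0" by simp
    then have "y e \<times> \<rho> $ e = \<xi> \<times> \<rho> $ e"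
      by (simp add: r_def Cross3.left_diff_distrib)
    moreover have "y e \<times> \<rho> $ e = v $ e"
      using v len(1)[of e] polt_norm[OF \<rho>, of e]
      by (simp add: y_def cross_mult_left cross_cross_left polt_tangent_def
          power2_norm_eq_inner[symmetric])
    ultimately show ?thesis by simp
  qed
  then show ?thesis by blast
qed

definition bend_field :: "'e::finite set \<Rightarrow> 'e config \<Rightarrow> 'e config" where
  "bend_field A \<rho> = (\<chi> e. if e \<in> A then sgn (ssum A \<rho>) \<times> \<rho> $ e else 0)"

lemma ssum_bend_field: "ssum UNIV (bend_field A \<rho>) = 0"
proof -
  have "ssum UNIV (bend_field A \<rho>) = (\<Sum>e\<in>A. sgn (ssum A \<rho>) \<times> \<rho> $ e)"
    by (simp add: bend_field_def sum.If_cases)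
  also have "\<dots> = sgn (ssum A \<rho>) \<times> ssum A \<rho>"
    by (simp add: bounded_bilinear.sum_right[OF bounded_bilinear_cross])
  finally show ?thesis by (simp add: sgn_div_norm cross_mult_left)
qed

lemma bend_field_tangent: "bend_field A \<rho> \<in> polt_tangent len \<rho>"
  by (simp add: polt_tangent_def ssum_bend_field) (simp add: bend_field_def dot_cross_self)

lemma form_bend_field:
  assumes "\<And>e. len e > 0" "\<rho> \<in> polt len" "w \<in> polt_tangent len \<rho>"
  shows "orbit_prod_form len \<rho> (bend_field A \<rho>) w = sgn (ssum A \<rho>) \<bullet> ssum A w"
proof -
  have "kks (len e) (\<rho> $ e) (bend_field A \<rho> $ e) (w $ e)
      = (if e \<in> A then sgn (ssum A \<rho>) \<bullet> w $ e else 0)" for e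
    using assms kks_generator[of "\<rho> $ e" "len e" "w $ e"]
    by (simp add: bend_field_def polt_norm polt_tangent_def inner_commute) (simp add: kks_def)
  then show ?thesis
    by (simp add: orbit_prod_form_def sum.If_cases inner_sum_right)
qed

lemma bounded_linear_ssum: "bounded_linear (ssum A)"
  by (intro bounded_linear_sum bounded_linear_vec_nth)

lemma bending_hamiltonian_derivative:
  assumes "ssum A \<rho> \<noteq> 0"
  shows "(bending_hamiltonian A has_derivative (\<lambda>w. sgn (ssum A \<rho>) \<bullet> ssum A w)) (at \<rho>)"
  using has_derivative_compose[OF bounded_linear_imp_has_derivative[OF bounded_linear_ssum]
      has_derivative_norm[OF assms]]
  by (simp add: bending_hamiltonian_def[abs_def] inner_commute)

lemma frechet_bending_hamiltonian:
  "ssum A \<rho> \<noteq> 0 \<Longrightarrow>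
    frechet_derivative (bending_hamiltonian A) (at \<rho>) = (\<lambda>w. sgn (ssum A \<rho>) \<bullet> ssum A w)"
  by (rule frechet_derivative_at[OF bending_hamiltonian_derivative, symmetric])

lemma rot_has_vector_derivative:
  assumes "(\<tau> has_real_derivative \<tau>') (at t)" "(u has_vector_derivative u') (at t)"
    "(x has_vector_derivative x') (at t)"
  shows "((\<lambda>t. rot (u t) (\<tau> t) (x t)) has_vector_derivative
      \<tau>' *\<^sub>R (- sin (\<tau> t) *\<^sub>R x t + cos (\<tau> t) *\<^sub>R (u t \<times> x t) + (sin (\<tau> t) * (u t \<bullet> x t)) *\<^sub>R u t)
      + (cos (\<tau> t) *\<^sub>R x' + sin (\<tau> t) *\<^sub>R (u' \<times> x t + u t \<times> x')
      + (1 - cos (\<tau> t)) *\<^sub>R ((u' \<bullet> x t + u t \<bullet> x') *\<^sub>R u t + (u t \<bullet> x t) *\<^sub>R u'))) (at t)"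
proof -
  have c: "((\<lambda>t. cos (\<tau> t)) has_real_derivative - sin (\<tau> t) * \<tau>') (at t)"
    and s: "((\<lambda>t. sin (\<tau> t)) has_real_derivative cos (\<tau> t) * \<tau>') (at t)"
    using assms(1) by (auto intro!: derivative_eq_intros)
  have ux: "((\<lambda>t. u t \<times> x t) has_vector_derivative u t \<times> x' + u' \<times> x t) (at t)"
    by (rule bounded_bilinear.has_vector_derivative[OF bounded_bilinear_cross assms(2,3)])
  have ip: "((\<lambda>t. u t \<bullet> x t) has_real_derivative u t \<bullet> x' + u' \<bullet> x t) (at t)"
    using bounded_bilinear.has_vector_derivative[OF bounded_bilinear_inner assms(2,3)]
    by (simp add: has_real_derivative_iff_has_vector_derivative)
  have k: "((\<lambda>t. (1 - cos (\<tau> t)) * (u t \<bullet> x t)) has_real_derivative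
      (1 - cos (\<tau> t)) * (u t \<bullet> x' + u' \<bullet> x t) + (sin (\<tau> t) * \<tau>') * (u t \<bullet> x t)) (at t)"
    by (rule derivative_eq_intros c ip refl | simp)+
  show ?thesis
    unfolding rot_def
    by (rule has_vector_derivative_eq_rhs[OF has_vector_derivative_add[OF has_vector_derivative_add
            [OF has_vector_derivative_scaleR[OF c assms(3)] has_vector_derivative_scaleR[OF s ux]]
            has_vector_derivative_scaleR[OF k assms(2)]]])
      (simp add: algebra_simps)
qed


lemma polt_curve_tangent:
  assumes "\<And>t. \<gamma> t \<in> polt len" "(\<gamma> has_vector_derivative \<gamma>') (at t)"
  shows "\<gamma>' \<in> polt_tangent len (\<gamma> t)"
proof -
  have d: "((\<lambda>t. \<gamma> t $ e) has_vector_derivative \<gamma>' $ e) (at t)" for e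
    by (rule bounded_linear.has_vector_derivative[OF bounded_linear_vec_nth assms(2)])
  have "\<gamma>' $ e \<bullet> \<gamma> t $ e = 0" for e
  proof -
    have "((\<lambda>t. \<gamma> t $ e \<bullet> \<gamma> t $ e) has_vector_derivative \<gamma> t $ e \<bullet> \<gamma>' $ e + \<gamma>' $ e \<bullet> \<gamma> t $ e) (at t)"
      by (rule bounded_bilinear.has_vector_derivative[OF bounded_bilinear_inner d d])
    moreover have "(\<lambda>t. \<gamma> t $ e \<bullet> \<gamma> t $ e) = (\<lambda>t. (len e)\<^sup>2)"
      by (simp add: polt_norm[OF assms(1)] flip: power2_norm_eq_inner)
    ultimately have "\<gamma> t $ e \<bullet> \<gamma>' $ e + \<gamma>' $ e \<bullet> \<gamma> t $ e = 0"
      using vector_derivative_unique_at has_vector_derivative_const by metis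
    then show ?thesis by (simp add: inner_commute)
  qed
  moreover have "ssum UNIV \<gamma>' = 0"
  proof -
    have "((\<lambda>t. ssum UNIV (\<gamma> t)) has_vector_derivative ssum UNIV \<gamma>') (at t)"
      by (rule bounded_linear.has_vector_derivative[OF bounded_linear_ssum assms(2)])
    then show ?thesis
      using vector_derivative_unique_at[OF has_vector_derivative_const]
      by (simp add: polt_sum[OF assms(1)]) fastforce
  qed
  ultimately show ?thesis by (simp add: polt_tangent_def)
qed

text \<open>The inner and triple products of the edges have derivative \<open>0\<close>.\<close>

lemma infinitesimal_rotation_imp_rotation:
  fixes \<sigma> :: "real \<Rightarrow> 'e::finite config"
  assumes der: "\<And>t e. ((\<lambda>t. \<sigma> t $ e) has_vector_derivative \<xi> t \<times> \<sigma> t $ e) (at t)"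
    and nc: "\<sigma> 0 $ a \<times> \<sigma> 0 $ b \<noteq> 0"
  shows "\<exists>R. rotation_matrix R \<and> \<sigma> t = rot_act R (\<sigma> 0)"
proof -
  have const: "f s = f 0" if "\<And>t. (f has_vector_derivative 0) (at t)" for f :: "real \<Rightarrow> real" and s
    using has_derivative_zero_constant[of UNIV f] that
    by (auto simp: has_vector_derivative_def)
  have "\<sigma> 0 $ e \<bullet> \<sigma> 0 $ f = \<sigma> t $ e \<bullet> \<sigma> t $ f" for e f
  proof (rule const[where f = "\<lambda>t. \<sigma> t $ e \<bullet> \<sigma> t $ f", symmetric])
    fix t
    show "((\<lambda>t. \<sigma> t $ e \<bullet> \<sigma> t $ f) has_vector_derivative 0) (at t)"
      by (rule has_vector_derivative_eq_rhs[OF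
            bounded_bilinear.has_vector_derivative[OF bounded_bilinear_inner der der]])
        (metis add.commute add.inverse_inverse inner_commute left_minus triple_rotate triple_swap)
  qed
  moreover have "\<sigma> 0 $ e \<bullet> (\<sigma> 0 $ f \<times> \<sigma> 0 $ g) = \<sigma> t $ e \<bullet> (\<sigma> t $ f \<times> \<sigma> t $ g)" for e f g
  proof (rule const[where f = "\<lambda>t. \<sigma> t $ e \<bullet> (\<sigma> t $ f \<times> \<sigma> t $ g)", symmetric])
    fix t
    have jacobi: "y \<times> (k \<times> z) + (k \<times> y) \<times> z = k \<times> (y \<times> z)" for k y z :: "real^3"
      by (simp add: cross_cross_left cross_cross_right inner_commute)
    show "((\<lambda>t. \<sigma> t $ e \<bullet> (\<sigma> t $ f \<times> \<sigma> t $ g)) has_vector_derivative 0) (at t)"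
      by (rule has_vector_derivative_eq_rhs[OF
            bounded_bilinear.has_vector_derivative[OF bounded_bilinear_inner der
              bounded_bilinear.has_vector_derivative[OF bounded_bilinear_cross der der]]])
        (unfold jacobi, metis add.commute inner_commute left_minus triple_rotate triple_swap)
  qed
  ultimately show ?thesis
    using same_products_imp_rotation[OF _ _ nc] by blast
qed

text \<open>
  Along any curve lifting a trajectory of the Hamiltonian vector field of \<open>|\<rho>\<^sub>A|\<close>, undoing the
  bending leaves an infinitesimal rotation, by the description of the kernel of the form.  So the
  Hamiltonian equation determines the flow on the quotient, and it is bending.
\<close>

lemma hamiltonian_flow_bending_unique:
  fixes len :: "'e::finite \<Rightarrow> real"
  assumes len: "\<And>e. len e > 0" "generic len" and A: "nonvanishing len A"
    and \<Phi>: "hamiltonian_flow len (bending_hamiltonian A) \<Phi>" and \<rho>: "\<rho> \<in> polt len"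
  shows "\<Phi> t (cls len \<rho>) = cls len (bend A t \<rho>)"
proof -
  obtain \<gamma> \<gamma>' where \<gamma>0: "\<gamma> 0 = \<rho>" and g: "\<And>t. \<gamma> t \<in> polt len"
    "\<And>t. cls len (\<gamma> t) = \<Phi> t (cls len \<rho>)" "\<And>t. (\<gamma> has_vector_derivative \<gamma>' t) (at t)"
    and eq: "\<And>t w. w \<in> polt_tangent len (\<gamma> t) \<Longrightarrow> orbit_prod_form len (\<gamma> t) (\<gamma>' t) w
      = frechet_derivative (bending_hamiltonian A) (at (\<gamma> t)) w"
    using \<Phi> \<rho> unfolding hamiltonian_flow_def by metis
  define u where "u t = sgn (ssum A (\<gamma> t))" for t
  have u1: "norm (u t) = 1" for t using norm_sgn_ssum[OF A g(1)] by (simp add: u_def)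
  have "\<exists>\<xi>. \<forall>e. (\<gamma>' t - bend_field A (\<gamma> t)) $ e = \<xi> \<times> \<gamma> t $ e" for t
  proof (rule orbit_prod_form_kernel[OF len g(1)])
    show "\<gamma>' t - bend_field A (\<gamma> t) \<in> polt_tangent len (\<gamma> t)"
      using polt_curve_tangent[OF g(1) g(3)] bend_field_tangent[of A "\<gamma> t" len]
      by (simp add: polt_tangent_def inner_diff_left sum_subtractf)
    show "orbit_prod_form len (\<gamma> t) (\<gamma>' t - bend_field A (\<gamma> t)) w = 0"
      if "w \<in> polt_tangent len (\<gamma> t)" for w
      using that
      by (simp add: orbit_prod_form_diff eq form_bend_field[OF len(1) g(1)]
          frechet_bending_hamiltonian[OF nonvanishingD[OF A g(1)]])
  qed
  then obtain \<xi> where "\<And>t e. (\<gamma>' t - bend_field A (\<gamma> t)) $ e = \<xi> t \<times> \<gamma> t $ e" by metis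
  then have \<gamma>': "\<gamma>' t $ e = (if e \<in> A then u t \<times> \<gamma> t $ e else 0) + \<xi> t \<times> \<gamma> t $ e" for t e
    by (simp add: bend_field_def u_def algebra_simps)
  have d: "((\<lambda>t. \<gamma> t $ e) has_vector_derivative \<gamma>' t $ e) (at t)" for e t
    by (rule bounded_linear.has_vector_derivative[OF bounded_linear_vec_nth g(3)])
  have ssum': "ssum A (\<gamma>' t) = \<xi> t \<times> ssum A (\<gamma> t)" for t
  proof -
    have "ssum A (\<gamma>' t) = u t \<times> ssum A (\<gamma> t) + \<xi> t \<times> ssum A (\<gamma> t)"
      by (simp add: \<gamma>' sum.distrib bounded_bilinear.sum_right[OF bounded_bilinear_cross])
    then show ?thesis by (simp add: u_def sgn_div_norm cross_mult_left)
  qed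
  have dS: "((\<lambda>t. ssum A (\<gamma> t)) has_vector_derivative \<xi> t \<times> ssum A (\<gamma> t)) (at t)" for t
    using bounded_linear.has_vector_derivative[OF bounded_linear_ssum g(3)] by (metis ssum')
  have nS: "norm (ssum A (\<gamma> t)) = norm (ssum A \<rho>)" for t
  proof -
    have "((\<lambda>t. ssum A (\<gamma> t) \<bullet> ssum A (\<gamma> t)) has_derivative (\<lambda>h. 0)) (at t within UNIV)" for t
      using bounded_bilinear.has_vector_derivative[OF bounded_bilinear_inner dS dS, of t]
      by (simp add: dot_cross_self has_vector_derivative_def)
    then have "ssum A (\<gamma> t) \<bullet> ssum A (\<gamma> t) = ssum A (\<gamma> 0) \<bullet> ssum A (\<gamma> 0)"
      using has_derivative_zero_constant[of UNIV "\<lambda>t. ssum A (\<gamma> t) \<bullet> ssum A (\<gamma> t)"] by auto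
    then show ?thesis by (simp add: norm_eq_sqrt_inner \<gamma>0)
  qed
  have u': "(u has_vector_derivative \<xi> t \<times> u t) (at t)" for t
  proof -
    have "u = (\<lambda>t. inverse (norm (ssum A \<rho>)) *\<^sub>R ssum A (\<gamma> t))"
      by (simp add: u_def[abs_def] sgn_div_norm nS)
    then show ?thesis
      using bounded_linear.has_vector_derivative[OF bounded_linear_scaleR_right dS]
      by (simp add: cross_mult_right)
  qed
  define \<sigma> where "\<sigma> t = bend A (- t) (\<gamma> t)" for t
  have \<sigma>nth: "\<sigma> t $ e = (if e \<in> A then rot (u t) (- t) (\<gamma> t $ e) else \<gamma> t $ e)" for t e
    by (simp add: \<sigma>_def bend_nth u_def)
  have "((\<lambda>t. \<sigma> t $ e) has_vector_derivative \<xi> t \<times> \<sigma> t $ e) (at t)" for t e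
  proof (cases "e \<in> A")
    case True
    have m: "((\<lambda>t. - t) has_real_derivative - 1) (at t)" by (auto intro!: derivative_eq_intros)
    have uu: "u t \<bullet> u t = 1" using u1[of t] by (simp add: norm_eq_1)
    have jac: "(k \<times> y) \<times> z + y \<times> (k \<times> z) = k \<times> (y \<times> z)" for k y z :: "real^3"
      by (simp add: cross_cross_left cross_cross_right inner_commute)
    have skew: "(k \<times> y) \<bullet> z + y \<bullet> (k \<times> z) = 0" for k y z :: "real^3"
      by (metis add.commute inner_commute left_minus triple_rotate triple_swap)
    have s1: "(\<xi> t \<times> u t) \<times> \<gamma> t $ e + u t \<times> (u t \<times> \<gamma> t $ e + \<xi> t \<times> \<gamma> t $ e)
        = \<xi> t \<times> (u t \<times> \<gamma> t $ e) + ((u t \<bullet> \<gamma> t $ e) *\<^sub>R u t - \<gamma> t $ e)"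
      using jac[of "\<xi> t" "u t" "\<gamma> t $ e"]
      by (simp add: cross_add_right cross_cross_right[of "u t" "u t"] uu algebra_simps)
    have s2: "(\<xi> t \<times> u t) \<bullet> \<gamma> t $ e + u t \<bullet> (u t \<times> \<gamma> t $ e + \<xi> t \<times> \<gamma> t $ e) = 0"
      using skew[of "\<xi> t" "u t" "\<gamma> t $ e"] by (simp add: inner_add_right dot_cross_self)
    have "\<gamma>' t $ e = u t \<times> \<gamma> t $ e + \<xi> t \<times> \<gamma> t $ e" using True by (simp add: \<gamma>')
    from rot_has_vector_derivative[OF m u' d[of e t, unfolded this], unfolded s1 s2] True
    show ?thesis
      by (simp add: \<sigma>nth, elim has_vector_derivative_eq_rhs)
        (simp add: rot_def cross_add_right cross_mult_right Cross3.right_diff_distrib algebra_simps)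
  next
    case False
    then show ?thesis using d[of e t] by (simp add: \<sigma>nth \<gamma>')
  qed
  moreover have \<sigma>0: "\<sigma> 0 = \<rho>" by (simp add: \<sigma>_def \<gamma>0)
  moreover obtain a b where "\<rho> $ a \<times> \<rho> $ b \<noteq> 0" using polt_not_collinear[OF len \<rho>] by blast
  ultimately obtain R where R: "rotation_matrix R" "\<sigma> t = rot_act R \<rho>"
    using infinitesimal_rotation_imp_rotation[of \<sigma> \<xi>] by metis
  have "\<gamma> t = bend A t (\<sigma> t)"
    by (simp add: \<sigma>_def bend_add_angle nonvanishingD[OF A g(1)])
  then have "\<gamma> t = rot_act R (bend A t \<rho>)" using R by (simp add: bend_rot_act)
  then have "cls len (\<gamma> t) = cls len (bend A t \<rho>)"
    using R by (simp add: cls_rot_act bend_polt[OF \<rho> nonvanishingD[OF A \<rho>]])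
  then show ?thesis by (simp add: g(2))
qed


section \<open>Trajectories of commuting bendings\<close>

primrec bends :: "'e::finite set list \<Rightarrow> ('e set \<Rightarrow> real) \<Rightarrow> 'e config \<Rightarrow> 'e config" where
  "bends [] \<tau> \<rho> = \<rho>"
| "bends (A # As) \<tau> \<rho> = bend A (\<tau> A) (bends As \<tau> \<rho>)"

definition nested :: "'a set \<Rightarrow> 'a set \<Rightarrow> bool" where
  "nested A B \<longleftrightarrow> A \<inter> B = {} \<or> A \<subseteq> B \<or> B \<subseteq> A"

lemma nested_sym: "nested A B \<longleftrightarrow> nested B A"
  by (auto simp: nested_def)

lemma bends_polt:
  "\<rho> \<in> polt len \<Longrightarrow> (\<And>A. A \<in> set As \<Longrightarrow> nonvanishing len A) \<Longrightarrow> bends As \<tau> \<rho> \<in> polt len"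
proof (induction As)
  case (Cons A As)
  then have "bends As \<tau> \<rho> \<in> polt len" "nonvanishing len A" by auto
  then show ?case by (simp add: bend_polt nonvanishingD)
qed simp

lemma bends_single: "bends [A] \<tau> = bend A (\<tau> A)"
  by (rule ext) simp

lemma bends_rot_act: "rotation_matrix R \<Longrightarrow> bends As \<tau> (rot_act R \<rho>) = rot_act R (bends As \<tau> \<rho>)"
  by (induction As) (auto simp: bend_rot_act)

lemma equivariant_bends:
  "(\<And>A. A \<in> set As \<Longrightarrow> nonvanishing len A) \<Longrightarrow> equivariant len (bends As \<tau>)"
  by (simp add: equivariant_def bends_polt bends_rot_act)



lemma bends_zero: "(\<And>A. A \<in> set As \<Longrightarrow> \<tau> A = 0) \<Longrightarrow> bends As \<tau> \<rho> = \<rho>"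
  by (induction As) auto

lemma bend_bends_commute:
  assumes "\<rho> \<in> polt len" "\<And>B. B \<in> set As \<Longrightarrow> nonvanishing len B \<and> nested A B" "nonvanishing len A"
  shows "bend A s (bends As \<tau> \<rho>) = bends As \<tau> (bend A s \<rho>)"
  using assms(2)
proof (induction As)
  case (Cons B As)
  have "bends As \<tau> \<rho> \<in> polt len" using Cons.prems by (intro bends_polt assms(1)) auto
  moreover have "nonvanishing len B" "nested A B" using Cons.prems by auto
  ultimately have "bend A s (bend B (\<tau> B) (bends As \<tau> \<rho>))
      = bend B (\<tau> B) (bend A s (bends As \<tau> \<rho>))"
    using assms(3) by (intro bend_commute) (simp_all add: nested_def nonvanishingD)
  then show ?case using Cons by simp
qed simp

lemma bends_add_angle:
  assumes "\<rho> \<in> polt len" "\<And>A. A \<in> set As \<Longrightarrow> nonvanishing len A"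
    "\<And>A B. A \<in> set As \<Longrightarrow> B \<in> set As \<Longrightarrow> nested A B"
  shows "bends As (\<lambda>A. \<tau> A + \<tau>' A) \<rho> = bends As \<tau> (bends As \<tau>' \<rho>)"
  using assms(2,3)
proof (induction As)
  case (Cons A As)
  have p: "bends As \<tau> (bends As \<tau>' \<rho>) \<in> polt len" "bends As \<tau>' \<rho> \<in> polt len"
    using Cons.prems assms(1) by (auto intro!: bends_polt)
  have "bends (A # As) (\<lambda>A. \<tau> A + \<tau>' A) \<rho>
      = bend A (\<tau> A) (bend A (\<tau>' A) (bends As \<tau> (bends As \<tau>' \<rho>)))"
    using Cons bend_add_angle[OF nonvanishingD[OF _ p(1)]] by simp
  also have "bend A (\<tau>' A) (bends As \<tau> (bends As \<tau>' \<rho>))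
      = bends As \<tau> (bend A (\<tau>' A) (bends As \<tau>' \<rho>))"
    using Cons.prems by (intro bend_bends_commute[OF p(2)]) auto
  finally show ?case by simp
qed simp

lemma ssum_bends_superset:
  "(\<And>B. B \<in> set As \<Longrightarrow> B \<subseteq> A \<or> A \<inter> B = {}) \<Longrightarrow> ssum A (bends As \<tau> \<rho>) = ssum A \<rho>"
proof (induction As)
  case (Cons B As)
  then show ?case
    using ssum_bend_superset[of B A] ssum_bend_disjoint[of A B] by (metis bends.simps(2) list.set_intros)
qed simp

lemma bend_field_bend:
  assumes "B \<subseteq> A \<or> A \<inter> B = {}" "ssum A \<rho> \<noteq> 0"
  shows "bend_field B (bend A s \<rho>) $ e =
    (if e \<in> A then rot (sgn (ssum A \<rho>)) s (bend_field B \<rho> $ e) else bend_field B \<rho> $ e)"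
  using assms(1)
proof
  have a: "norm (sgn (ssum A \<rho>)) = 1" using assms(2) by (simp add: norm_sgn)
  assume "B \<subseteq> A"
  then show ?thesis
    by (simp add: bend_field_def ssum_bend_subset sgn_rot[OF a])
      (auto simp: bend_nth rot_cross[OF a])
next
  assume "A \<inter> B = {}"
  then have "B \<inter> A = {}" "e \<in> A \<Longrightarrow> e \<notin> B" by auto
  then show ?thesis
    by (simp add: bend_field_def ssum_bend_disjoint) (auto simp: bend_nth)
qed

lemma bounded_linear_axis: "bounded_linear (axis e :: real^3 \<Rightarrow> 'e::finite config)"
  unfolding linear_conv_bounded_linear[symmetric]
  by (rule linearI) (simp_all add: axis_def vec_eq_iff)

lemma config_eq_sum_axis: "(\<Sum>e\<in>UNIV. axis e (\<rho> $ e)) = (\<rho> :: 'e::finite config)"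
  by (rule config_eqI) (simp add: axis_def if_distrib[of "\<lambda>f. f _"] cong: if_cong)

lemma config_has_vector_derivativeI:
  fixes \<gamma> :: "real \<Rightarrow> 'e::finite config"
  assumes "\<And>e. ((\<lambda>t. \<gamma> t $ e) has_vector_derivative \<gamma>' $ e) (at t)"
  shows "(\<gamma> has_vector_derivative \<gamma>') (at t)"
proof -
  have "((\<lambda>t. \<Sum>e\<in>UNIV. axis e (\<gamma> t $ e)) has_vector_derivative
      (\<Sum>e\<in>UNIV. axis e (\<gamma>' $ e))) (at t)"
    by (intro has_vector_derivative_sum
        bounded_linear.has_vector_derivative[OF bounded_linear_axis] assms)
  then show ?thesis by (simp add: config_eq_sum_axis)
qed

text \<open>
  When the larger sets are bent last, the axis of each bending is constant along the trajectory
  of the bendings applied before it.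
\<close>

lemma bends_trajectory:
  assumes "\<rho> \<in> polt len" "\<And>A. A \<in> set As \<Longrightarrow> nonvanishing len A" "distinct As"
    "\<And>A B. A \<in> set As \<Longrightarrow> B \<in> set As \<Longrightarrow> nested A B" "sorted_wrt (\<lambda>A B. \<not> A \<subset> B) As"
  shows "((\<lambda>t. bends As (\<lambda>A. t * c A) \<rho>) has_vector_derivative
      (\<Sum>A\<in>set As. c A *\<^sub>R bend_field A (bends As (\<lambda>A. t * c A) \<rho>))) (at t)"
  using assms(2-5)
proof (induction As)
  case (Cons A As)
  let ?\<beta> = "\<lambda>t. bends As (\<lambda>A. t * c A) \<rho>" and ?\<gamma> = "\<lambda>t. bends (A # As) (\<lambda>A. t * c A) \<rho>"
  have sub: "B \<subseteq> A \<or> A \<inter> B = {}" if "B \<in> set As" for B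
  proof -
    have "B \<noteq> A" "\<not> A \<subset> B" "nested A B" using that Cons.prems by auto
    then show ?thesis by (auto simp: nested_def)
  qed
  have p: "?\<beta> t \<in> polt len" for t using Cons.prems by (intro bends_polt assms(1)) auto
  have A: "nonvanishing len A" using Cons.prems by simp
  define a where "a = sgn (ssum A \<rho>)"
  have a: "sgn (ssum A (?\<beta> t)) = a" for t
    using sub by (simp add: ssum_bends_superset a_def)
  have a1: "norm a = 1" using norm_sgn_ssum[OF A assms(1)] by (simp add: a_def)
  have IH: "((\<lambda>t. ?\<beta> t $ e) has_vector_derivative
      (\<Sum>B\<in>set As. c B *\<^sub>R bend_field B (?\<beta> t)) $ e) (at t)" for e
    using Cons by (intro bounded_linear.has_vector_derivative[OF bounded_linear_vec_nth]) auto
  have "((\<lambda>t. ?\<gamma> t $ e) has_vector_derivative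
      (\<Sum>B\<in>set (A # As). c B *\<^sub>R bend_field B (?\<gamma> t)) $ e) (at t)" for e
  proof (cases "e \<in> A")
    case True
    have lin: "((\<lambda>t. t * c A) has_real_derivative c A) (at t)" by (auto intro!: derivative_eq_intros)
    let ?\<beta>' = "\<Sum>B\<in>set As. c B *\<^sub>R bend_field B (?\<beta> t)"
    have g: "?\<gamma> t $ e = rot a (t * c A) (?\<beta> t $ e)" for t
      using True by (simp add: bend_nth a)
    have aa: "a \<bullet> a = 1" using a1 by (simp add: norm_eq_1)
    have "rot a (t * c A) (?\<beta>' $ e) = (\<Sum>B\<in>set As. c B *\<^sub>R bend_field B (?\<gamma> t)) $ e"
      using True bend_field_bend[OF sub nonvanishingD[OF A p], of _ "t * c A" t e]
      by (simp add: rot_sum rot_scaleR a)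
    moreover have "A \<notin> set As" using Cons.prems by simp
    ultimately have rhs: "(\<Sum>B\<in>set (A # As). c B *\<^sub>R bend_field B (?\<gamma> t)) $ e
        = c A *\<^sub>R (a \<times> ?\<gamma> t $ e) + rot a (t * c A) (?\<beta>' $ e)"
      using True by (simp add: bend_field_def[of A] ssum_bend_superset a del: sum_component)
    show ?thesis
      unfolding rhs g
      by (rule has_vector_derivative_eq_rhs[OF
            rot_has_vector_derivative[OF lin has_vector_derivative_const IH]])
        (simp add: rot_def cross_add_right cross_mult_right cross_cross_right
          Cross3.right_diff_distrib aa algebra_simps del: sum_component)
  next
    case False
    have "A \<notin> set As" using Cons.prems by simp
    then have "(\<Sum>B\<in>set (A # As). c B *\<^sub>R bend_field B (?\<gamma> t)) $ e
        = (\<Sum>B\<in>set As. c B *\<^sub>R bend_field B (?\<beta> t)) $ e"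
      using False bend_field_bend[OF sub nonvanishingD[OF A p], of _ "t * c A" t e]
      by (simp add: bend_field_def[of A])
    then show ?thesis using False IH[of e] by (simp add: bend_nth)
  qed
  then show ?case by (rule config_has_vector_derivativeI)
qed simp

lemma induced_bends_Bij:
  assumes "\<And>A. A \<in> set As \<Longrightarrow> nonvanishing len A"
    "\<And>A B. A \<in> set As \<Longrightarrow> B \<in> set As \<Longrightarrow> nested A B"
  shows "induced_map len (bends As \<tau>) \<in> carrier (BijGroup (Pol len))"
proof (rule induced_map_Bij)
  show "equivariant len (bends As \<tau>)" "equivariant len (bends As (\<lambda>A. - \<tau> A))"
    by (simp_all add: equivariant_bends assms(1))
  fix \<rho> assume "\<rho> \<in> polt len"
  from bends_add_angle[OF this assms, of As \<tau> "\<lambda>A. - \<tau> A"]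
    bends_add_angle[OF this assms, of As "\<lambda>A. - \<tau> A" \<tau>]
  show "bends As \<tau> (bends As (\<lambda>A. - \<tau> A) \<rho>) = \<rho>" "bends As (\<lambda>A. - \<tau> A) (bends As \<tau> \<rho>) = \<rho>"
    by (simp_all add: bends_zero)
qed

lemma induced_bend_Bij:
  "nonvanishing len A \<Longrightarrow> induced_map len (bend A t) \<in> carrier (BijGroup (Pol len))"
  using induced_bends_Bij[of "[A]" len "\<lambda>_. t"] by (simp add: nested_def bends_single)

lemma orbit_prod_form_sum:
  "orbit_prod_form len \<rho> (\<Sum>i\<in>S. c i *\<^sub>R v i) w = (\<Sum>i\<in>S. c i * orbit_prod_form len \<rho> (v i) w)"
proof (induction S rule: infinite_finite_induct)
  case (insert i S)
  have "orbit_prod_form len \<rho> (c i *\<^sub>R v i + v') w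
      = c i * orbit_prod_form len \<rho> (v i) w + orbit_prod_form len \<rho> v' w" for v'
    by (simp add: orbit_prod_form_def kks_cross cross_add_right cross_mult_right inner_add_right
        add_divide_distrib sum.distrib sum_distrib_left)
  then show ?case using insert by simp
qed (simp_all add: orbit_prod_form_def kks_cross)

text \<open>
  The velocity of the composed bendings is the combination of the fields of the individual ones,
  which the form turns into the differentials of the lengths.
\<close>

lemma hamiltonian_flow_bends:
  assumes len: "\<And>e. len e > 0" and As: "\<And>A. A \<in> set As \<Longrightarrow> nonvanishing len A" "distinct As"
    "\<And>A B. A \<in> set As \<Longrightarrow> B \<in> set As \<Longrightarrow> nested A B" "sorted_wrt (\<lambda>A B. \<not> A \<subset> B) As"
    and F: "\<And>\<rho>. F \<rho> = (\<Sum>A\<in>set As. c A * bending_hamiltonian A \<rho>)"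
  shows "hamiltonian_flow len F (\<lambda>t. induced_map len (bends As (\<lambda>A. t * c A)))"
  unfolding hamiltonian_flow_def
proof (intro conjI ballI allI)
  show "induced_map len (bends As (\<lambda>A. t * c A)) \<in> carrier (BijGroup (Pol len))" for t
    by (rule induced_bends_Bij[OF As(1,3)])
  fix \<rho> assume \<rho>: "\<rho> \<in> polt len"
  let ?\<gamma> = "\<lambda>t. bends As (\<lambda>A. t * c A) \<rho>"
  have p: "?\<gamma> t \<in> polt len" for t by (rule bends_polt[OF \<rho> As(1)])
  show "\<exists>\<gamma> \<gamma>'. \<gamma> 0 = \<rho> \<and> (\<forall>t. \<gamma> t \<in> polt len \<and>
      cls len (\<gamma> t) = induced_map len (bends As (\<lambda>A. t * c A)) (cls len \<rho>) \<and>
      (\<gamma> has_vector_derivative \<gamma>' t) (at t) \<and> (\<forall>w\<in>polt_tangent len (\<gamma> t).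
        orbit_prod_form len (\<gamma> t) (\<gamma>' t) w = frechet_derivative F (at (\<gamma> t)) w))"
  proof (rule exI[of _ ?\<gamma>], rule exI[of _ "\<lambda>t. \<Sum>A\<in>set As. c A *\<^sub>R bend_field A (?\<gamma> t)"],
      intro conjI allI ballI)
    show "?\<gamma> 0 = \<rho>" by (simp add: bends_zero)
    show "?\<gamma> t \<in> polt len" for t by (rule p)
    show "cls len (?\<gamma> t) = induced_map len (bends As (\<lambda>A. t * c A)) (cls len \<rho>)" for t
      by (simp add: induced_map_cls equivariant_bends As(1) \<rho>)
    show "(?\<gamma> has_vector_derivative (\<Sum>A\<in>set As. c A *\<^sub>R bend_field A (?\<gamma> t))) (at t)" for t
      by (rule bends_trajectory[OF \<rho> As])
    fix t w assume w: "w \<in> polt_tangent len (?\<gamma> t)"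
    have "((\<lambda>\<rho>. \<Sum>A\<in>set As. c A * bending_hamiltonian A \<rho>) has_derivative
        (\<lambda>w. \<Sum>A\<in>set As. c A * (sgn (ssum A (?\<gamma> t)) \<bullet> ssum A w))) (at (?\<gamma> t))"
      by (intro has_derivative_sum has_derivative_mult_right bending_hamiltonian_derivative
          nonvanishingD[OF As(1) p])
    moreover have "F = (\<lambda>\<rho>. \<Sum>A\<in>set As. c A * bending_hamiltonian A \<rho>)" using F by auto
    ultimately have "frechet_derivative F (at (?\<gamma> t))
        = (\<lambda>w. \<Sum>A\<in>set As. c A * (sgn (ssum A (?\<gamma> t)) \<bullet> ssum A w))"
      by (simp only: frechet_derivative_at[symmetric])
    then show "orbit_prod_form len (?\<gamma> t) (\<Sum>A\<in>set As. c A *\<^sub>R bend_field A (?\<gamma> t)) w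
        = frechet_derivative F (at (?\<gamma> t)) w"
      by (simp add: orbit_prod_form_sum form_bend_field[OF len p w])
  qed
qed

theorem bending_flow_eq:
  fixes len :: "'e::finite \<Rightarrow> real"
  assumes len: "\<And>e. len e > 0" "generic len" and A: "nonvanishing len A"
  shows "bending_flow len A t = induced_map len (bend A t)"
proof -
  have "hamiltonian_flow len (bending_hamiltonian A) (\<lambda>t. induced_map len (bend A t))"
    using hamiltonian_flow_bends[of len "[A]" "bending_hamiltonian A" "\<lambda>_. 1"] len A
    by (simp add: nested_def bends_single)
  moreover have "\<Phi> = (\<lambda>t. induced_map len (bend A t))"
    if "hamiltonian_flow len (bending_hamiltonian A) \<Phi>" for \<Phi>
  proof
    fix t
    have "\<Phi> t \<in> extensional (Pol len)"
      using that by (simp add: hamiltonian_flow_def BijGroup_def Bij_def)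
    then show "\<Phi> t = induced_map len (bend A t)"
      by (rule induced_map_eqI[OF equivariant_bend[OF A]])
        (rule hamiltonian_flow_bending_unique[OF len A that])
  qed
  ultimately have "bending_flow len A = (\<lambda>t. induced_map len (bend A t))"
    unfolding bending_flow_def by (rule the_equality)
  then show ?thesis by simp
qed


section \<open>Bendings are symplectic\<close>

text \<open>
  A lift of a map of the polygon space to a smooth map near the zero level which respects the
  tangent spaces and the form.  Respecting the tangent spaces is what makes this notion stable
  under composition.
\<close>

definition symplectic_lift :: "('e::finite \<Rightarrow> real) \<Rightarrow> ('e config \<Rightarrow> 'e config) \<Rightarrow> bool" where
  "symplectic_lift len G \<longleftrightarrow> (\<exists>U. open U \<and> polt len \<subseteq> U \<and> smooth_on U G) \<and>
     (\<forall>\<sigma>\<in>polt len. G \<sigma> \<in> polt len \<and>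
       (\<forall>v\<in>polt_tangent len \<sigma>. frechet_derivative G (at \<sigma>) v \<in> polt_tangent len (G \<sigma>)) \<and>
       (\<forall>v\<in>polt_tangent len \<sigma>. \<forall>w\<in>polt_tangent len \<sigma>.
          orbit_prod_form len (G \<sigma>)
            (frechet_derivative G (at \<sigma>) v) (frechet_derivative G (at \<sigma>) w)
          = orbit_prod_form len \<sigma> v w))"

lemma symplectic_lift_id: "symplectic_lift len (\<lambda>\<rho>. \<rho>)"
  unfolding symplectic_lift_def
  by (auto simp: smooth_on_def Ck_linear frechet_derivative_id intro!: exI[of _ UNIV])

lemma smooth_on_has_derivative:
  "smooth_on U f \<Longrightarrow> x \<in> U \<Longrightarrow> (f has_derivative frechet_derivative f (at x)) (at x)"
  using Ck_has_derivative unfolding smooth_on_def by metis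

lemma symplectic_lift_compose:
  assumes "symplectic_lift len G" "symplectic_lift len H"
  shows "symplectic_lift len (\<lambda>\<rho>. G (H \<rho>))"
proof -
  obtain U where U: "open U" "polt len \<subseteq> U" "smooth_on U G"
    using assms(1) by (auto simp: symplectic_lift_def)
  obtain V where V: "open V" "polt len \<subseteq> V" "smooth_on V H"
    using assms(2) by (auto simp: symplectic_lift_def)
  have "continuous_on V H" using V(3) by (metis Ck.simps(1) smooth_on_def)
  define W where "W = H -` U \<inter> V"
  have W: "open W" unfolding W_def
    using \<open>continuous_on V H\<close> U(1) V(1) by (metis continuous_on_open_vimage)
  have polt: "polt len \<subseteq> W"
    using U V assms(2) by (auto simp: W_def symplectic_lift_def)
  have "Ck n W (\<lambda>\<rho>. G (H \<rho>))" for n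
  proof (rule Ck_compose[OF W U(1), of n G H])
    show "Ck n U G" "Ck n W H"
      using U(3) V(3) Ck_subset[of n V H W] by (auto simp: smooth_on_def W_def)
  qed (auto simp: W_def)
  then have sm: "smooth_on W (\<lambda>\<rho>. G (H \<rho>))" by (simp add: smooth_on_def)
  have D: "frechet_derivative (\<lambda>\<rho>. G (H \<rho>)) (at \<sigma>)
      = (\<lambda>v. frechet_derivative G (at (H \<sigma>)) (frechet_derivative H (at \<sigma>) v))"
    if "\<sigma> \<in> polt len" for \<sigma>
  proof -
    have "\<sigma> \<in> V" "H \<sigma> \<in> U" using that polt by (auto simp: W_def)
    from has_derivative_compose[OF smooth_on_has_derivative[OF V(3) this(1)]
        smooth_on_has_derivative[OF U(3) this(2)]]
    show ?thesis by (rule frechet_derivative_at[symmetric])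
  qed
  show ?thesis
    unfolding symplectic_lift_def
  proof (intro conjI ballI)
    show "\<exists>U. open U \<and> polt len \<subseteq> U \<and> smooth_on U (\<lambda>\<rho>. G (H \<rho>))"
      using W polt sm by blast
  qed (use assms D in \<open>auto simp: symplectic_lift_def\<close>)
qed

lemma symplectic_lift_symplectic_map:
  assumes "symplectic_lift len G" "equivariant len G"
  shows "symplectic_map len (induced_map len G)"
  unfolding symplectic_map_def
proof
  fix \<rho> assume \<rho>: "\<rho> \<in> polt len"
  obtain U where U: "open U" "polt len \<subseteq> U" "smooth_on U G"
    using assms(1) by (auto simp: symplectic_lift_def)
  show "\<exists>U G'. open U \<and> \<rho> \<in> U \<and> smooth_on U G' \<and>
        (\<forall>\<sigma>\<in>U \<inter> polt len. G' \<sigma> \<in> polt len \<and> cls len (G' \<sigma>) = induced_map len G (cls len \<sigma>)) \<and>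
        (\<forall>\<sigma>\<in>U \<inter> polt len. \<forall>v\<in>polt_tangent len \<sigma>. \<forall>w\<in>polt_tangent len \<sigma>.
           orbit_prod_form len (G' \<sigma>)
             (frechet_derivative G' (at \<sigma>) v) (frechet_derivative G' (at \<sigma>) w)
           = orbit_prod_form len \<sigma> v w)"
    using U \<rho> assms
    by (intro exI[of _ U] exI[of _ G]) (auto simp: induced_map_cls symplectic_lift_def)
qed

lemma open_ssum_nonzero: "open {\<rho>. ssum A \<rho> \<noteq> 0}"
proof -
  have "continuous_on UNIV (\<lambda>\<rho>. ssum A \<rho>)" by (intro continuous_intros)
  then have "open ((\<lambda>\<rho>. ssum A \<rho>) -` (- {0}))"
    by (intro open_vimage) auto
  then show ?thesis by (simp add: vimage_def)
qed

lemma smooth_on_bend: "smooth_on {\<rho>. ssum A \<rho> \<noteq> 0} (bend A t)"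
  unfolding smooth_on_def
proof
  fix n
  let ?U = "{\<rho>. ssum A \<rho> \<noteq> 0}"
  note U = open_ssum_nonzero[of A]
  have nth: "Ck n ?U (\<lambda>\<rho>. \<rho> $ e)" for e by (rule Ck_linear[OF U bounded_linear_vec_nth])
  have u: "Ck n ?U (\<lambda>\<rho>. sgn (ssum A \<rho>))" by (rule Ck_sgn[OF U bounded_linear_ssum]) simp
  have "Ck n ?U (\<lambda>\<rho>. rot (sgn (ssum A \<rho>)) t (\<rho> $ e))" for e
    unfolding rot_def
    by (intro Ck_add[OF U] Ck_linear_compose[OF U bounded_linear_scaleR_right]
        Ck_bilinear[OF U bounded_bilinear_scaleR] Ck_bilinear[OF U bounded_bilinear_cross]
        Ck_linear_compose[OF U bounded_linear_mult_right]
        Ck_bilinear[OF U bounded_bilinear_inner] u nth)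
  then have "Ck n ?U (\<lambda>\<rho>. bend A t \<rho> $ e)" for e
    using nth[of e] by (cases "e \<in> A") (simp_all add: bend_nth)
  then have "Ck n ?U (\<lambda>\<rho>. \<Sum>e\<in>UNIV. axis e (bend A t \<rho> $ e))"
    by (intro Ck_sum[OF U] Ck_linear_compose[OF U bounded_linear_axis]) auto
  then show "Ck n ?U (bend A t)" by (simp only: config_eq_sum_axis)
qed

lemma sgn_has_derivative:
  fixes x :: "'a::real_inner"
  assumes "x \<noteq> 0"
  shows "(sgn has_derivative (\<lambda>h. inverse (norm x) *\<^sub>R (h - (sgn x \<bullet> h) *\<^sub>R sgn x))) (at x)"
proof -
  have "((\<lambda>x. inverse (norm x)) has_derivative
      (\<lambda>h. - (inverse (norm x) * (h \<bullet> sgn x) * inverse (norm x)))) (at x)"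
    using assms by (intro Deriv.has_derivative_inverse has_derivative_norm) auto
  from has_derivative_scaleR[OF this has_derivative_ident]
  show ?thesis
    using assms
    by (elim has_derivative_eq_rhs[OF has_derivative_transform[rotated -1]])
      (auto simp: sgn_div_norm fun_eq_iff algebra_simps inner_commute)
qed

text \<open>
  When the unit axis \<open>u\<close> moves with velocity \<open>d\<close>, the derivative of the rotation by the fixed
  angle \<open>t\<close> is the infinitesimal rotation by this vector followed by the rotation itself.
\<close>

definition axis_variation :: "real^3 \<Rightarrow> real \<Rightarrow> real^3 \<Rightarrow> real^3" where
  "axis_variation u t d = sin t *\<^sub>R d - (1 - cos t) *\<^sub>R (u \<times> d)"

lemma rot_axis_variation:
  assumes "norm u = 1" "u \<bullet> d = 0"
  shows "sin t *\<^sub>R (d \<times> x) + (1 - cos t) *\<^sub>R ((d \<bullet> x) *\<^sub>R u + (u \<bullet> x) *\<^sub>R d)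
    = rot u t (axis_variation u t d \<times> x)"
proof -
  have uu: "u \<bullet> u = 1" using assms(1) by (simp add: norm_eq_1)
  have s2: "sin t * sin t = 1 - cos t * cos t"
    using sin_cos_squared_add[of t] by (simp add: power2_eq_square)
  have "u \<times> (u \<times> (d \<times> x)) = (u \<bullet> x) *\<^sub>R (u \<times> d)"
    by (simp add: cross_cross_right[of u d x] assms(2) cross_mult_right)
  then have dx: "d \<times> x = (u \<bullet> (d \<times> x)) *\<^sub>R u - (u \<bullet> x) *\<^sub>R (u \<times> d)"
    by (simp add: cross_cross_right[of u u] uu algebra_simps)
  define T where "T = u \<bullet> (d \<times> x)"
  have 1: "axis_variation u t d \<times> x
      = sin t *\<^sub>R (d \<times> x) - (1 - cos t) *\<^sub>R ((u \<bullet> x) *\<^sub>R d - (d \<bullet> x) *\<^sub>R u)"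
    by (simp add: axis_variation_def Cross3.left_diff_distrib cross_mult_left cross_cross_left)
  have 2: "u \<times> (axis_variation u t d \<times> x)
      = sin t *\<^sub>R ((u \<bullet> x) *\<^sub>R d) - (1 - cos t) *\<^sub>R ((u \<bullet> x) *\<^sub>R (u \<times> d))"
    unfolding 1
    by (simp add: Cross3.right_diff_distrib cross_mult_right cross_cross_right[of u d x] assms(2))
  have 3: "u \<bullet> (axis_variation u t d \<times> x) = sin t * T + (1 - cos t) * (d \<bullet> x)"
    unfolding 1 by (simp add: T_def inner_diff_right assms(2) uu)
  have collect: "s *\<^sub>R (T *\<^sub>R u - p *\<^sub>R w) + (1 - k) *\<^sub>R (q *\<^sub>R u + p *\<^sub>R d)
      = k *\<^sub>R (s *\<^sub>R (T *\<^sub>R u - p *\<^sub>R w) - (1 - k) *\<^sub>R (p *\<^sub>R d - q *\<^sub>R u))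
        + s *\<^sub>R (s *\<^sub>R (p *\<^sub>R d) - (1 - k) *\<^sub>R (p *\<^sub>R w))
        + ((1 - k) * (s * T + (1 - k) * q)) *\<^sub>R u" (is "?l = ?r")
    if "s * s = 1 - k * k" for s k p q and w :: "real^3"
  proof -
    have "?r = ?l + ((s * s - (1 - k * k)) * p) *\<^sub>R d" by (simp add: vec_eq_iff algebra_simps)
    then show ?thesis using that by simp
  qed
  have dT: "d \<times> x = T *\<^sub>R u - (u \<bullet> x) *\<^sub>R (u \<times> d)" unfolding T_def by (rule dx)
  show ?thesis
    unfolding rot_def 2 3 unfolding 1 unfolding dT using s2
    by (rule collect)
qed

lemma bend_derivative:
  assumes "ssum A \<sigma> \<noteq> 0"
  defines "u \<equiv> sgn (ssum A \<sigma>)"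
  defines "d \<equiv> \<lambda>v. inverse (norm (ssum A \<sigma>)) *\<^sub>R (ssum A v - (u \<bullet> ssum A v) *\<^sub>R u)"
  shows "frechet_derivative (bend A t) (at \<sigma>) v $ e =
    (if e \<in> A then rot u t (v $ e + axis_variation u t (d v) \<times> \<sigma> $ e) else v $ e)"
proof -
  have D: "(bend A t has_derivative frechet_derivative (bend A t) (at \<sigma>)) (at \<sigma>)"
    by (rule smooth_on_has_derivative[OF smooth_on_bend]) (use assms(1) in simp)
  have line: "((\<lambda>h. \<sigma> + h *\<^sub>R v) has_vector_derivative v) (at 0)"
    by (auto intro!: derivative_eq_intros)
  have along: "((\<lambda>h. f (\<sigma> + h *\<^sub>R v)) has_vector_derivative f' v) (at 0)"
    if "(f has_derivative f') (at \<sigma>)" for f :: "'a config \<Rightarrow> 'b::real_normed_vector" and f'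
    using that line
    by (intro vector_derivative_diff_chain_within[of "\<lambda>h. \<sigma> + h *\<^sub>R v" v 0 UNIV f f',
          unfolded o_def]) (auto intro: has_derivative_at_withinI)
  have u1: "norm u = 1" and uu: "u \<bullet> u = 1"
    using assms(1) by (simp_all add: u_def norm_sgn flip: norm_eq_1)
  have "u \<bullet> d v = 0" by (simp add: d_def inner_diff_right uu)
  note var = rot_axis_variation[OF u1 this, of t "\<sigma> $ e"]
  have lhs: "((\<lambda>h. bend A t (\<sigma> + h *\<^sub>R v) $ e) has_vector_derivative
      frechet_derivative (bend A t) (at \<sigma>) v $ e) (at 0)"
    by (rule bounded_linear.has_vector_derivative[OF bounded_linear_vec_nth along[OF D]])
  have x: "((\<lambda>h. (\<sigma> + h *\<^sub>R v) $ e) has_vector_derivative v $ e) (at 0)"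
    by (rule bounded_linear.has_vector_derivative[OF bounded_linear_vec_nth line])
  have "((\<lambda>\<sigma>. sgn (ssum A \<sigma>)) has_derivative d) (at \<sigma>)"
    using has_derivative_compose[OF bounded_linear_imp_has_derivative[OF bounded_linear_ssum]
        sgn_has_derivative[OF assms(1)]] by (simp add: d_def u_def)
  from along[OF this]
  have u': "((\<lambda>h. sgn (ssum A (\<sigma> + h *\<^sub>R v))) has_vector_derivative d v) (at 0)" .
  have rhs: "((\<lambda>h. bend A t (\<sigma> + h *\<^sub>R v) $ e) has_vector_derivative
    (if e \<in> A then rot u t (v $ e + axis_variation u t (d v) \<times> \<sigma> $ e) else v $ e)) (at 0)"
  proof (cases "e \<in> A")
    case True
    show ?thesis
      unfolding bend_nth if_P[OF True]
      by (rule has_vector_derivative_eq_rhs[OF rot_has_vector_derivative[OF DERIV_const u' x]])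
        (simp add: rot_add flip: u_def var, simp add: rot_def algebra_simps)
  next
    case False
    then show ?thesis using x by (simp add: bend_nth)
  qed
  show ?thesis by (rule vector_derivative_unique_at[OF lhs rhs])
qed

text \<open>
  The corrections coming from the moving axis add up to a multiple of
  \<open>2 (cos t - 1) + sin\<^sup>2 t + (1 - cos t)\<^sup>2 = 0\<close>.
\<close>

lemma axis_variations_cancel:
  fixes u d d' :: "real^3" and t :: real
  assumes "norm u = 1" "u \<bullet> d = 0" "u \<bullet> d' = 0"
  defines "c \<equiv> axis_variation u t d" and "c' \<equiv> axis_variation u t d'"
  shows "d' \<bullet> c - d \<bullet> c' + u \<bullet> (c \<times> c') = 0"
proof -
  have uu: "u \<bullet> u = 1" using assms(1) by (simp add: norm_eq_1)
  have s2: "sin t * sin t = 1 - cos t * cos t"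
    using sin_cos_squared_add[of t] by (simp add: power2_eq_square)
  define D where "D = u \<bullet> (d \<times> d')"
  have 1: "d' \<bullet> (u \<times> d) = D" "d \<bullet> (u \<times> d') = - D"
    unfolding D_def by (metis triple_rotate, metis triple_swap)
  have 2: "u \<bullet> (d \<times> (u \<times> d')) = d \<bullet> d'" "u \<bullet> ((u \<times> d) \<times> d') = - (d \<bullet> d')"
    by (simp_all add: cross_cross_right cross_cross_left inner_diff_right assms uu)
  have 3: "u \<bullet> ((u \<times> d) \<times> (u \<times> d')) = D"
    by (simp add: cross_cross_left inner_diff_right uu 1 assms dot_cross_self)
  have "u \<bullet> (c \<times> c') = (sin t * sin t + (1 - cos t) * (1 - cos t)) * D"
  proof -
    have "u \<bullet> ((s *\<^sub>R d - k *\<^sub>R (u \<times> d)) \<times> (s *\<^sub>R d' - k *\<^sub>R (u \<times> d'))) = (s * s + k * k) * D"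
      for s k :: real
      by (simp add: Cross3.left_diff_distrib Cross3.right_diff_distrib cross_mult_left
          cross_mult_right inner_diff_right 2 3 D_def[symmetric] algebra_simps)
    then show ?thesis unfolding c_def c'_def axis_variation_def .
  qed
  moreover have "d' \<bullet> c - d \<bullet> c' = - 2 * (1 - cos t) * D"
    by (simp add: c_def c'_def axis_variation_def inner_diff_right 1 inner_commute[of d' d]
        algebra_simps)
  ultimately show ?thesis by (simp add: s2 algebra_simps)
qed

lemma kks_rot:
  "norm u = 1 \<Longrightarrow> kks s (rot u t z) (rot u t v) (rot u t w) = kks s z v w"
  by (simp add: kks_def rot_inner flip: rot_cross)

lemma kks_shift:
  assumes "norm z = s" "s > 0" "z \<bullet> v = 0" "z \<bullet> w = 0"
  shows "kks s z (v + c \<times> z) (w + c' \<times> z) = kks s z v w + (c \<bullet> w - c' \<bullet> v + z \<bullet> (c \<times> c'))"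
proof -
  have zz: "z \<bullet> z = s\<^sup>2" using assms(1) by (simp add: power2_norm_eq_inner[symmetric])
  have "z \<bullet> (v \<times> (c' \<times> z)) = - (s\<^sup>2 * (c' \<bullet> v))"
    by (simp add: cross_cross_right inner_diff_right zz assms inner_commute[of v])
  moreover have "z \<bullet> ((c \<times> z) \<times> w) = s\<^sup>2 * (c \<bullet> w)"
    by (simp add: cross_cross_left inner_diff_right zz assms)
  moreover have "z \<bullet> ((c \<times> z) \<times> (c' \<times> z)) = s\<^sup>2 * (z \<bullet> (c \<times> c'))"
    by (simp add: cross_cross_left inner_diff_right zz dot_cross_self)
      (metis triple_rotate)
  ultimately have "z \<bullet> ((v + c \<times> z) \<times> (w + c' \<times> z))
      = z \<bullet> (v \<times> w) + s\<^sup>2 * (c \<bullet> w - c' \<bullet> v + z \<bullet> (c \<times> c'))"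
    by (simp add: cross_add_left cross_add_right inner_add_right algebra_simps)
  then show ?thesis using assms(2) by (simp add: kks_def add_divide_distrib)
qed

lemma symplectic_lift_bend:
  fixes len :: "'e::finite \<Rightarrow> real"
  assumes len: "\<And>e. len e > 0" and A: "nonvanishing len A"
  shows "symplectic_lift len (bend A t)"
  unfolding symplectic_lift_def
proof (intro conjI ballI)
  show "\<exists>U. open U \<and> polt len \<subseteq> U \<and> smooth_on U (bend A t)"
    using open_ssum_nonzero smooth_on_bend A
    by (intro exI[of _ "{\<rho>. ssum A \<rho> \<noteq> 0}"]) (auto simp: nonvanishing_def)
  fix \<sigma> assume \<sigma>: "\<sigma> \<in> polt len"
  have ne: "ssum A \<sigma> \<noteq> 0" by (rule nonvanishingD[OF A \<sigma>])
  show G: "bend A t \<sigma> \<in> polt len" by (rule bend_polt[OF \<sigma> ne])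
  define u where "u = sgn (ssum A \<sigma>)"
  define r where "r = norm (ssum A \<sigma>)"
  define d where "d v = inverse r *\<^sub>R (ssum A v - (u \<bullet> ssum A v) *\<^sub>R u)" for v
  define c where "c v = axis_variation u t (d v)" for v
  let ?D = "frechet_derivative (bend A t) (at \<sigma>)"
  have D: "?D v $ e = (if e \<in> A then rot u t (v $ e + c v \<times> \<sigma> $ e) else v $ e)" for v e
    unfolding c_def d_def u_def r_def by (rule bend_derivative[OF ne])
  have u1: "norm u = 1" and uu: "u \<bullet> u = 1"
    using ne by (simp_all add: u_def norm_sgn flip: norm_eq_1)
  have r: "r > 0" using ne by (simp add: r_def)
  have ud: "u \<bullet> d v = 0" for v by (simp add: d_def inner_diff_right uu)
  have S: "ssum A \<sigma> = r *\<^sub>R u" using ne by (simp add: u_def r_def sgn_div_norm)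
  have dS: "ssum A v = r *\<^sub>R d v + (u \<bullet> ssum A v) *\<^sub>R u" for v using r by (simp add: d_def)
  show "?D v \<in> polt_tangent len (bend A t \<sigma>)" if v: "v \<in> polt_tangent len \<sigma>" for v
  proof -
    have "?D v $ e \<bullet> bend A t \<sigma> $ e = 0" for e
      using v by (simp add: D bend_nth rot_inner[OF u1] inner_add_left dot_cross_self
          polt_tangent_def flip: u_def)
    moreover have "ssum UNIV (?D v) = 0"
    proof -
      have "(bend A t has_derivative ?D) (at \<sigma>)"
        by (rule smooth_on_has_derivative[OF smooth_on_bend]) (use ne in simp)
      from has_derivative_compose[OF this
          bounded_linear_imp_has_derivative[OF bounded_linear_ssum[of UNIV]]]
      have "((\<lambda>\<rho>. ssum UNIV \<rho>) has_derivative (\<lambda>v. ssum UNIV (?D v))) (at \<sigma>)"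
        by (simp only: ssum_bend_superset subset_UNIV)
      moreover have "((\<lambda>\<rho>. ssum UNIV \<rho>) has_derivative (\<lambda>v. ssum UNIV v)) (at \<sigma>)"
        by (rule bounded_linear_imp_has_derivative[OF bounded_linear_ssum])
      ultimately have "(\<lambda>v. ssum UNIV (?D v)) = (\<lambda>v. ssum UNIV v)"
        by (rule has_derivative_unique)
      then have "ssum UNIV (?D v) = ssum UNIV v" by (rule fun_cong)
      then show ?thesis using v by (simp add: polt_tangent_def)
    qed
    ultimately show ?thesis by (simp add: polt_tangent_def)
  qed
  fix v w assume vw: "v \<in> polt_tangent len \<sigma>" "w \<in> polt_tangent len \<sigma>"
  have "kks (len e) (bend A t \<sigma> $ e) (?D v $ e) (?D w $ e)
      = kks (len e) (\<sigma> $ e) (v $ e) (w $ e)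
        + (if e \<in> A then c v \<bullet> w $ e - c w \<bullet> v $ e + \<sigma> $ e \<bullet> (c v \<times> c w) else 0)" for e
    using vw kks_shift[OF polt_norm[OF \<sigma>] len]
    by (simp add: D bend_nth kks_rot[OF u1] polt_tangent_def inner_commute flip: u_def)
  then have "orbit_prod_form len (bend A t \<sigma>) (?D v) (?D w)
      = orbit_prod_form len \<sigma> v w
        + (c v \<bullet> ssum A w - c w \<bullet> ssum A v + ssum A \<sigma> \<bullet> (c v \<times> c w))"
    by (simp add: orbit_prod_form_def sum.distrib sum.If_cases sum_subtractf inner_sum_right
        inner_sum_left)
  also have "c v \<bullet> ssum A w - c w \<bullet> ssum A v + ssum A \<sigma> \<bullet> (c v \<times> c w)
      = r * (d w \<bullet> c v - d v \<bullet> c w + u \<bullet> (c v \<times> c w))"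
  proof -
    have cu: "c x \<bullet> u = 0" for x
      using ud[of x]
      by (simp add: c_def axis_variation_def inner_diff_right dot_cross_self inner_commute[of _ u])
    have "c x \<bullet> ssum A y = r * (d y \<bullet> c x)" for x y
      using cu[of x] by (subst dS) (simp add: inner_add_right inner_commute)
    then show ?thesis by (simp add: S algebra_simps)
  qed
  also have "\<dots> = 0"
    using axis_variations_cancel[OF u1 ud ud, of w t v] by (simp add: c_def)
  finally show "orbit_prod_form len (bend A t \<sigma>) (?D v) (?D w) = orbit_prod_form len \<sigma> v w"
    by simp
qed


section \<open>Polygons in general position\<close>

definition triple :: "'e::finite set \<Rightarrow> 'e set \<Rightarrow> 'e set \<Rightarrow> 'e config \<Rightarrow> real" where
  "triple A B C \<rho> = ssum A \<rho> \<bullet> (ssum B \<rho> \<times> ssum C \<rho>)"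

definition four_parts :: "'e set \<Rightarrow> 'e set \<Rightarrow> 'e set \<Rightarrow> 'e set \<Rightarrow> bool" where
  "four_parts P1 P2 P3 P4 \<longleftrightarrow> P1 \<inter> P2 = {} \<and> P1 \<inter> P3 = {} \<and> P1 \<inter> P4 = {} \<and> P2 \<inter> P3 = {} \<and>
     P2 \<inter> P4 = {} \<and> P3 \<inter> P4 = {} \<and> P1 \<union> P2 \<union> P3 \<union> P4 = UNIV \<and>
     P1 \<noteq> {} \<and> P2 \<noteq> {} \<and> P3 \<noteq> {} \<and> P4 \<noteq> {}"

lemma four_parts_permute:
  "four_parts P1 P2 P3 P4 \<Longrightarrow> four_parts P1 P3 P2 P4"
  "four_parts P1 P2 P3 P4 \<Longrightarrow> four_parts P1 P4 P2 P3"
  by (auto simp: four_parts_def)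

lemma four_parts_sum:
  assumes "four_parts P1 P2 P3 P4" "\<rho> \<in> polt len"
  shows "ssum P1 \<rho> + ssum P2 \<rho> + ssum P3 \<rho> + ssum P4 \<rho> = 0"
proof -
  have "ssum (P1 \<union> P2 \<union> P3 \<union> P4) \<rho> = ssum P1 \<rho> + ssum P2 \<rho> + ssum P3 \<rho> + ssum P4 \<rho>"
  proof -
    have "P1 \<inter> P2 = {}" "(P1 \<union> P2) \<inter> P3 = {}" "(P1 \<union> P2 \<union> P3) \<inter> P4 = {}"
      using assms(1) by (auto simp: four_parts_def)
    then show ?thesis by (simp only: ssum_Un)
  qed
  moreover have "P1 \<union> P2 \<union> P3 \<union> P4 = UNIV" using assms(1) by (simp add: four_parts_def)
  ultimately show ?thesis using polt_sum[OF assms(2)] by simp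
qed

lemma parallel_trans:
  "a \<times> b = 0 \<Longrightarrow> b \<times> c = 0 \<Longrightarrow> b \<noteq> 0 \<Longrightarrow> a \<times> c = (0::real^3)"
proof -
  assume ab: "a \<times> b = 0" "b \<times> c = 0" "b \<noteq> 0"
  have "b \<bullet> (a \<times> c) = 0"
    using ab(2) by (metis inner_zero_right triple_swap neg_equal_0_iff_equal)
  moreover have "b \<times> (a \<times> c) = 0"
    using ab cross_cross_right[of b a c] cross_cross_right[of a b c] cross_cross_left[of a b c]
    by (simp add: inner_commute)
  ultimately show ?thesis using ab(3) norm_cross_dot[of b "a \<times> c"] by simp
qed

lemma isCont_bend: "isCont (\<lambda>t. bend A t \<rho>) t0"
proof -
  have "isCont (\<lambda>t. rot u t x) t0" for u x :: "real^3"
    unfolding rot_def by (intro continuous_intros)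
  then have "isCont (\<lambda>t. bend A t \<rho> $ e) t0" for e
    by (cases "e \<in> A") (simp_all add: bend_nth)
  from bounded_linear.continuous[OF bounded_linear_axis this]
  have "isCont (\<lambda>t. \<Sum>e\<in>UNIV. axis e (bend A t \<rho> $ e)) t0"
    by (rule continuous_sum)
  then show ?thesis by (simp only: config_eq_sum_axis)
qed

text \<open>
  Some edge of \<open>P\<close> is not parallel to some edge outside, for otherwise the polygon is collinear.
  Rotating this pair about its sum moves the sum of \<open>P\<close> in a direction which is not parallel to
  a prescribed vector; sets containing both edges or none of them are not affected.
\<close>

lemma perturb_ssum:
  fixes len :: "'e::finite \<Rightarrow> real"
  assumes len: "\<And>e. len e > 0" "generic len" and \<rho>: "\<rho> \<in> polt len"
    and P: "P \<noteq> {}" "P \<noteq> UNIV" and w: "w \<noteq> 0"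
  shows "\<exists>e f. e \<in> P \<and> f \<notin> P \<and> (\<forall>\<epsilon>>0. \<exists>\<sigma>\<in>polt len. dist \<sigma> \<rho> < \<epsilon> \<and>
    (ssum P \<sigma> - ssum P \<rho>) \<times> w \<noteq> 0 \<and>
    (\<forall>Q. (e \<in> Q \<longleftrightarrow> f \<in> Q) \<longrightarrow> ssum Q \<sigma> = ssum Q \<rho>))"
proof -
  have nz: "\<rho> $ e \<noteq> 0" for e using polt_norm[OF \<rho>, of e] len(1)[of e] by auto
  have "\<exists>e\<in>P. \<exists>f\<in>-P. \<rho> $ e \<times> \<rho> $ f \<noteq> 0"
  proof (rule ccontr)
    assume "\<not> ?thesis"
    then have par: "\<rho> $ e \<times> \<rho> $ f = 0" if "e \<in> P" "f \<notin> P" for e f using that by auto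
    obtain e0 f0 where ef: "e0 \<in> P" "f0 \<notin> P" using P by auto
    have 1: "\<rho> $ e \<times> \<rho> $ f0 = 0" for e
    proof (cases "e \<in> P")
      case False
      then have "\<rho> $ e \<times> \<rho> $ e0 = 0" using par[OF ef(1), of e] cross_skew by (metis neg_equal_0_iff_equal)
      then show ?thesis using par[OF ef] parallel_trans nz by blast
    qed (use par ef in auto)
    have "\<rho> $ e \<times> \<rho> $ f = 0" for e f
    proof -
      have "\<rho> $ f0 \<times> \<rho> $ f = 0" using 1[of f] cross_skew by (metis neg_equal_0_iff_equal)
      then show ?thesis using 1[of e] parallel_trans nz by blast
    qed
    then show False using polt_not_collinear[OF len \<rho>] by blast
  qed
  then obtain e f where ef: "e \<in> P" "f \<notin> P" "\<rho> $ e \<times> \<rho> $ f \<noteq> 0" by auto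
  let ?b = "\<rho> $ e + \<rho> $ f"
  have b: "ssum {e, f} \<rho> = ?b" using ef by (subst sum.insert) auto
  have be: "?b \<times> \<rho> $ e \<noteq> 0"
    using ef(3) cross_skew[of "\<rho> $ e"] by (simp add: cross_add_left)
  then have bnz: "?b \<noteq> 0" by auto
  define u where "u = sgn ?b"
  have u: "norm u = 1" "u \<times> \<rho> $ e \<noteq> 0"
    using be bnz by (auto simp: u_def norm_sgn sgn_div_norm cross_mult_left)
  have "\<exists>\<sigma>\<in>polt len. dist \<sigma> \<rho> < \<epsilon> \<and> (ssum P \<sigma> - ssum P \<rho>) \<times> w \<noteq> 0 \<and>
      (\<forall>Q. (e \<in> Q \<longleftrightarrow> f \<in> Q) \<longrightarrow> ssum Q \<sigma> = ssum Q \<rho>)" if \<epsilon>: "\<epsilon> > 0" for \<epsilon>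
  proof -
    let ?g = "\<lambda>t. bend {e, f} t \<rho>"
    have "isCont ?g 0" by (rule isCont_bend)
    then have "\<forall>\<^sub>F t in at 0. dist (?g t) (?g 0) < \<epsilon>"
      using \<epsilon> unfolding isCont_def by (rule tendstoD)
    then obtain \<delta> where \<delta>: "\<delta> > 0" "\<And>t. t \<noteq> 0 \<Longrightarrow> \<bar>t\<bar> < \<delta> \<Longrightarrow> dist (?g t) \<rho> < \<epsilon>"
      unfolding eventually_at by (auto simp: dist_real_def)
    define t where "t = min \<delta> pi / 2"
    have t: "0 < t" "t < pi" "t < \<delta>" using \<delta>(1) pi_gt_zero unfolding t_def by (linarith | simp add: min_def)+
    obtain s where s: "s = t \<or> s = - t" "(rot u s (\<rho> $ e) - \<rho> $ e) \<times> w \<noteq> 0"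
      using rot_displacement_not_parallel[OF u w t(1,2)] by blast
    have sd: "dist (?g s) \<rho> < \<epsilon>" using \<delta>(2)[of s] s(1) t by auto
    have p: "?g s \<in> polt len" by (rule bend_polt[OF \<rho>]) (simp add: b bnz)
    have "ssum P (?g s) - ssum P \<rho> = (\<Sum>g\<in>P. if g = e then rot u s (\<rho> $ e) - \<rho> $ e else 0)"
      unfolding sum_subtractf[symmetric]
      using ef by (intro sum.cong) (auto simp: bend_nth b u_def)
    then have "(ssum P (?g s) - ssum P \<rho>) \<times> w \<noteq> 0" using s(2) ef by simp
    moreover have "ssum Q (?g s) = ssum Q \<rho>" if "e \<in> Q \<longleftrightarrow> f \<in> Q" for Q
      using that ssum_bend_superset[of "{e, f}" Q] ssum_bend_disjoint[of Q "{e, f}"] by blast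
    ultimately show ?thesis using p sd by blast
  qed
  with ef show ?thesis by blast
qed

lemma ssum_nonzero_nearby:
  assumes "finite F" "\<And>Q. Q \<in> F \<Longrightarrow> ssum Q \<rho> \<noteq> 0"
  shows "\<exists>\<epsilon>>0. \<forall>\<sigma>. dist \<sigma> \<rho> < \<epsilon> \<longrightarrow> (\<forall>Q\<in>F. ssum Q \<sigma> \<noteq> 0)"
  using assms
proof (induction F rule: finite_induct)
  case empty
  show ?case by (intro exI[of _ 1]) simp
next
  case (insert Q F)
  obtain \<delta> where \<delta>: "\<delta> > 0" "\<And>\<sigma>. dist \<sigma> \<rho> < \<delta> \<Longrightarrow> \<forall>Q\<in>F. ssum Q \<sigma> \<noteq> 0"
    using insert.IH insert.prems by auto
  have "isCont (\<lambda>\<rho>. ssum Q \<rho>) \<rho>" by (intro continuous_intros)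
  from continuous_at_avoid[OF this, of 0] insert.prems
  obtain \<epsilon> where \<epsilon>: "\<epsilon> > 0" "\<And>\<sigma>. dist \<sigma> \<rho> < \<epsilon> \<Longrightarrow> ssum Q \<sigma> \<noteq> 0"
    by (auto simp: dist_commute)
  show ?case using \<delta> \<epsilon> by (intro exI[of _ "min \<delta> \<epsilon>"]) auto
qed

lemma polt_parts_nonzero:
  fixes len :: "'e::finite \<Rightarrow> real"
  assumes len: "\<And>e. len e > 0" "generic len" "polt len \<noteq> {}"
    and F: "finite F" "\<And>P. P \<in> F \<Longrightarrow> P \<noteq> {} \<and> P \<noteq> UNIV"
  shows "\<exists>\<rho>\<in>polt len. \<forall>P\<in>F. ssum P \<rho> \<noteq> 0"
  using F
proof (induction F rule: finite_induct)
  case (insert P F)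
  then obtain \<rho> where \<rho>: "\<rho> \<in> polt len" "\<And>Q. Q \<in> F \<Longrightarrow> ssum Q \<rho> \<noteq> 0" by auto
  show ?case
  proof (cases "ssum P \<rho> = 0")
    case True
    obtain \<epsilon> where \<epsilon>: "\<epsilon> > 0" "\<And>Q \<sigma>. Q \<in> F \<Longrightarrow> dist \<sigma> \<rho> < \<epsilon> \<Longrightarrow> ssum Q \<sigma> \<noteq> 0"
      using ssum_nonzero_nearby[OF insert.hyps(1) \<rho>(2)] by blast
    have P: "P \<noteq> {}" "P \<noteq> UNIV" using insert.prems by auto
    obtain w :: "real^3" where "w \<noteq> 0" using zero_neq_one by blast
    from perturb_ssum[OF len(1,2) \<rho>(1) P this] \<epsilon>(1)
    obtain \<sigma> where "\<sigma> \<in> polt len" "dist \<sigma> \<rho> < \<epsilon>" "(ssum P \<sigma> - ssum P \<rho>) \<times> w \<noteq> 0" by blast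
    then show ?thesis using \<epsilon> True by (intro bexI[of _ \<sigma>]) auto
  qed (use \<rho> in auto)
qed (use len in auto)

text \<open>
  If the four sums lie in a plane, a quarter turn of the first two parts about the sum of both
  makes the plane of these two vertical; it then meets the old plane only in the axis, and \<open>P3\<close>
  is not parallel to the axis because it is not parallel to \<open>P4\<close>.
\<close>

lemma bend_out_of_plane:
  fixes len :: "'e::finite \<Rightarrow> real"
  assumes P: "four_parts P1 P2 P3 P4" and \<rho>: "\<rho> \<in> polt len"
    and np: "ssum P1 \<rho> \<times> ssum P2 \<rho> \<noteq> 0" "ssum P3 \<rho> \<times> ssum P4 \<rho> \<noteq> 0"
  shows "\<exists>\<sigma>\<in>polt len. triple P1 P2 P3 \<sigma> \<noteq> 0"
proof (rule ccontr)
  assume c: "\<not> ?thesis"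
  let ?a = "ssum P1 \<rho>" and ?b = "ssum P2 \<rho>" and ?c = "ssum P3 \<rho>" and ?d = "ssum P4 \<rho>"
  have ab: "ssum (P1 \<union> P2) \<rho> = ?a + ?b" using P by (simp add: four_parts_def ssum_Un)
  have "?a \<times> (?a + ?b) \<noteq> 0" using np(1) by (simp add: cross_add_right)
  then have nz: "?a + ?b \<noteq> 0" by auto
  define u where "u = sgn (?a + ?b)"
  have u: "norm u = 1" "?a + ?b = norm (?a + ?b) *\<^sub>R u"
    using nz by (simp_all add: u_def norm_sgn sgn_div_norm)
  have nabs: "u \<bullet> (?a \<times> ?b) = 0"
  proof -
    have "(?a + ?b) \<bullet> (?a \<times> ?b) = 0" by (simp add: inner_add_left dot_cross_self)
    then show ?thesis by (simp add: u_def sgn_div_norm)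
  qed
  define \<sigma> where "\<sigma> = bend (P1 \<union> P2) (pi / 2) \<rho>"
  have \<sigma>: "\<sigma> \<in> polt len" unfolding \<sigma>_def using ab nz by (intro bend_polt[OF \<rho>]) simp
  have "P3 \<inter> (P1 \<union> P2) = {}" using P by (auto simp: four_parts_def)
  then have "triple P1 P2 P3 \<sigma> = ?c \<bullet> (rot u (pi/2) ?a \<times> rot u (pi/2) ?b)"
    unfolding triple_def
    by (simp add: \<sigma>_def ssum_bend_subset ssum_bend_disjoint ab flip: u_def)
      (metis triple_rotate)
  also have "\<dots> = ?c \<bullet> (u \<times> (?a \<times> ?b))"
    by (simp add: rot_cross[OF u(1), symmetric]) (simp add: rot_def nabs)
  finally have 1: "?c \<bullet> (u \<times> (?a \<times> ?b)) = 0" using c \<sigma> by auto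
  have 2: "?c \<bullet> (?a \<times> ?b) = 0" using c \<rho> by (auto simp: triple_def) (metis triple_rotate)
  have "(?c \<times> u) \<bullet> (?a \<times> ?b) = 0"
    using 1 by (metis inner_commute triple_rotate)
  moreover have "(?c \<times> u) \<times> (?a \<times> ?b) = 0"
    using nabs 2 by (simp add: cross_cross_left)
  ultimately have "?c \<times> u = 0"
    using norm_cross_dot[of "?c \<times> u" "?a \<times> ?b"] np(1) by simp
  then have "?c \<times> (?a + ?b) = 0" by (subst u(2)) (simp add: cross_mult_right)
  moreover have "?d = - (?a + ?b) - ?c"
    using four_parts_sum[OF P \<rho>] by (simp add: algebra_simps eq_neg_iff_add_eq_0)
  ultimately have "?c \<times> ?d = - (?c \<times> (?a + ?b)) - ?c \<times> ?c"
    by (simp only: Cross3.right_diff_distrib cross_minus_right)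
  with \<open>?c \<times> (?a + ?b) = 0\<close> show False using np(2) by simp
qed

text \<open>
  A small perturbation makes the four sums nonzero and not all parallel.  As they add up to \<open>0\<close>,
  they can then be divided into two pairs which are not parallel, and bending along one pair
  makes them span the space.
\<close>

theorem polt_general_position:
  fixes len :: "'e::finite \<Rightarrow> real"
  assumes len: "\<And>e. len e > 0" "generic len" "polt len \<noteq> {}" and P: "four_parts P1 P2 P3 P4"
  shows "\<exists>\<rho>\<in>polt len. triple P1 P2 P3 \<rho> \<noteq> 0"
proof -
  let ?F = "{P1, P2, P3, P4}"
  have F: "Q \<noteq> {} \<and> Q \<noteq> UNIV" if "Q \<in> ?F" for Q
    using that P unfolding four_parts_def by blast
  obtain \<rho>0 where \<rho>0: "\<rho>0 \<in> polt len" "\<And>Q. Q \<in> ?F \<Longrightarrow> ssum Q \<rho>0 \<noteq> 0"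
    using polt_parts_nonzero[OF len, of ?F] F by auto
  have "\<exists>\<rho>\<in>polt len. (\<forall>Q\<in>?F. ssum Q \<rho> \<noteq> 0) \<and> (\<exists>Q\<in>?F. \<exists>Q'\<in>?F. ssum Q \<rho> \<times> ssum Q' \<rho> \<noteq> 0)"
  proof (cases "\<exists>Q\<in>?F. \<exists>Q'\<in>?F. ssum Q \<rho>0 \<times> ssum Q' \<rho>0 \<noteq> 0")
    case False
    obtain \<epsilon>0 where \<epsilon>0: "\<epsilon>0 > 0" "\<And>\<sigma>. dist \<sigma> \<rho>0 < \<epsilon>0 \<Longrightarrow> \<forall>Q\<in>?F. ssum Q \<sigma> \<noteq> 0"
      using ssum_nonzero_nearby[of ?F \<rho>0] \<rho>0(2) by (metis finite)
    have w: "ssum P1 \<rho>0 \<noteq> 0" "P1 \<noteq> {}" "P1 \<noteq> UNIV" using \<rho>0 F by auto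
    from perturb_ssum[OF len(1,2) \<rho>0(1) w(2,3,1)] \<epsilon>0(1)
    obtain e f \<sigma> where \<sigma>: "e \<in> P1" "f \<notin> P1" "\<sigma> \<in> polt len" "dist \<sigma> \<rho>0 < \<epsilon>0"
      "(ssum P1 \<sigma> - ssum P1 \<rho>0) \<times> ssum P1 \<rho>0 \<noteq> 0"
      "\<And>Q. (e \<in> Q \<longleftrightarrow> f \<in> Q) \<Longrightarrow> ssum Q \<sigma> = ssum Q \<rho>0" by blast
    have nz: "ssum Q \<sigma> \<noteq> 0" if "Q \<in> ?F" for Q using \<epsilon>0(2)[OF \<sigma>(4)] that by (rule bspec)
    \<comment> \<open>At most one part besides \<open>P1\<close> is affected, so one part keeps its old direction.\<close>
    have "\<exists>Q\<in>?F. e \<notin> Q \<and> f \<notin> Q"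
    proof (rule ccontr)
      assume "\<not> ?thesis"
      then have "f \<in> P2" "f \<in> P3" using \<sigma>(1) P by (auto simp: four_parts_def)
      then show False using P by (auto simp: four_parts_def)
    qed
    then obtain Q where Q: "Q \<in> ?F" "ssum Q \<sigma> = ssum Q \<rho>0" using \<sigma>(6) by blast
    have "ssum P1 \<sigma> \<times> ssum Q \<sigma> \<noteq> 0"
    proof
      assume "ssum P1 \<sigma> \<times> ssum Q \<sigma> = 0"
      moreover have "ssum Q \<sigma> \<times> ssum P1 \<rho>0 = 0" using False Q by auto
      ultimately have "ssum P1 \<sigma> \<times> ssum P1 \<rho>0 = 0" using parallel_trans nz[OF Q(1)] by blast
      then show False using \<sigma>(5) by (simp add: Cross3.left_diff_distrib)
    qed
    then show ?thesis using \<sigma>(3) nz Q(1) by blast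
  qed (use \<rho>0 in blast)
  then obtain \<rho> Q Q' where \<rho>: "\<rho> \<in> polt len" "\<And>Q. Q \<in> ?F \<Longrightarrow> ssum Q \<rho> \<noteq> 0"
    and Q: "Q \<in> ?F" "Q' \<in> ?F" "ssum Q \<rho> \<times> ssum Q' \<rho> \<noteq> 0" by blast
  let ?w1 = "ssum P1 \<rho>" and ?w2 = "ssum P2 \<rho>" and ?w3 = "ssum P3 \<rho>" and ?w4 = "ssum P4 \<rho>"
  have nz: "?w1 \<noteq> 0" "?w2 \<noteq> 0" "?w3 \<noteq> 0" "?w4 \<noteq> 0" using \<rho>(2) by auto
  note sum0 = four_parts_sum[OF P \<rho>(1)]
  have sym: "x \<times> y = 0 \<longleftrightarrow> y \<times> x = 0" for x y :: "real^3"
    using cross_skew by (metis neg_equal_0_iff_equal)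
  consider "?w1 \<times> ?w2 \<noteq> 0" "?w3 \<times> ?w4 \<noteq> 0" | "?w1 \<times> ?w3 \<noteq> 0" "?w2 \<times> ?w4 \<noteq> 0"
    | "?w1 \<times> ?w4 \<noteq> 0" "?w2 \<times> ?w3 \<noteq> 0"
  proof (rule ccontr)
    assume "\<not> thesis"
    then have "?w1 \<times> ?w2 = 0 \<or> ?w3 \<times> ?w4 = 0" "?w1 \<times> ?w3 = 0 \<or> ?w2 \<times> ?w4 = 0"
      "?w1 \<times> ?w4 = 0 \<or> ?w2 \<times> ?w3 = 0"
      using that by blast+
    moreover have tr: "?w1 \<times> ?w2 = 0 \<Longrightarrow> ?w2 \<times> ?w4 = 0 \<Longrightarrow> ?w1 \<times> ?w4 = 0"
      "?w1 \<times> ?w2 = 0 \<Longrightarrow> ?w2 \<times> ?w3 = 0 \<Longrightarrow> ?w1 \<times> ?w3 = 0"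
      "?w1 \<times> ?w3 = 0 \<Longrightarrow> ?w3 \<times> ?w4 = 0 \<Longrightarrow> ?w1 \<times> ?w4 = 0"
      "?w2 \<times> ?w4 = 0 \<Longrightarrow> ?w3 \<times> ?w4 = 0 \<Longrightarrow> ?w2 \<times> ?w3 = 0"
      using parallel_trans nz sym[of ?w3 ?w4] by blast+
    ultimately
    \<comment> \<open>Three of the four vectors are parallel, and with them their negative sum.\<close>
    have "(?w1 \<times> ?w2 = 0 \<and> ?w1 \<times> ?w3 = 0) \<or> (?w1 \<times> ?w2 = 0 \<and> ?w1 \<times> ?w4 = 0)
      \<or> (?w1 \<times> ?w3 = 0 \<and> ?w1 \<times> ?w4 = 0) \<or> (?w2 \<times> ?w3 = 0 \<and> ?w2 \<times> ?w4 = 0)"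
      using tr by blast
    then have "\<exists>w. w \<noteq> 0 \<and> w \<times> ?w1 = 0 \<and> w \<times> ?w2 = 0 \<and> w \<times> ?w3 = 0 \<and> w \<times> ?w4 = 0"
    proof -
      have s: "w \<times> ?w1 + w \<times> ?w2 + w \<times> ?w3 + w \<times> ?w4 = 0" for w
        using arg_cong[OF sum0, of "\<lambda>z. w \<times> z"] by (simp add: cross_add_right)
      consider "?w1 \<times> ?w2 = 0" "?w1 \<times> ?w3 = 0" | "?w1 \<times> ?w2 = 0" "?w1 \<times> ?w4 = 0"
        | "?w1 \<times> ?w3 = 0" "?w1 \<times> ?w4 = 0" | "?w2 \<times> ?w3 = 0" "?w2 \<times> ?w4 = 0"
        using \<open>(?w1 \<times> ?w2 = 0 \<and> ?w1 \<times> ?w3 = 0) \<or> _\<close> by blast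
      then show ?thesis
      proof cases
        case 4
        then show ?thesis using s[of ?w2] nz by (intro exI[of _ ?w2]) simp
      qed (use s[of ?w1] nz in \<open>(intro exI[of _ ?w1], simp)+\<close>)
    qed
    then obtain w where "w \<noteq> 0" "\<And>Q. Q \<in> ?F \<Longrightarrow> w \<times> ssum Q \<rho> = 0" by auto
    then have "ssum Q \<rho> \<times> w = 0" "w \<times> ssum Q' \<rho> = 0" "w \<noteq> 0"
      using Q(1,2) sym[of "ssum Q \<rho>" w] by auto
    then show False using Q(3) parallel_trans by blast
  qed
  then show ?thesis
  proof cases
    case 1
    then show ?thesis by (rule bend_out_of_plane[OF P \<rho>(1)])
  next
    case 2
    from bend_out_of_plane[OF four_parts_permute(1)[OF P] \<rho>(1) this]
    show ?thesis unfolding triple_def by (metis cross_skew inner_minus_right neg_equal_0_iff_equal)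
  next
    case 3
    from bend_out_of_plane[OF four_parts_permute(2)[OF P] \<rho>(1) this]
    obtain \<sigma> where \<sigma>: "\<sigma> \<in> polt len" "triple P1 P4 P2 \<sigma> \<noteq> 0" by blast
    have "ssum P4 \<sigma> = - (ssum P1 \<sigma> + ssum P2 \<sigma> + ssum P3 \<sigma>)"
      using four_parts_sum[OF P \<sigma>(1)] by (simp add: eq_neg_iff_add_eq_0 algebra_simps)
    then have "triple P1 P4 P2 \<sigma> = - (ssum P1 \<sigma> \<bullet> (ssum P3 \<sigma> \<times> ssum P2 \<sigma>))"
      by (simp add: triple_def cross_add_left inner_add_right dot_cross_self
          Cross3.left_diff_distrib inner_diff_right)
    then have "triple P1 P2 P3 \<sigma> \<noteq> 0"
      using \<sigma>(2) cross_skew[of "ssum P3 \<sigma>" "ssum P2 \<sigma>"] by (simp add: triple_def)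
    then show ?thesis using \<sigma>(1) by blast
  qed
qed


section \<open>Crossing bendings do not commute\<close>

text \<open>This relation between two sets does not change when one of them is replaced by its complement.\<close>

definition crossing :: "'e set \<Rightarrow> 'e set \<Rightarrow> bool" where
  "crossing A B \<longleftrightarrow> A \<inter> B \<noteq> {} \<and> A - B \<noteq> {} \<and> B - A \<noteq> {} \<and> A \<union> B \<noteq> UNIV"

lemma rot_half_turn_orthogonal: "u \<bullet> x = 0 \<Longrightarrow> rot u pi x = - x"
  by (simp add: rot_def)

text \<open>
  Let \<open>x, y, z\<close> be the sums over \<open>A - B\<close>, \<open>A \<inter> B\<close>, \<open>B - A\<close>.  If the flows commute, then the
  length of \<open>\<rho>\<^sub>A\<close> after bending along \<open>B\<close> does not change when \<open>\<rho>\<close> is first bent along \<open>A\<close> by a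
  half turn.  Comparing bendings along \<open>B\<close> by quarter turns in both directions, the triple product
  of \<open>x, y, z\<close>, divided by the length of \<open>\<rho>\<^sub>B\<close>, does not change either.  But the half turn about
  \<open>x + y\<close> reverses \<open>x \<times> y\<close>, so it changes the sign of the triple product.
\<close>


lemma commuting_bendings_not_crossing:
  fixes len :: "'e::finite \<Rightarrow> real"
  assumes len: "\<And>e. len e > 0" "generic len" "polt len \<noteq> {}"
    and AB: "nonvanishing len A" "nonvanishing len B"
    and comm: "\<And>s t. bending_flow len A s \<otimes>\<^bsub>BijGroup (Pol len)\<^esub> bending_flow len B t
      = bending_flow len B t \<otimes>\<^bsub>BijGroup (Pol len)\<^esub> bending_flow len A s"
  shows "\<not> crossing A B"
proof
  assume "crossing A B"
  then have "four_parts (A - B) (A \<inter> B) (B - A) (- (A \<union> B))"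
    by (auto simp: crossing_def four_parts_def)
  then obtain \<rho> where \<rho>: "\<rho> \<in> polt len" "triple (A - B) (A \<inter> B) (B - A) \<rho> \<noteq> 0"
    using polt_general_position[OF len] by blast
  define x y z where xyz: "x = ssum (A - B) \<rho>" "y = ssum (A \<inter> B) \<rho>" "z = ssum (B - A) \<rho>"
  have A_eq: "ssum A \<sigma> = ssum (A - B) \<sigma> + ssum (A \<inter> B) \<sigma>"
    and B_eq: "ssum B \<sigma> = ssum (A \<inter> B) \<sigma> + ssum (B - A) \<sigma>" for \<sigma> :: "'e config"
  proof -
    have "(A - B) \<inter> (A \<inter> B) = {}" "(A \<inter> B) \<inter> (B - A) = {}" by auto
    then show "ssum A \<sigma> = ssum (A - B) \<sigma> + ssum (A \<inter> B) \<sigma>"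
      "ssum B \<sigma> = ssum (A \<inter> B) \<sigma> + ssum (B - A) \<sigma>"
      using ssum_Un[of "A - B" "A \<inter> B" \<sigma>] ssum_Un[of "A \<inter> B" "B - A" \<sigma>]
      by (simp_all add: Un_Diff_Int Int_commute Un_commute)
        (metis Int_Diff_Un Int_commute Un_commute)+
  qed
  define a where "a = sgn (x + y)"
  have a: "norm a = 1"
    using norm_sgn_ssum[OF AB(1) \<rho>(1)] by (simp add: a_def A_eq xyz)
  define \<sigma> where "\<sigma> = bend A pi \<rho>"
  have \<sigma>: "\<sigma> \<in> polt len" unfolding \<sigma>_def by (rule bend_polt[OF \<rho>(1) nonvanishingD[OF AB(1) \<rho>(1)]])
  have s\<sigma>: "ssum (A - B) \<sigma> = rot a pi x" "ssum (A \<inter> B) \<sigma> = rot a pi y" "ssum (B - A) \<sigma> = z"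
    using ssum_bend_subset[of "A - B" A pi \<rho>] ssum_bend_subset[of "A \<inter> B" A pi \<rho>]
      ssum_bend_disjoint[of "B - A" A pi \<rho>]
    by (simp_all add: \<sigma>_def a_def A_eq xyz Diff_Int_distrib2)
  have nb: "ssum B \<tau> \<noteq> 0" "norm (sgn (ssum B \<tau>)) = 1" if "\<tau> \<in> polt len" for \<tau>
    using that AB(2) by (simp_all add: nonvanishingD norm_sgn)
  have after: "norm (ssum A (bend B t \<tau>))^2 = norm (ssum (A - B) \<tau>)^2 + norm (ssum (A \<inter> B) \<tau>)^2
      + 2 * (ssum (A - B) \<tau> \<bullet> rot (sgn (ssum B \<tau>)) t (ssum (A \<inter> B) \<tau>))"
    if "\<tau> \<in> polt len" for \<tau> t
    using ssum_bend_subset[of "A \<inter> B" B t \<tau>] ssum_bend_disjoint[of "A - B" B t \<tau>] nb(2)[OF that]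
    by (simp add: A_eq[of "bend B t \<tau>"] power2_norm_eq_inner inner_add_left inner_add_right
        rot_inner inner_commute Diff_Int_distrib2)
  have inv: "norm (ssum A (bend B t \<rho>)) = norm (ssum A (bend B t \<sigma>))" for t
  proof -
    have p: "bend B t \<rho> \<in> polt len" by (rule bend_polt[OF \<rho>(1) nb(1)[OF \<rho>(1)]])
    have "(bending_flow len A pi \<otimes>\<^bsub>BijGroup (Pol len)\<^esub> bending_flow len B t) (cls len \<rho>)
        = (bending_flow len B t \<otimes>\<^bsub>BijGroup (Pol len)\<^esub> bending_flow len A pi) (cls len \<rho>)"
      by (simp add: comm)
    then have "cls len (bend A pi (bend B t \<rho>)) = cls len (bend B t (bend A pi \<rho>))"
      using \<rho>(1) \<sigma> p
      by (simp add: bending_flow_eq[OF len(1,2)] AB mult_cls induced_bend_Bij induced_map_cls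
          equivariant_bend \<sigma>_def)
    moreover have "bend A pi (bend B t \<rho>) \<in> polt len" "bend B t (bend A pi \<rho>) \<in> polt len"
      using bend_polt[OF p nonvanishingD[OF AB(1) p]] bend_polt[OF \<sigma> nb(1)[OF \<sigma>]]
      by (simp_all add: \<sigma>_def)
    ultimately obtain R where "rotation_matrix R"
      "bend B t \<sigma> = rot_act R (bend A pi (bend B t \<rho>))"
      using cls_eq_iff by (metis \<sigma>_def)
    then show ?thesis
      by (simp add: ssum_rot_act rotation_matrix_norm ssum_bend_superset)
  qed
  have eq: "x \<bullet> rot (sgn (y + z)) t y = rot a pi x \<bullet> rot (sgn (rot a pi y + z)) t (rot a pi y)" for t
    using inv[of t] after[OF \<rho>(1), of t] after[OF \<sigma>, of t]
    by (simp add: s\<sigma> B_eq norm_rot[OF a] flip: xyz)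
  have quarter: "v \<bullet> rot b (pi/2) w - v \<bullet> rot b (- (pi/2)) w = 2 * (v \<bullet> (b \<times> w))" for v b w
    by (simp add: rot_def inner_add_right inner_diff_right)
  have "x \<bullet> (sgn (y + z) \<times> y) = rot a pi x \<bullet> (sgn (rot a pi y + z) \<times> rot a pi y)"
    using quarter[of x "sgn (y + z)" y] eq[of "pi/2"] eq[of "- (pi/2)"]
      quarter[of "rot a pi x" "sgn (rot a pi y + z)" "rot a pi y"] by simp
  moreover have "v \<bullet> (sgn (w + z) \<times> w) = (v \<bullet> (z \<times> w)) / norm (w + z)" for v w
    by (simp add: sgn_div_norm cross_mult_left cross_add_left divide_inverse_commute)
  ultimately have q: "(x \<bullet> (z \<times> y)) / norm (y + z)
      = (rot a pi x \<bullet> (z \<times> rot a pi y)) / norm (rot a pi y + z)" by simp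
  have ax: "a \<bullet> (y \<times> x) = 0"
    by (simp add: a_def sgn_div_norm inner_add_left dot_cross_self)
  have "rot a pi x \<bullet> (z \<times> rot a pi y) = z \<bullet> (rot a pi y \<times> rot a pi x)" by (rule triple_rotate)
  also have "\<dots> = - (x \<bullet> (z \<times> y))"
    by (simp add: rot_cross[OF a, symmetric] rot_half_turn_orthogonal[OF ax]) (rule triple_rotate[symmetric])
  finally have r: "rot a pi x \<bullet> (z \<times> rot a pi y) = - (x \<bullet> (z \<times> y))" .
  have pos: "norm (y + z) > 0" "norm (rot a pi y + z) > 0"
    using nb(1)[OF \<rho>(1)] nb(1)[OF \<sigma>] by (simp_all add: B_eq s\<sigma> xyz)
  have "x \<bullet> (z \<times> y) = 0"
  proof -
    have "(x \<bullet> (z \<times> y)) * (norm (rot a pi y + z) + norm (y + z)) = 0"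
      using q pos unfolding r by (simp add: field_simps)
    then show ?thesis using pos by (metis add_pos_pos less_irrefl mult_eq_0_iff)
  qed
  then have "x \<bullet> (y \<times> z) = 0" by (metis cross_skew inner_minus_right neg_equal_0_iff_equal)
  then show False using \<rho>(2) by (simp add: triple_def flip: xyz)
qed


section \<open>Effectiveness\<close>

text \<open>
  A bending along a set inside one of the four parts \<open>B\<close>, \<open>A - B\<close>, \<open>P - A\<close>, \<open>- P\<close> does not change
  the sums over the parts, and one along a set which contains \<open>P\<close> rotates the first three sums
  together.  This leaves bending along \<open>A\<close> as the only relative motion.
\<close>

lemma bends_four_parts:
  fixes \<tau> :: "'e::finite set \<Rightarrow> real"
  assumes \<rho>: "\<rho> \<in> polt len" and As: "distinct As" "\<And>C. C \<in> set As \<Longrightarrow> nonvanishing len C"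
    and BAP: "B \<subseteq> A" "A \<subseteq> P"
    and pos: "\<And>C. C \<in> set As \<Longrightarrow> C \<noteq> A \<Longrightarrow> C \<subseteq> B \<or> C \<subseteq> A - B \<or> C \<subseteq> P - A \<or> C \<subseteq> - P \<or> P \<subseteq> C"
  defines "s \<equiv> if A \<in> set As then \<tau> A else 0"
  shows "\<exists>Q. rotation_matrix Q \<and>
    ssum B (bends As \<tau> \<rho>) = Q *v rot (sgn (ssum A \<rho>)) s (ssum B \<rho>) \<and>
    ssum (A - B) (bends As \<tau> \<rho>) = Q *v rot (sgn (ssum A \<rho>)) s (ssum (A - B) \<rho>) \<and>
    ssum (P - A) (bends As \<tau> \<rho>) = Q *v ssum (P - A) \<rho>"
  unfolding s_def using As pos
proof (induction As)
  case Nil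
  show ?case by (intro exI[of _ "mat 1"]) (simp add: rotation_matrix_id)
next
  case (Cons C As)
  let ?\<sigma> = "bends As \<tau> \<rho>" and ?a = "sgn (ssum A \<rho>)"
  let ?s = "if A \<in> set As then \<tau> A else 0"
  obtain Q where Q: "rotation_matrix Q" "ssum B ?\<sigma> = Q *v rot ?a ?s (ssum B \<rho>)"
    "ssum (A - B) ?\<sigma> = Q *v rot ?a ?s (ssum (A - B) \<rho>)"
    "ssum (P - A) ?\<sigma> = Q *v ssum (P - A) \<rho>"
    using Cons by auto
  have \<sigma>: "?\<sigma> \<in> polt len" using Cons.prems by (intro bends_polt[OF \<rho>]) auto
  have C: "norm (sgn (ssum C ?\<sigma>)) = 1" using norm_sgn_ssum[OF _ \<sigma>] Cons.prems by simp
  consider "C = A" | "C \<noteq> A" "C \<subseteq> B \<or> C \<subseteq> A - B \<or> C \<subseteq> P - A \<or> C \<subseteq> - P" | "C \<noteq> A" "P \<subseteq> C"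
    using Cons.prems(3)[of C] by auto
  then show ?case
  proof cases
    case 1
    then have s0: "?s = 0" using Cons.prems(1) by simp
    have "ssum A ?\<sigma> = Q *v ssum A \<rho>"
      using Q(2,3) s0 ssum_split[OF BAP(1)] by (simp add: matrix_vector_right_distrib)
    then have ax: "sgn (ssum A ?\<sigma>) = Q *v ?a" by (simp add: rotation_matrix_sgn[OF Q(1)])
    have "(P - A) \<inter> A = {}" by auto
    then show ?thesis
      using Q s0 ssum_bend_subset[OF BAP(1), of "\<tau> A" ?\<sigma>]
        ssum_bend_subset[of "A - B" A "\<tau> A" ?\<sigma>] ssum_bend_disjoint[of "P - A" A "\<tau> A" ?\<sigma>]
      by (intro exI[of _ Q]) (simp add: 1 ax rot_conjugate)
  next
    case 2
    have keep: "ssum X (bend C (\<tau> C) ?\<sigma>) = ssum X ?\<sigma>" if "C \<subseteq> X \<or> X \<inter> C = {}" for X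
      using that ssum_bend_superset[of C X] ssum_bend_disjoint[of X C] by blast
    have "C \<subseteq> B \<or> B \<inter> C = {}" "C \<subseteq> A - B \<or> (A - B) \<inter> C = {}"
      "C \<subseteq> P - A \<or> (P - A) \<inter> C = {}"
      using 2(2) BAP by auto
    then show ?thesis using Q 2(1) by (intro exI[of _ Q]) (simp add: keep)
  next
    case 3
    let ?R = "matrix (rot (sgn (ssum C ?\<sigma>)) (\<tau> C))"
    have sub: "B \<subseteq> C" "A - B \<subseteq> C" "P - A \<subseteq> C" using 3(2) BAP by auto
    have "rotation_matrix (?R ** Q)"
      by (rule rotation_matrix_mul[OF rotation_matrix_rot[OF C] Q(1)])
    moreover have "(?R ** Q) *v x = rot (sgn (ssum C ?\<sigma>)) (\<tau> C) (Q *v x)" for x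
      by (simp add: rot_matrix flip: matrix_vector_mul_assoc)
    ultimately show ?thesis
      using Q 3(1) sub by (intro exI[of _ "?R ** Q"]) (simp add: ssum_bend_subset)
  qed
qed

text \<open>
  Take a polygon in which the sums over the first three parts are independent.  Up to a global
  rotation, the bendings turn the first two parts about their sum by \<open>\<tau> A\<close> and leave the third
  one.  If this is a global rotation, then it fixes the sum over the third part, which is not on
  the axis.
\<close>

lemma bends_trivial_imp_full_turns:
  fixes len :: "'e::finite \<Rightarrow> real"
  assumes len: "\<And>e. len e > 0" "generic len" "polt len \<noteq> {}"
    and As: "distinct As" "\<And>C. C \<in> set As \<Longrightarrow> nonvanishing len C" and A: "A \<in> set As"
    and BAP: "B \<subset> A" "A \<subset> P" "B \<noteq> {}" "P \<noteq> UNIV"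
    and pos: "\<And>C. C \<in> set As \<Longrightarrow> C \<noteq> A \<Longrightarrow> C \<subseteq> B \<or> C \<subseteq> A - B \<or> C \<subseteq> P - A \<or> C \<subseteq> - P \<or> P \<subseteq> C"
    and triv: "\<And>\<rho>. \<rho> \<in> polt len \<Longrightarrow> cls len (bends As \<tau> \<rho>) = cls len \<rho>"
  shows "\<exists>n::int. \<tau> A = 2 * pi * of_int n"
proof -
  have "four_parts B (A - B) (P - A) (- P)" using BAP by (auto simp: four_parts_def)
  then obtain \<rho> where \<rho>: "\<rho> \<in> polt len" "triple B (A - B) (P - A) \<rho> \<noteq> 0"
    using polt_general_position[OF len] by blast
  define x y z where xyz: "x = ssum B \<rho>" "y = ssum (A - B) \<rho>" "z = ssum (P - A) \<rho>"
  have A_eq: "ssum A \<rho> = x + y" using ssum_split[of B A \<rho>] BAP by (auto simp: xyz)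
  define a where "a = sgn (x + y)"
  have a: "norm a = 1" using norm_sgn_ssum[OF As(2)[OF A] \<rho>(1)] by (simp add: a_def A_eq)
  have nz: "x \<bullet> (y \<times> z) \<noteq> 0" using \<rho>(2) by (simp add: triple_def xyz)
  obtain Q where Q: "rotation_matrix Q" "ssum B (bends As \<tau> \<rho>) = Q *v rot a (\<tau> A) x"
    "ssum (A - B) (bends As \<tau> \<rho>) = Q *v rot a (\<tau> A) y" "ssum (P - A) (bends As \<tau> \<rho>) = Q *v z"
    using bends_four_parts[OF \<rho>(1) As(1,2) _ _ pos, where \<tau> = \<tau>] BAP A
    by (auto simp: A_eq xyz a_def) 
  obtain R where R: "rotation_matrix R" "bends As \<tau> \<rho> = rot_act R \<rho>"
    using triv[OF \<rho>(1)] cls_eq_iff[OF \<rho>(1) bends_polt[OF \<rho>(1) As(2)]] by metis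
  define S where "S = transpose Q ** R"
  have S: "rotation_matrix S"
    unfolding S_def by (rule rotation_matrix_mul[OF rotation_matrix_transpose[OF Q(1)] R(1)])
  have S_eq: "S *v v = w" if "R *v v = Q *v w" for v w
    using that transpose_rotation_cancel(1)[OF Q(1)]
    by (simp add: S_def del: transpose_matrix_vector flip: matrix_vector_mul_assoc)
  have Sx: "S *v x = rot a (\<tau> A) x" and Sy: "S *v y = rot a (\<tau> A) y" and Sz: "S *v z = z"
    using Q R(2) by (auto intro!: S_eq simp: ssum_rot_act simp flip: xyz)
  \<comment> \<open>\<open>S\<close> agrees with the rotation on the frame of \<open>x\<close> and \<open>y\<close>, so the rotation fixes \<open>z\<close>.\<close>
  have frame: "rot a (\<tau> A) v \<bullet> (z - rot a (\<tau> A) z) = 0" if "S *v v = rot a (\<tau> A) v" for v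
  proof -
    have "rot a (\<tau> A) v \<bullet> z = v \<bullet> z"
      using rotation_matrix_inner[OF S, of v z] that Sz by simp
    then show ?thesis by (simp add: inner_diff_right rot_inner[OF a])
  qed
  have Sxy: "S *v (x \<times> y) = rot a (\<tau> A) (x \<times> y)"
    using cross_rotation_matrix[OF S, of x y] by (simp add: Sx Sy rot_cross[OF a])
  have "x \<times> y \<noteq> 0"
    using nz triple_rotate[of z x y] triple_rotate[of x y z] by auto
  then have xy: "rot a (\<tau> A) (x \<times> y) \<noteq> 0"
    using norm_rot[OF a, of "\<tau> A" "x \<times> y"] by auto
  have "z - rot a (\<tau> A) z = 0"
  proof (rule orthogonal_to_frame_eq_0)
    show "rot a (\<tau> A) x \<times> rot a (\<tau> A) y \<noteq> 0" using xy by (simp add: rot_cross[OF a])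
    show "(z - rot a (\<tau> A) z) \<bullet> rot a (\<tau> A) x = 0" "(z - rot a (\<tau> A) z) \<bullet> rot a (\<tau> A) y = 0"
      "(z - rot a (\<tau> A) z) \<bullet> (rot a (\<tau> A) x \<times> rot a (\<tau> A) y) = 0"
      using frame[OF Sx] frame[OF Sy] frame[OF Sxy]
      by (simp_all add: inner_commute rot_cross[OF a, symmetric])
  qed
  then have "rot a (\<tau> A) z = z" by simp
  moreover have "a \<times> z \<noteq> 0"
  proof
    assume "a \<times> z = 0"
    moreover have "norm (x + y) *\<^sub>R sgn (x + y) = x + y"
      by (cases "x + y = 0") (simp_all add: sgn_div_norm)
    ultimately have "(x + y) \<times> z = 0" unfolding a_def by (metis cross_mult_left scaleR_zero_right)
    then have "x \<bullet> (x \<times> z + y \<times> z) = 0" by (simp add: cross_add_left)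
    then show False using nz by (simp add: inner_add_right dot_cross_self)
  qed
  ultimately show ?thesis using rot_fixed_imp_full_turns[OF a] by blast
qed


section \<open>The torus of a nested family\<close>

lemma bends_Cons: "bends (A # As) \<tau> = (\<lambda>\<rho>. bend A (\<tau> A) (bends As \<tau> \<rho>))"
  by (rule ext) simp

lemma symplectic_lift_bends:
  fixes len :: "'e::finite \<Rightarrow> real"
  assumes "\<And>e. len e > 0" "\<And>A. A \<in> set As \<Longrightarrow> nonvanishing len A"
  shows "symplectic_lift len (bends As \<tau>)"
  using assms(2)
proof (induction As)
  case Nil
  have "bends [] \<tau> = (\<lambda>\<rho>. \<rho>)" by (rule ext) simp
  then show ?case by (simp add: symplectic_lift_id)
next
  case (Cons A As)
  then have A: "nonvanishing len A" and IH: "symplectic_lift len (bends As \<tau>)" by auto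
  show ?case
    unfolding bends_Cons by (rule symplectic_lift_compose[OF symplectic_lift_bend[OF assms(1) A] IH])
qed

lemma norm_ssum_bends:
  assumes "\<rho> \<in> polt len" "\<And>B. B \<in> set As \<Longrightarrow> nonvanishing len B \<and> nested A B"
  shows "norm (ssum A (bends As \<tau> \<rho>)) = norm (ssum A \<rho>)"
  using assms(2)
proof (induction As)
  case (Cons B As)
  let ?\<sigma> = "bends As \<tau> \<rho>"
  have \<sigma>: "?\<sigma> \<in> polt len" using Cons.prems by (intro bends_polt[OF assms(1)]) auto
  have "nonvanishing len B" "nested A B" using Cons.prems by auto
  then have B: "norm (sgn (ssum B ?\<sigma>)) = 1" using norm_sgn_ssum \<sigma> by blast
  note \<open>nested A B\<close>
  then have "norm (ssum A (bend B (\<tau> B) ?\<sigma>)) = norm (ssum A ?\<sigma>)"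
    unfolding nested_def
    by (elim disjE) (simp_all add: ssum_bend_disjoint ssum_bend_superset ssum_bend_subset norm_rot[OF B])
  then show ?case using Cons by simp
qed simp

lemma bends_only:
  "distinct As \<Longrightarrow> A \<in> set As \<Longrightarrow> (\<And>B. B \<in> set As \<Longrightarrow> B \<noteq> A \<Longrightarrow> \<tau> B = 0) \<Longrightarrow>
    bends As \<tau> \<rho> = bend A (\<tau> A) \<rho>"
proof (induction As)
  case (Cons B As)
  show ?case
  proof (cases "B = A")
    case True
    then have "bends As \<tau> \<rho> = \<rho>" using Cons.prems by (intro bends_zero) auto
    then show ?thesis using True by simp
  qed (use Cons in auto)
qed simp

text \<open>
  Sets with fewer than two elements inside or outside have trivial flows, and a set has the same
  flow as its complement.  Avoiding a base point selects one of the two and turns families without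
  crossings into nested ones.
\<close>

definition nested_system :: "'e::finite \<Rightarrow> 'e set set \<Rightarrow> bool" where
  "nested_system e0 K \<longleftrightarrow> (\<forall>A\<in>K. e0 \<notin> A \<and> card A \<ge> 2 \<and> card (- A) \<ge> 2) \<and>
     (\<forall>A\<in>K. \<forall>B\<in>K. nested A B)"

text \<open>
  To isolate the effect of bending along \<open>A\<close>, the edge set is divided into four parts by \<open>A\<close> and
  its neighbours in the family: a maximal member below it, or a point, and a minimal member above
  it, or the complement of the base point.
\<close>

lemma nested_system_neighbours:
  fixes K :: "'e::finite set set"
  assumes K: "nested_system e0 K" and A: "A \<in> K"
  shows "\<exists>B P. B \<subset> A \<and> A \<subset> P \<and> B \<noteq> {} \<and> P \<noteq> UNIV \<and>
    (\<forall>C\<in>K. C \<noteq> A \<longrightarrow> C \<subseteq> B \<or> C \<subseteq> A - B \<or> C \<subseteq> P - A \<or> C \<subseteq> - P \<or> P \<subseteq> C)"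
proof -
  have cA: "e0 \<notin> A" "card A \<ge> 2" "card (- A) \<ge> 2" and ne: "\<And>C. C \<in> K \<Longrightarrow> C \<noteq> {}"
    using K A by (auto simp: nested_system_def)
  have nest: "nested C D" if "C \<in> K" "D \<in> K" for C D
    using K that by (auto simp: nested_system_def)
  have "\<exists>B. B \<subset> A \<and> B \<noteq> {} \<and> (\<forall>C\<in>K. C \<subset> A \<longrightarrow> C \<subseteq> B \<or> C \<subseteq> A - B)"
  proof (cases "{C\<in>K. C \<subset> A} = {}")
    case True
    obtain e where "e \<in> A" using cA by fastforce
    moreover have "A \<noteq> {e}" using cA by auto
    ultimately show ?thesis using True by (intro exI[of _ "{e}"]) auto
  next
    case False
    then obtain B where B: "B \<in> {C\<in>K. C \<subset> A}" "\<And>C. C \<in> {C\<in>K. C \<subset> A} \<Longrightarrow> \<not> B \<subset> C"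
      using finite_has_maximal[of "{C\<in>K. C \<subset> A}"] by (auto simp: psubset_eq)
    have "C \<subseteq> B \<or> C \<subseteq> A - B" if "C \<in> K" "C \<subset> A" for C
      using that B(2)[of C] nest[of C B] B(1) by (auto simp: nested_def)
    moreover have "B \<subset> A" "B \<noteq> {}" using B(1) ne by auto
    ultimately show ?thesis by metis
  qed
  then obtain B where B: "B \<subset> A" "B \<noteq> {}" "\<forall>C\<in>K. C \<subset> A \<longrightarrow> C \<subseteq> B \<or> C \<subseteq> A - B"
    by (elim exE conjE) (rule that)
  let ?K' = "{C\<in>insert (- {e0}) K. A \<subset> C}"
  have "A \<subset> - {e0}" using cA by auto
  then have "?K' \<noteq> {}" by blast
  then have "\<exists>P\<in>?K'. \<forall>C\<in>?K'. C \<le> P \<longrightarrow> P = C" by (intro finite_has_minimal) simp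
  then obtain P where P: "P \<in> ?K'" "\<forall>C\<in>?K'. C \<le> P \<longrightarrow> P = C" by (elim bexE) (rule that)
  have Pmin: "\<not> C \<subset> P" if "C \<in> ?K'" for C using bspec[OF P(2) that] by auto
  have Pnest: "nested C P" if "C \<in> K" for C
  proof -
    have "P = - {e0} \<or> P \<in> K" using P(1) by auto
    moreover have "C \<subseteq> - {e0}" using that K by (auto simp: nested_system_def)
    ultimately show ?thesis using nest[OF that] by (metis nested_def)
  qed
  have "e0 \<notin> P" using P(1) K by (auto simp: nested_system_def)
  have "C \<subseteq> B \<or> C \<subseteq> A - B \<or> C \<subseteq> P - A \<or> C \<subseteq> - P \<or> P \<subseteq> C" if C: "C \<in> K" "C \<noteq> A" for C
  proof -
    consider "C \<subset> A" | "A \<subset> C" | "C \<inter> A = {}"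
      using nest[OF C(1) A] C(2) by (auto simp: nested_def)
    then show ?thesis
    proof cases
      case 1
      then show ?thesis using bspec[OF B(3) C(1)] by blast
    next
      case 2
      then have "\<not> C \<subset> P" using Pmin[of C] C(1) by simp
      moreover have "C \<inter> P \<noteq> {}" using 2 P(1) ne[OF A] by blast
      ultimately show ?thesis using Pnest[OF C(1)] by (auto simp: nested_def)
    next
      case 3
      moreover have "\<not> P \<subseteq> C" using 3 P(1) ne[OF A] by blast
      ultimately show ?thesis using Pnest[OF C(1)] by (auto simp: nested_def)
    qed
  qed
  moreover have "A \<subset> P" "P \<noteq> UNIV" using P(1) \<open>e0 \<notin> P\<close> by auto
  ultimately show ?thesis
    using B(1,2) by - (rule exI[of _ B], rule exI[of _ P], intro conjI ballI impI, simp_all)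
qed

lemma bending_flow_in_generated:
  "A \<in> J \<Longrightarrow> bending_flow len A t \<in> generated_by_bendings len J"
  unfolding generated_by_bendings_def by (rule generate.incl) auto

lemma bending_flow_carrier:
  fixes len :: "'e::finite \<Rightarrow> real"
  assumes "\<And>e. len e > 0" "generic len" "nonvanishing len A"
  shows "bending_flow len A t \<in> carrier (BijGroup (Pol len))"
  by (simp add: bending_flow_eq[OF assms] induced_bend_Bij[OF assms(3)])

lemma subgroup_generated_by_bendings:
  fixes len :: "'e::finite \<Rightarrow> real"
  assumes "\<And>e. len e > 0" "generic len" "\<And>A. A \<in> J \<Longrightarrow> nonvanishing len A"
  shows "subgroup (generated_by_bendings len J) (BijGroup (Pol len))"
  unfolding generated_by_bendings_def
  using bending_flow_carrier[OF assms(1,2)] assms(3)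
  by (intro group.generate_is_subgroup[OF group_BijGroup]) blast

lemma generated_by_bendings_least:
  assumes "subgroup H (BijGroup (Pol len))" "\<And>A t. A \<in> J \<Longrightarrow> bending_flow len A t \<in> H"
  shows "generated_by_bendings len J \<subseteq> H"
  unfolding generated_by_bendings_def
  using assms by (intro group.generate_subgroup_incl[OF group_BijGroup]) auto

lemma bends_in_generated:
  fixes len :: "'e::finite \<Rightarrow> real"
  assumes len: "\<And>e. len e > 0" "generic len" and J: "\<And>A. A \<in> J \<Longrightarrow> nonvanishing len A"
    and nest: "\<And>A B. A \<in> set As \<Longrightarrow> B \<in> set As \<Longrightarrow> nested A B" and "set As \<subseteq> J"
  shows "induced_map len (bends As \<tau>) \<in> generated_by_bendings len J"
  using nest \<open>set As \<subseteq> J\<close>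
proof (induction As)
  case Nil
  have "bends [] \<tau> = (\<lambda>\<rho>. \<rho>)" by (rule ext) simp
  then show ?case by (simp add: induced_map_id generated_by_bendings_def generate.one)
next
  case (Cons A As)
  have A: "A \<in> J" "nonvanishing len A" using Cons.prems J by auto
  have IH: "induced_map len (bends As \<tau>) \<in> generated_by_bendings len J" using Cons by auto
  have "induced_map len (bends (A # As) \<tau>)
      = bending_flow len A (\<tau> A) \<otimes>\<^bsub>BijGroup (Pol len)\<^esub> induced_map len (bends As \<tau>)"
    using Cons.prems J A unfolding bends_Cons
    by (subst bending_flow_eq[OF len A(2)], subst induced_map_mult)
      (auto intro!: equivariant_bend equivariant_bends induced_bend_Bij induced_bends_Bij)
  then show ?case
    using IH bending_flow_in_generated[OF A(1)] unfolding generated_by_bendings_def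
    by (metis generate.eng)
qed

lemma smooth_on_scaled_bending_hamiltonian:
  "smooth_on {\<rho>. ssum A \<rho> \<noteq> 0} (\<lambda>\<rho>. c * bending_hamiltonian A \<rho>)"
  unfolding smooth_on_def bending_hamiltonian_def
  by (intro allI Ck_linear_compose[OF open_ssum_nonzero bounded_linear_mult_right]
      Ck_norm[OF open_ssum_nonzero bounded_linear_ssum]) simp

text \<open>
  The torus is parametrized by the turns of the individual bendings, each of period \<open>2\<pi>\<close>; the
  moment map consists of the lengths \<open>|\<rho>\<^sub>A|\<close>, rescaled to period \<open>1\<close>.  Effectiveness comes from
  \<open>bends_trivial_imp_full_turns\<close>.
\<close>

theorem hamiltonian_torus_nested:
  fixes len :: "'e::finite \<Rightarrow> real"
  assumes len: "\<And>e. len e > 0" "generic len" "polt len \<noteq> {}"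
    and K: "nested_system e0 K" "\<And>A. A \<in> K \<Longrightarrow> nonvanishing len A"
  shows "hamiltonian_torus len (card K) (generated_by_bendings len K)"
proof -
  interpret G: group "BijGroup (Pol len)" by (rule group_BijGroup)
  let ?G = "BijGroup (Pol len)"
  have nest: "\<And>A B. A \<in> K \<Longrightarrow> B \<in> K \<Longrightarrow> nested A B" using K(1) by (auto simp: nested_system_def)
  \<comment> \<open>Enumerate the family with larger sets first, as needed for the trajectories.\<close>
  obtain ys where ys: "set ys = K" "distinct ys" using finite_distinct_list[of K] by auto
  define xs where "xs = rev (sort_key card ys)"
  have xs: "set xs = K" "distinct xs" using ys by (simp_all add: xs_def)
  have "sorted_wrt (\<lambda>A B. card A \<le> card B) (sort_key card ys)"
    using sorted_sort_key[of card ys] by (simp add: sorted_map)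
  then have "sorted_wrt (\<lambda>A B. card B \<le> card A) xs" by (simp add: xs_def sorted_wrt_rev)
  then have sorted: "sorted_wrt (\<lambda>A B. \<not> A \<subset> B) xs"
    by (rule sorted_wrt_mono_rel[rotated]) (meson finite leD psubset_card_mono)
  define k where "k = card K"
  have k: "k = length xs" using xs by (simp add: k_def distinct_card[symmetric])
  define idx where "idx A = (THE i. i < k \<and> xs ! i = A)" for A
  have idx_nth: "idx (xs ! i) = i" if "i < k" for i
    unfolding idx_def using that xs(2) k by (intro the_equality) (auto simp: nth_eq_iff_index_eq)
  have idx: "idx A < k" "xs ! idx A = A" if "A \<in> K" for A
    using that idx_nth xs(1) k by (auto simp: in_set_conv_nth)
  define \<tau> where "\<tau> \<xi> A = 2 * pi * \<xi> (idx A)" for \<xi> :: "nat \<Rightarrow> real" and A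
  define \<theta> where "\<theta> \<xi> = induced_map len (bends xs (\<tau> \<xi>))" for \<xi>
  define \<mu> where "\<mu> i \<rho> = 2 * pi * bending_hamiltonian (xs ! i) \<rho>" for i and \<rho> :: "'e config"
  have nv: "nonvanishing len A" if "A \<in> set xs" for A using that xs K(2) by simp
  have nestx: "nested A B" if "A \<in> set xs" "B \<in> set xs" for A B using that xs nest by simp
  have eqv: "equivariant len (bends xs \<tau>')" for \<tau>' by (rule equivariant_bends[OF nv])
  have bij: "\<theta> \<xi> \<in> carrier ?G" for \<xi> unfolding \<theta>_def by (rule induced_bends_Bij[OF nv nestx])
  have cls: "\<theta> \<xi> (cls len \<rho>) = cls len (bends xs (\<tau> \<xi>) \<rho>)" if "\<rho> \<in> polt len" for \<xi> \<rho>
    by (simp add: \<theta>_def induced_map_cls[OF eqv that])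
  have add: "\<theta> (\<lambda>i. \<xi> i + \<eta> i) = \<theta> \<xi> \<otimes>\<^bsub>?G\<^esub> \<theta> \<eta>" for \<xi> \<eta>
  proof -
    have t: "\<tau> (\<lambda>i. \<xi> i + \<eta> i) = (\<lambda>A. \<tau> \<xi> A + \<tau> \<eta> A)" by (auto simp: \<tau>_def algebra_simps)
    have "\<theta> \<xi> \<otimes>\<^bsub>?G\<^esub> \<theta> \<eta> = induced_map len (\<lambda>\<rho>. bends xs (\<tau> \<xi>) (bends xs (\<tau> \<eta>) \<rho>))"
      using bij[of \<xi>] bij[of \<eta>] unfolding \<theta>_def by (intro induced_map_mult eqv)
    also have "\<dots> = \<theta> (\<lambda>i. \<xi> i + \<eta> i)"
      unfolding \<theta>_def t
      by (rule induced_map_cong[OF eqv _ equivariant_compose[OF eqv eqv]])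
        (simp add: bends_add_angle[OF _ nv nestx])
    finally show ?thesis by simp
  qed
  have int: "bends xs (\<tau> \<xi>) \<rho> = \<rho>" if "\<And>i. i < k \<Longrightarrow> \<xi> i \<in> \<int>" for \<xi> \<rho>
  proof -
    have "bend A (\<tau> \<xi> A) \<sigma> = \<sigma>" if "A \<in> K" for A \<sigma>
      using \<open>\<And>i. i < k \<Longrightarrow> \<xi> i \<in> \<int>\<close>[OF idx(1)[OF that]]
      by (auto simp: \<tau>_def elim!: Ints_cases intro: bend_full_turns)
    then have "set zs \<subseteq> K \<Longrightarrow> bends zs (\<tau> \<xi>) \<rho> = \<rho>" for zs by (induction zs) auto
    then show ?thesis using xs by auto
  qed
  have one: "\<theta> \<xi> = \<one>\<^bsub>?G\<^esub> \<longleftrightarrow> (\<forall>i<k. \<xi> i \<in> \<int>)" for \<xi>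
  proof
    assume "\<forall>i<k. \<xi> i \<in> \<int>"
    then have "bends xs (\<tau> \<xi>) = (\<lambda>\<rho>. \<rho>)" using int by blast
    then show "\<theta> \<xi> = \<one>\<^bsub>?G\<^esub>" by (simp add: \<theta>_def induced_map_id)
  next
    assume 1: "\<theta> \<xi> = \<one>\<^bsub>?G\<^esub>"
    have triv: "cls len (bends xs (\<tau> \<xi>) \<rho>) = cls len \<rho>" if "\<rho> \<in> polt len" for \<rho>
      using cls[OF that, of \<xi>] that by (simp add: 1 BijGroup_def cls_in_Pol)
    show "\<forall>i<k. \<xi> i \<in> \<int>"
    proof (intro allI impI)
      fix i assume i: "i < k"
      then have A: "xs ! i \<in> K" using xs k by auto
      obtain B P where BP: "B \<subset> xs ! i" "xs ! i \<subset> P" "B \<noteq> {}" "P \<noteq> UNIV"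
        "\<forall>C\<in>K. C \<noteq> xs ! i \<longrightarrow> C \<subseteq> B \<or> C \<subseteq> xs ! i - B \<or> C \<subseteq> P - xs ! i \<or> C \<subseteq> - P \<or> P \<subseteq> C"
        using nested_system_neighbours[OF K(1) A] by blast
      have "\<exists>n::int. \<tau> \<xi> (xs ! i) = 2 * pi * of_int n"
        using BP(5) xs A
        by (intro bends_trivial_imp_full_turns[OF len xs(2) nv _ BP(1-4) _ triv]) auto
      then show "\<xi> i \<in> \<int>" by (auto simp: \<tau>_def idx_nth[OF i])
    qed
  qed
  have inv: "inv\<^bsub>?G\<^esub> \<theta> \<xi> = \<theta> (\<lambda>i. - \<xi> i)" for \<xi>
  proof (rule G.inv_equality[OF _ bij bij])
    have "\<theta> (\<lambda>i. - \<xi> i) \<otimes>\<^bsub>?G\<^esub> \<theta> \<xi> = \<theta> (\<lambda>i. 0)" by (simp flip: add)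
    then show "\<theta> (\<lambda>i. - \<xi> i) \<otimes>\<^bsub>?G\<^esub> \<theta> \<xi> = \<one>\<^bsub>?G\<^esub>" using one[of "\<lambda>i. 0"] by simp
  qed
  have symp: "symplectic_map len (\<theta> \<xi>)" for \<xi>
    unfolding \<theta>_def
    by (intro symplectic_lift_symplectic_map symplectic_lift_bends eqv len(1) nv)
  have sub: "range \<theta> \<subseteq> symplectomorphisms len"
    using bij symp by (auto simp: symplectomorphisms_def inv)
  have range: "range \<theta> = generated_by_bendings len K"
  proof
    show "range \<theta> \<subseteq> generated_by_bendings len K"
      unfolding \<theta>_def using bends_in_generated[OF len(1,2) K(2) nestx, of K xs] xs by auto
    have "subgroup (range \<theta>) ?G"
    proof
      show "range \<theta> \<subseteq> carrier ?G" using bij by auto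
      show "\<one>\<^bsub>?G\<^esub> \<in> range \<theta>" using one[of "\<lambda>i. 0"] by (metis Ints_0 rangeI)
      show "x \<otimes>\<^bsub>?G\<^esub> y \<in> range \<theta>" if "x \<in> range \<theta>" "y \<in> range \<theta>" for x y
        using that by (auto simp flip: add)
      show "inv\<^bsub>?G\<^esub> x \<in> range \<theta>" if "x \<in> range \<theta>" for x using that by (auto simp: inv)
    qed
    then show "generated_by_bendings len K \<subseteq> range \<theta>"
    proof (rule generated_by_bendings_least)
      fix A t assume A: "A \<in> K"
      let ?\<xi> = "\<lambda>i. if i = idx A then t / (2 * pi) else 0"
      have "idx B \<noteq> idx A" if "B \<in> K" "B \<noteq> A" for B using idx(2) that A by metis
      then have "bends xs (\<tau> ?\<xi>) = bend A t"
        using A xs by (intro ext, subst bends_only[of xs A]) (auto simp: \<tau>_def)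
      then have "bending_flow len A t = \<theta> ?\<xi>"
        by (simp add: \<theta>_def bending_flow_eq[OF len(1,2) K(2)[OF A]])
      then show "bending_flow len A t \<in> range \<theta>" by simp
    qed
  qed
  have smooth: "smooth_fun_Pol len (\<mu> i)" if "i < k" for i
  proof -
    have "nonvanishing len (xs ! i)" using that k nv by simp
    then show ?thesis
      unfolding smooth_fun_Pol_def \<mu>_def
      using smooth_on_scaled_bending_hamiltonian[of "xs ! i" "2 * pi"] open_ssum_nonzero[of "xs ! i"]
      by (intro conjI exI[of _ "{\<rho>. ssum (xs ! i) \<rho> \<noteq> 0}"])
        (auto simp: nonvanishing_def bending_hamiltonian_def ssum_rot_act rotation_matrix_norm)
  qed
  have \<mu>_inv: "\<mu> i \<sigma> = \<mu> i \<rho>"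
    if h: "i < k" "\<rho> \<in> polt len" "\<sigma> \<in> polt len" "cls len \<sigma> = \<theta> \<xi> (cls len \<rho>)" for i \<xi> \<rho> \<sigma>
  proof -
    have "bends xs (\<tau> \<xi>) \<rho> \<in> polt len" by (rule bends_polt[OF h(2) nv])
    then obtain R where "rotation_matrix R" "bends xs (\<tau> \<xi>) \<rho> = rot_act R \<sigma>"
      using h(3,4) cls[OF h(2)] cls_eq_iff by metis
    moreover have "norm (ssum (xs ! i) (bends xs (\<tau> \<xi>) \<rho>)) = norm (ssum (xs ! i) \<rho>)"
      using nv nestx h(1) k by (intro norm_ssum_bends[OF h(2)]) auto
    ultimately show ?thesis
      by (simp add: \<mu>_def bending_hamiltonian_def ssum_rot_act rotation_matrix_norm)
  qed
  have flow: "hamiltonian_flow len (\<lambda>\<rho>. \<Sum>i<k. \<xi> i * \<mu> i \<rho>) (\<lambda>t. \<theta> (\<lambda>i. t * \<xi> i))" for \<xi>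
  proof -
    have t: "\<tau> (\<lambda>i. t * \<xi> i) = (\<lambda>A. t * \<tau> \<xi> A)" for t by (auto simp: \<tau>_def)
    have "(\<Sum>i<k. \<xi> i * \<mu> i \<rho>) = (\<Sum>A\<in>set xs. \<tau> \<xi> A * bending_hamiltonian A \<rho>)" for \<rho>
    proof (rule sum.reindex_bij_witness[of _ idx "\<lambda>i. xs ! i"])
      show "idx A \<in> {..<k}" if "A \<in> set xs" for A using that idx(1) xs by simp
    qed (use idx_nth idx xs k in \<open>auto simp: \<mu>_def \<tau>_def\<close>)
    from hamiltonian_flow_bends[OF len(1) nv xs(2) nestx sorted this]
    show ?thesis by (simp add: \<theta>_def t)
  qed
  show ?thesis
    unfolding hamiltonian_torus_def k_def[symmetric]
    using sub range add one smooth \<mu>_inv flow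
    by (intro conjI exI[of _ \<theta>] exI[of _ \<mu>]) auto
qed

text \<open>
  The dimension of a torus is determined by the abstract group, since a \<open>k\<close>-dimensional torus has
  \<open>2\<^sup>k\<close> elements of order at most two.
\<close>

lemma hamiltonian_torus_involutions:
  assumes "hamiltonian_torus len k T"
  shows "card {g \<in> T. g \<otimes>\<^bsub>BijGroup (Pol len)\<^esub> g = \<one>\<^bsub>BijGroup (Pol len)\<^esub>} = 2 ^ k"
proof -
  interpret G: group "BijGroup (Pol len)" by (rule group_BijGroup)
  let ?G = "BijGroup (Pol len)"
  have "\<exists>\<theta> :: (nat \<Rightarrow> real) \<Rightarrow> 'a config set \<Rightarrow> 'a config set. range \<theta> = T \<and> (\<forall>\<xi> \<eta>. \<theta> (\<lambda>i. \<xi> i + \<eta> i) = \<theta> \<xi> \<otimes>\<^bsub>?G\<^esub> \<theta> \<eta>) \<and>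
      (\<forall>\<xi>. \<theta> \<xi> = \<one>\<^bsub>?G\<^esub> \<longleftrightarrow> (\<forall>i<k. \<xi> i \<in> \<int>))"
    using assms unfolding hamiltonian_torus_def
    by (elim conjE exE) (intro exI conjI; assumption)
  then obtain \<theta> :: "(nat \<Rightarrow> real) \<Rightarrow> 'a config set \<Rightarrow> 'a config set" where \<theta>: "range \<theta> = T"
    "\<And>\<xi> \<eta>. \<theta> (\<lambda>i. \<xi> i + \<eta> i) = \<theta> \<xi> \<otimes>\<^bsub>?G\<^esub> \<theta> \<eta>"
    "\<And>\<xi>. \<theta> \<xi> = \<one>\<^bsub>?G\<^esub> \<longleftrightarrow> (\<forall>i<k. \<xi> i \<in> \<int>)" by blast
  have "T \<subseteq> carrier ?G"
    using assms by (auto simp: hamiltonian_torus_def symplectomorphisms_def)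
  then have carr: "\<theta> \<xi> \<in> carrier ?G" for \<xi> using \<theta>(1) by auto
  have eq_iff: "\<theta> \<xi> = \<theta> \<eta> \<longleftrightarrow> (\<forall>i<k. \<xi> i - \<eta> i \<in> \<int>)" for \<xi> \<eta>
  proof -
    have "\<theta> \<xi> = \<theta> (\<lambda>i. \<xi> i - \<eta> i) \<otimes>\<^bsub>?G\<^esub> \<theta> \<eta>" by (simp flip: \<theta>(2))
    then have "\<theta> \<xi> = \<theta> \<eta> \<longleftrightarrow> \<theta> (\<lambda>i. \<xi> i - \<eta> i) = \<one>\<^bsub>?G\<^esub>"
      by (simp only: G.r_cancel_one[OF carr carr])
    then show ?thesis by (simp only: \<theta>(3))
  qed
  let ?h = "\<lambda>S i. if i \<in> S then 1/2 else (0::real)"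
  have half: "(1/2 :: real) \<notin> \<int>" "(- 1/2 :: real) \<notin> \<int>"
    by (auto elim!: Ints_cases simp: field_simps)
  have "bij_betw (\<lambda>S. \<theta> (?h S)) (Pow {..<k}) {g \<in> T. g \<otimes>\<^bsub>?G\<^esub> g = \<one>\<^bsub>?G\<^esub>}"
    unfolding bij_betw_def
  proof
    show "inj_on (\<lambda>S. \<theta> (?h S)) (Pow {..<k})"
    proof (rule inj_onI)
      fix S S' assume S: "S \<in> Pow {..<k}" "S' \<in> Pow {..<k}" "\<theta> (?h S) = \<theta> (?h S')"
      then have d: "?h S i - ?h S' i \<in> \<int>" if "i < k" for i using that by (simp only: eq_iff)
      then have "i \<in> S \<longleftrightarrow> i \<in> S'" if "i < k" for i
        using d[OF that] half by (auto split: if_splits)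
      then show "S = S'" using S(1,2) by auto
    qed
    show "(\<lambda>S. \<theta> (?h S)) ` Pow {..<k} = {g \<in> T. g \<otimes>\<^bsub>?G\<^esub> g = \<one>\<^bsub>?G\<^esub>}"
    proof (intro equalityI subsetI)
      fix g assume "g \<in> (\<lambda>S. \<theta> (?h S)) ` Pow {..<k}"
      then obtain S where S: "g = \<theta> (?h S)" by auto
      have "\<theta> (?h S) \<otimes>\<^bsub>?G\<^esub> \<theta> (?h S) = \<one>\<^bsub>?G\<^esub>" unfolding \<theta>(2)[symmetric] \<theta>(3) by auto
      moreover have "\<theta> (?h S) \<in> T" unfolding \<theta>(1)[symmetric] by (rule rangeI)
      ultimately show "g \<in> {g \<in> T. g \<otimes>\<^bsub>?G\<^esub> g = \<one>\<^bsub>?G\<^esub>}" by (simp add: S)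
    next
      fix g assume g: "g \<in> {g \<in> T. g \<otimes>\<^bsub>?G\<^esub> g = \<one>\<^bsub>?G\<^esub>}"
      then obtain \<xi> where \<xi>: "g = \<theta> \<xi>" using \<theta>(1) by auto
      then have int: "\<xi> i + \<xi> i \<in> \<int>" if "i < k" for i
        using g \<theta>(2)[of \<xi> \<xi>] \<theta>(3)[of "\<lambda>i. \<xi> i + \<xi> i"] that by auto
      define S where "S = {i. i < k \<and> \<xi> i \<notin> \<int>}"
      have "\<xi> i - ?h S i \<in> \<int>" if i: "i < k" for i
      proof (cases "\<xi> i \<in> \<int>")
        case False
        obtain m where m: "\<xi> i + \<xi> i = of_int m" using int[OF i] by (auto elim: Ints_cases)
        have "odd m"
        proof
          assume "even m"
          then obtain n where "m = 2 * n" by blast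
          then have "\<xi> i = of_int n" using m by simp
          then show False using False by simp
        qed
        then obtain n where "m = 2 * n + 1" by (rule oddE)
        then have "\<xi> i - 1/2 = of_int n" using m by simp
        then show ?thesis using False i by (simp add: S_def)
      qed (simp add: S_def)
      then have "g = \<theta> (?h S)" unfolding \<xi> eq_iff by blast
      moreover have "S \<in> Pow {..<k}" by (auto simp: S_def)
      ultimately show "g \<in> (\<lambda>S. \<theta> (?h S)) ` Pow {..<k}" by blast
    qed
  qed
  from bij_betw_same_card[OF this] show ?thesis by (simp add: card_Pow)
qed

lemma hamiltonian_torus_dim_unique:
  "hamiltonian_torus len k T \<Longrightarrow> hamiltonian_torus len k' T \<Longrightarrow> k = k'"
  using hamiltonian_torus_involutions[of len k T] hamiltonian_torus_involutions[of len k' T] by simp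


section \<open>Families of nested sets\<close>

lemma crossing_Compl: "crossing (- A) B \<longleftrightarrow> crossing A B" "crossing A (- B) \<longleftrightarrow> crossing A B"
  by (auto simp: crossing_def)

text \<open>
  By induction on the size of \<open>B\<close>: apart from \<open>B\<close> itself, all members lie inside a maximal proper
  one or outside of it.
\<close>

lemma card_nested_family:
  assumes "finite B" "B \<noteq> {}" "\<And>A. A \<in> F \<Longrightarrow> A \<subseteq> B \<and> card A \<ge> 2"
    and "\<And>A A'. A \<in> F \<Longrightarrow> A' \<in> F \<Longrightarrow> nested A A'"
  shows "card F \<le> card B - 1"
  using assms
proof (induction "card B" arbitrary: B F rule: less_induct)
  case less
  have finF: "finite F"
    using less.prems(1,3) by (intro finite_subset[of F "Pow B"]) auto
  show ?case
  proof (cases "F - {B} = {}")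
    case True
    show ?thesis
    proof (cases "F = {}")
      case False
      then have "F = {B}" using True by auto
      then show ?thesis using less.prems(3)[of B] by auto
    qed simp
  next
    case False

    have "\<exists>M\<in>F - {B}. \<forall>A\<in>F - {B}. M \<le> A \<longrightarrow> M = A"
      using finF False by (intro finite_has_maximal) auto
    then obtain M where M: "M \<in> F - {B}" "\<forall>A\<in>F - {B}. M \<le> A \<longrightarrow> M = A"
      by (elim bexE) (rule that)
    let ?F1 = "{A \<in> F. A \<subseteq> M}" and ?F2 = "{A \<in> F. A \<subseteq> B - M}"
    have MB: "M \<subseteq> B" "M \<noteq> B" "card M \<ge> 2" using M less.prems(3) by auto
    then have lt: "card M < card B" using less.prems(1) by (simp add: psubset_card_mono psubsetI)
    have cov: "F \<subseteq> insert B (?F1 \<union> ?F2)"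
    proof
      fix A assume A: "A \<in> F"
      have "A = B \<or> A \<subseteq> M \<or> A \<inter> M = {}"
      proof (rule ccontr)
        assume c: "\<not> ?thesis"
        then have "M \<subset> A" using less.prems(4)[OF A, of M] M(1) by (auto simp: nested_def)
        then show False using bspec[OF M(2), of A] A c by auto
      qed
      then show "A \<in> insert B (?F1 \<union> ?F2)" using A less.prems(3) by auto
    qed
    have 1: "card ?F1 \<le> card M - 1"
      using less.prems MB lt by (intro less.hyps) (auto intro: finite_subset)
    have "B - M \<noteq> {}" "card (B - M) = card B - card M"
      using MB less.prems(1) by (auto simp: card_Diff_subset finite_subset)
    then have "card (B - M) < card B" using MB(3) lt by linarith
    then have "card ?F2 \<le> card (B - M) - 1"
      using less.prems \<open>B - M \<noteq> {}\<close> by (intro less.hyps) auto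
    then have 2: "card ?F2 \<le> card B - card M - 1" by (simp add: \<open>card (B - M) = _\<close>)
    have "card F \<le> card (insert B (?F1 \<union> ?F2))" using finF by (intro card_mono cov) auto
    also have "\<dots> \<le> Suc (card (?F1 \<union> ?F2))" using finF by (intro card_insert_le_m1) auto
    also have "\<dots> \<le> Suc (card ?F1 + card ?F2)" by (simp add: card_Un_le)
    finally show ?thesis using 1 2 MB lt by linarith
  qed
qed


text \<open>
  Among the partitions into members of \<open>J\<close> which are coarser than \<open>K\<close> and have at least three
  blocks, take one with the least number of blocks.  A member of \<open>J\<close> which violates the last
  condition is a union of several blocks and could replace them, unless only one block is left
  outside of it, which is then its complement.
\<close>



lemma partition_compatible:
  fixes J :: "'e::finite set set"
  assumes J: "\<And>A B. A \<in> J \<Longrightarrow> B \<in> J \<Longrightarrow> \<not> crossing A B" "UNIV \<notin> J" "{} \<notin> J"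
    and L0: "partition_on UNIV L0" "L0 \<subseteq> J" "coarser L0 K" "card L0 \<ge> 3"
  shows "\<exists>L. partition_on UNIV L \<and> L \<subseteq> J \<and> coarser L K \<and> card L \<ge> 3 \<and>
    (\<forall>A\<in>J. \<exists>B\<in>L. A \<subseteq> B \<or> - A \<subseteq> B)"
proof -
  let ?ok = "\<lambda>L. partition_on UNIV L \<and> L \<subseteq> J \<and> coarser L K \<and> card L \<ge> 3"
  have "?ok L0" using L0 by blast
  then obtain L where L: "?ok L" and min: "\<And>L'. ?ok L' \<Longrightarrow> card L \<le> card L'"
    using ex_has_least_nat[of ?ok L0 card] by blast
  have "\<exists>B\<in>L. A \<subseteq> B \<or> - A \<subseteq> B" if A: "A \<in> J" for A
  proof (rule ccontr)
    assume c: "\<not> ?thesis"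
    define M where "M = {B\<in>L. B \<subseteq> A}"
    have dich: "B \<subseteq> A \<or> B \<inter> A = {}" if "B \<in> L" for B
    proof -
      have "\<not> crossing A B" using J(1) A L that by blast
      then show ?thesis using c that by (auto simp: crossing_def)
    qed
    have cov: "\<Union>L = UNIV" and disj: "\<And>B B'. B \<in> L \<Longrightarrow> B' \<in> L \<Longrightarrow> B \<noteq> B' \<Longrightarrow> B \<inter> B' = {}"
      and ne: "{} \<notin> L"
      using L by (auto simp: partition_on_def disjoint_def)
    have AM: "A = \<Union>M"
      using cov dich by (auto simp: M_def) blast
    let ?L = "insert A (L - M)"
    have fin: "finite L" "finite M" by simp_all
    have "A \<noteq> {}" using A J(3) by blast
    have AL: "A \<notin> L" using c by blast
    have "partition_on UNIV ?L"
    proof (rule partition_onI)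
      show "\<Union>?L = UNIV" using cov AM by auto
      show "\<And>p q. p \<in> ?L \<Longrightarrow> q \<in> ?L \<Longrightarrow> p \<noteq> q \<Longrightarrow> disjnt p q"
        using disj dich by (auto simp: M_def disjnt_def)
      show "{} \<notin> ?L" using ne \<open>A \<noteq> {}\<close> by auto
    qed
    moreover have "?L \<subseteq> J" using A L by auto
    moreover have "coarser ?L K"
    proof -
      have "\<exists>K'\<subseteq>K. A = \<Union>K'"
      proof -
        have "\<forall>B\<in>M. \<exists>K'\<subseteq>K. B = \<Union>K'" using L by (auto simp: M_def coarser_def)
        then obtain k where "\<And>B. B \<in> M \<Longrightarrow> k B \<subseteq> K \<and> B = \<Union>(k B)" by metis
        then have k: "k B \<subseteq> K" "\<Union>(k B) = B" if "B \<in> M" for B using that by (blast, metis)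
        have "\<Union>(\<Union>(k ` M)) = (\<Union>B\<in>M. \<Union>(k B))" by blast
        also have "\<dots> = (\<Union>B\<in>M. B)" using k(2) by (intro SUP_cong) auto
        finally have "A = \<Union>(\<Union>(k ` M))" by (simp add: AM)
        then show ?thesis using k(1) by blast
      qed
      then show ?thesis using L by (auto simp: coarser_def)
    qed
    moreover have lt: "card ?L < card L"
    proof -
      have "M \<noteq> {}" using AM \<open>A \<noteq> {}\<close> by auto
      moreover have "card M \<noteq> 1"
      proof
        assume "card M = 1"
        then obtain B where "M = {B}" by (rule card_1_singletonE)
        then have "B \<in> M" "A = B" unfolding AM by simp_all
        then show False using AL by (simp add: M_def)
      qed
      ultimately have "card M \<ge> 2" using fin by (cases "card M") auto
      moreover have "M \<subseteq> L" by (auto simp: M_def)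
      ultimately show ?thesis
        using card_insert_le_m1 card_Diff_subset[of M L] card_mono[of L M] fin AL by (simp add: card_insert_if)
    qed
    ultimately have "card ?L < 3" using min[of ?L] by fastforce
    \<comment> \<open>The new partition has too few blocks, so the rest outside of \<open>A\<close> is a single block.\<close>
    moreover have "card ?L = Suc (card (L - M))" using fin AL by (simp add: card_insert_if)
    ultimately have "card (L - M) \<le> 1" by simp
    then have "\<exists>B. L - M \<subseteq> {B}" using fin
      by (metis card_1_singletonE card_eq_0_iff empty_subsetI finite_Diff le_Suc_eq le_zero_eq One_nat_def subset_refl)
    then obtain B where B: "L - M \<subseteq> {B}" by blast
    have "\<Union>L \<subseteq> \<Union>M \<union> \<Union>(L - M)" by blast
    then have "- A \<subseteq> \<Union>(L - M)" unfolding cov AM by blast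
    then have "- A \<subseteq> B" using B by auto
    show False
    proof (cases "L - M = {}")
      case True
      then have "A = UNIV" using \<open>- A \<subseteq> \<Union>(L - M)\<close> by auto
      then show False using A J(2) by simp
    next
      case False
      then have "B \<in> L" using B by auto
      then show False using c \<open>- A \<subseteq> B\<close> by blast
    qed
  qed
  then show ?thesis using L by blast
qed

lemma partition_card_sum:
  fixes L :: "'e::finite set set"
  assumes "partition_on UNIV L"
  shows "(\<Sum>B\<in>L. card B) = CARD('e)"
  using card_Union_disjoint[of L] assms
  by (simp add: partition_on_def disjoint_def disjnt_def pairwise_def)

lemma partition_card_sum_diff:
  fixes L :: "'e::finite set set"
  assumes L: "partition_on UNIV L"
  shows "(\<Sum>B\<in>L. card B - 1) = CARD('e) - card L"
proof -
  have "card B \<ge> 1" if "B \<in> L" for B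
    using L that by (auto simp: partition_on_def Suc_le_eq card_gt_0_iff)
  then have "(\<Sum>B\<in>L. card B) = (\<Sum>B\<in>L. (card B - 1) + 1)"
    by (intro sum.cong refl) (metis le_add_diff_inverse2)
  also have "\<dots> = (\<Sum>B\<in>L. card B - 1) + card L"
    by (simp only: sum.distrib sum_constant of_nat_id mult_1_right)
  finally show ?thesis by (simp add: partition_card_sum[OF L])
qed

definition avoid :: "'e \<Rightarrow> 'e set \<Rightarrow> 'e set" where
  "avoid e0 A = (if e0 \<in> A then - A else A)"

definition normal_form :: "'e::finite \<Rightarrow> 'e set set \<Rightarrow> 'e set set" where
  "normal_form e0 J = avoid e0 ` {A \<in> J. card A \<ge> 2 \<and> card (- A) \<ge> 2}"

text \<open>
  Every member or its complement lies in a block, and the resulting sets inside a block \<open>B\<close> form a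
  nested family, with at most \<open>card B - 1\<close> members.
\<close>

lemma card_normal_form_le:
  fixes J :: "'e::finite set set"
  assumes J: "\<And>A B. A \<in> J \<Longrightarrow> B \<in> J \<Longrightarrow> \<not> crossing A B"
    and L: "partition_on UNIV L" "card L \<ge> 3" "\<And>A. A \<in> J \<Longrightarrow> \<exists>B\<in>L. A \<subseteq> B \<or> - A \<subseteq> B"
  shows "card (normal_form e0 J) \<le> CARD('e) - card L"
proof -
  have cov: "\<Union>L = UNIV" and disj: "\<And>B B'. B \<in> L \<Longrightarrow> B' \<in> L \<Longrightarrow> B \<noteq> B' \<Longrightarrow> B \<inter> B' = {}"
    and ne: "\<And>B. B \<in> L \<Longrightarrow> B \<noteq> {}"
    using L(1) by (auto simp: partition_on_def disjoint_def)
  define r where "r A = (if \<exists>B\<in>L. A \<subseteq> B then A else - A)" for A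
  let ?K = "normal_form e0 J"
  have K: "e0 \<notin> A \<and> card A \<ge> 2 \<and> card (- A) \<ge> 2 \<and> (A \<in> J \<or> - A \<in> J)" if "A \<in> ?K" for A
    using that by (auto simp: normal_form_def avoid_def)
  have r: "(\<exists>B\<in>L. r A \<subseteq> B) \<and> card (r A) \<ge> 2 \<and> (r A = A \<or> r A = - A)" if "A \<in> ?K" for A
    using K[OF that] L(3)[of A] L(3)[of "- A"] by (auto simp: r_def)
  have crossK: "\<not> crossing A A'" if "A \<in> ?K" "A' \<in> ?K" for A A'
    using K[OF that(1)] K[OF that(2)] J crossing_Compl by metis
  have inj: "inj_on r ?K"
  proof (rule inj_onI)
    fix A A' assume A: "A \<in> ?K" "A' \<in> ?K" "r A = r A'"
    then have "A = A' \<or> A = - A'" using r by (metis double_complement)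
    then show "A = A'" using K[OF A(1)] K[OF A(2)] by auto
  qed
  define F where "F B = {C \<in> r ` ?K. C \<subseteq> B}" for B
  have cardF: "card (F B) \<le> card B - 1" if B: "B \<in> L" for B
  proof (rule card_nested_family)
    show "finite B" "B \<noteq> {}" using ne B by auto
    show "A \<subseteq> B \<and> 2 \<le> card A" if "A \<in> F B" for A using that r by (auto simp: F_def)
    fix C C' assume C: "C \<in> F B" "C' \<in> F B"
    have "B \<noteq> UNIV"
    proof
      assume "B = UNIV"
      then have "L \<subseteq> {UNIV}" using disj[OF B] ne by fastforce
      then have "card L \<le> card {UNIV :: 'e set}" by (intro card_mono) auto
      then show False using L(2) by simp
    qed
    then have "C \<union> C' \<noteq> UNIV" using C by (auto simp: F_def)
    moreover have "\<not> crossing C C'"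
      using C crossK r crossing_Compl unfolding F_def by (smt (verit) imageE mem_Collect_eq)
    ultimately show "nested C C'" by (auto simp: crossing_def nested_def)
  qed
  have "r ` ?K \<subseteq> (\<Union>B\<in>L. F B)" using r by (auto simp: F_def)
  then have "card (r ` ?K) \<le> card (\<Union>B\<in>L. F B)" by (intro card_mono) auto
  also have "\<dots> \<le> (\<Sum>B\<in>L. card (F B))" by (intro card_UN_le) simp
  also have "\<dots> \<le> (\<Sum>B\<in>L. card B - 1)" by (intro sum_mono cardF)
  also have "\<dots> = CARD('e) - card L" by (rule partition_card_sum_diff[OF L(1)])
  finally show ?thesis using card_image[OF inj] by simp
qed

lemma nested_system_normal_form:
  assumes "\<And>A B. A \<in> J \<Longrightarrow> B \<in> J \<Longrightarrow> \<not> crossing A B"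
  shows "nested_system e0 (normal_form e0 J)"
proof -
  have K: "e0 \<notin> A \<and> card A \<ge> 2 \<and> card (- A) \<ge> 2 \<and> (A \<in> J \<or> - A \<in> J)" if "A \<in> normal_form e0 J" for A
    using that by (auto simp: normal_form_def avoid_def)
  have "nested A B" if "A \<in> normal_form e0 J" "B \<in> normal_form e0 J" for A B
  proof -
    have "\<not> crossing A B" using K[OF that(1)] K[OF that(2)] assms crossing_Compl by metis
    moreover have "A \<union> B \<noteq> UNIV" using K[OF that(1)] K[OF that(2)] by auto
    ultimately show ?thesis by (auto simp: crossing_def nested_def)
  qed
  then show ?thesis using K by (auto simp: nested_system_def)
qed

text \<open>The complement of the base point can be added to the family.\<close>

lemma card_nested_system_le:
  fixes K :: "'e::finite set set"
  assumes "nested_system e0 K" "CARD('e) \<ge> 3"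
  shows "card K \<le> CARD('e) - 3"
proof -
  have c: "card (- {e0}) = CARD('e) - 1" by (simp add: Compl_eq_Diff_UNIV)
  have notin: "- {e0} \<notin> K"
    using assms(1) by (auto simp: nested_system_def)
  have "card (insert (- {e0}) K) \<le> card (- {e0}) - 1"
  proof (rule card_nested_family)
    show "- {e0} \<noteq> {}" using c assms(2) by auto
    show "A \<subseteq> - {e0} \<and> 2 \<le> card A" if "A \<in> insert (- {e0}) K" for A
      using that assms c by (auto simp: nested_system_def)
    show "nested A B" if "A \<in> insert (- {e0}) K" "B \<in> insert (- {e0}) K" for A B
      using that assms(1) by (auto simp: nested_system_def nested_def)
  qed simp
  then show ?thesis using notin c by simp
qed


section \<open>The flows of a family and of its normal form\<close>

lemma bending_flow_Compl:
  fixes len :: "'e::finite \<Rightarrow> real"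
  assumes len: "\<And>e. len e > 0" "generic len" and A: "nonvanishing len A"
  shows "bending_flow len (- A) t = bending_flow len A t"
  unfolding bending_flow_eq[OF len A] bending_flow_eq[OF len nonvanishing_Compl[OF A]]
proof (rule induced_map_cong[OF equivariant_bend[OF A] _ equivariant_bend[OF nonvanishing_Compl[OF A]]])
  fix \<rho> assume \<rho>: "\<rho> \<in> polt len"
  show "cls len (bend (- A) t \<rho>) = cls len (bend A t \<rho>)"
    unfolding bend_Compl[OF \<rho> nonvanishingD[OF A \<rho>]]
    by (intro cls_rot_act rotation_matrix_rot norm_sgn_ssum[OF A \<rho>]
        bend_polt[OF \<rho> nonvanishingD[OF A \<rho>]])
qed

lemma bending_flow_small:
  fixes len :: "'e::finite \<Rightarrow> real"
  assumes len: "\<And>e. len e > 0" "generic len" and A: "nonvanishing len A" and c: "card A \<le> 1"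
  shows "bending_flow len A t = \<one>\<^bsub>BijGroup (Pol len)\<^esub>"
proof -
  have "A = {} \<or> (\<exists>e. A = {e})" using c by (metis One_nat_def card_0_eq card_1_singletonE finite le_Suc_eq le_zero_eq)
  then have "bend A t = (\<lambda>\<rho>. \<rho>)"
    by (auto intro!: ext config_eqI simp: bend_nth rot_sgn_self)
  then show ?thesis by (simp add: bending_flow_eq[OF len A] induced_map_id)
qed

text \<open>Passing to complements preserves the flow, and the flow of a set without two elements is trivial.\<close>

lemma generated_by_normal_form:
  fixes len :: "'e::finite \<Rightarrow> real"
  assumes len: "\<And>e. len e > 0" "generic len" and J: "\<And>A. A \<in> J \<Longrightarrow> nonvanishing len A"
  shows "generated_by_bendings len (normal_form e0 J) = generated_by_bendings len J"
proof
  have nv: "nonvanishing len A" if "A \<in> normal_form e0 J" for A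
    using that J nonvanishing_Compl by (auto simp: normal_form_def avoid_def)
  have flow: "bending_flow len (avoid e0 A) t = bending_flow len A t" if "A \<in> J" for A t
    using bending_flow_Compl[OF len J[OF that]] by (simp add: avoid_def)
  show "generated_by_bendings len (normal_form e0 J) \<subseteq> generated_by_bendings len J"
  proof (rule generated_by_bendings_least[OF subgroup_generated_by_bendings[OF len J]])
    fix A t assume "A \<in> normal_form e0 J"
    then obtain B where "B \<in> J" "A = avoid e0 B" by (auto simp: normal_form_def)
    then show "bending_flow len A t \<in> generated_by_bendings len J"
      by (simp add: flow bending_flow_in_generated)
  qed
  show "generated_by_bendings len J \<subseteq> generated_by_bendings len (normal_form e0 J)"
  proof (rule generated_by_bendings_least[OF subgroup_generated_by_bendings[OF len nv]])
    fix A t assume A: "A \<in> J"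
    consider "card A \<le> 1" | "card (- A) \<le> 1" | "card A \<ge> 2" "card (- A) \<ge> 2" by linarith
    then show "bending_flow len A t \<in> generated_by_bendings len (normal_form e0 J)"
    proof cases
      case 1
      then show ?thesis
        using bending_flow_small[OF len J[OF A]] by (simp add: generated_by_bendings_def generate.one)
    next
      case 2
      then show ?thesis
        using bending_flow_small[OF len nonvanishing_Compl[OF J[OF A]]]
          bending_flow_Compl[OF len J[OF A]]
        by (simp add: generated_by_bendings_def generate.one)
    next
      case 3
      then have "avoid e0 A \<in> normal_form e0 J" using A by (auto simp: normal_form_def)
      then show ?thesis using bending_flow_in_generated flow[OF A] by metis
    qed
  qed
qed

lemma hamiltonian_torus_commute:
  assumes "hamiltonian_torus len k T" "\<phi> \<in> T" "\<psi> \<in> T"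
  shows "\<phi> \<otimes>\<^bsub>BijGroup (Pol len)\<^esub> \<psi> = \<psi> \<otimes>\<^bsub>BijGroup (Pol len)\<^esub> \<phi>"
proof -
  have "\<exists>\<theta> :: (nat \<Rightarrow> real) \<Rightarrow> 'a config set \<Rightarrow> 'a config set. range \<theta> = T \<and>
      (\<forall>\<xi> \<eta>. \<theta> (\<lambda>i. \<xi> i + \<eta> i) = \<theta> \<xi> \<otimes>\<^bsub>BijGroup (Pol len)\<^esub> \<theta> \<eta>)"
    using assms(1) unfolding hamiltonian_torus_def
    by (elim conjE exE) (intro exI conjI; assumption)
  then obtain \<theta> :: "(nat \<Rightarrow> real) \<Rightarrow> 'a config set \<Rightarrow> 'a config set" where \<theta>: "range \<theta> = T"
    "\<And>\<xi> \<eta>. \<theta> (\<lambda>i. \<xi> i + \<eta> i) = \<theta> \<xi> \<otimes>\<^bsub>BijGroup (Pol len)\<^esub> \<theta> \<eta>" by blast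
  obtain \<xi> \<eta> where "\<phi> = \<theta> \<xi>" "\<psi> = \<theta> \<eta>" using assms(2,3) \<theta>(1) by blast
  then show ?thesis using \<theta>(2)[of \<xi> \<eta>] \<theta>(2)[of \<eta> \<xi>] by (simp add: add.commute)
qed

lemma UNIV_vanishing: "polt len \<noteq> {} \<Longrightarrow> \<not> nonvanishing len UNIV"
  by (auto simp: nonvanishing_def polt_sum)

text \<open>
  A bending torus which contains the flows of \<open>I\<close> is also generated by the flows of its own
  generating sets together with \<open>I\<close>.  As they commute, these sets do not cross.
\<close>

lemma bending_torus_dims_eq:
  fixes len :: "'e::finite \<Rightarrow> real"
  assumes len: "\<And>e. len e > 0" "generic len" "polt len \<noteq> {}"
    and I: "\<And>A. A \<in> I \<Longrightarrow> lopsided len A"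
  shows "bending_torus_dims len I = {card (normal_form e0 J) | J.
    I \<subseteq> J \<and> (\<forall>A\<in>J. lopsided len A) \<and> (\<forall>A\<in>J. \<forall>B\<in>J. \<not> crossing A B)}"
proof -
  have torus: "hamiltonian_torus len (card (normal_form e0 J)) (generated_by_bendings len J)"
    if J: "\<And>A. A \<in> J \<Longrightarrow> lopsided len A" "\<And>A B. A \<in> J \<Longrightarrow> B \<in> J \<Longrightarrow> \<not> crossing A B" for J
  proof -
    have nv: "nonvanishing len A" if "A \<in> normal_form e0 J" for A
      using that J(1)
      by (auto simp: normal_form_def avoid_def intro: nonvanishing_Compl lopsided_nonvanishing)
    show ?thesis
      using hamiltonian_torus_nested[OF len nested_system_normal_form[OF J(2)] nv]
        generated_by_normal_form[OF len(1,2) lopsided_nonvanishing[OF J(1)]] by metis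
  qed
  show ?thesis
  proof (intro equalityI subsetI)
    fix k assume "k \<in> bending_torus_dims len I"
    then obtain T J0 where T: "hamiltonian_torus len k T" "\<And>A. A \<in> J0 \<Longrightarrow> lopsided len A"
      "T = generated_by_bendings len J0" "generated_by_bendings len I \<subseteq> T"
      by (auto simp: bending_torus_dims_def bending_torus_def)
    define J where "J = I \<union> J0"
    have J: "lopsided len A" if "A \<in> J" for A using that I T(2) by (auto simp: J_def)
    note nv = lopsided_nonvanishing[OF J]
    have in_T: "bending_flow len A t \<in> T" if "A \<in> J" for A t
      using that T(3,4) bending_flow_in_generated unfolding J_def by blast
    have "T = generated_by_bendings len J"
    proof
      show "T \<subseteq> generated_by_bendings len J" unfolding T(3)
        by (rule generated_by_bendings_least[OF subgroup_generated_by_bendings[OF len(1,2) nv]])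
          (auto simp: J_def intro: bending_flow_in_generated)
      show "generated_by_bendings len J \<subseteq> T"
        using in_T subgroup_generated_by_bendings[OF len(1,2) lopsided_nonvanishing[OF T(2)]]
        by (intro generated_by_bendings_least) (auto simp: T(3))
    qed
    moreover have ncr: "\<not> crossing A B" if "A \<in> J" "B \<in> J" for A B
      using hamiltonian_torus_commute[OF T(1) in_T[OF that(1)] in_T[OF that(2)]]
      by (intro commuting_bendings_not_crossing[OF len nv nv] that)
    ultimately have "k = card (normal_form e0 J)"
      using hamiltonian_torus_dim_unique[OF T(1)] torus[OF J ncr] by simp
    then show "k \<in> {card (normal_form e0 J) | J.
        I \<subseteq> J \<and> (\<forall>A\<in>J. lopsided len A) \<and> (\<forall>A\<in>J. \<forall>B\<in>J. \<not> crossing A B)}"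
      using J ncr J_def by blast
  next
    fix k assume "k \<in> {card (normal_form e0 J) | J.
        I \<subseteq> J \<and> (\<forall>A\<in>J. lopsided len A) \<and> (\<forall>A\<in>J. \<forall>B\<in>J. \<not> crossing A B)}"
    then obtain J where J: "k = card (normal_form e0 J)" "I \<subseteq> J" "\<And>A. A \<in> J \<Longrightarrow> lopsided len A"
      "\<And>A B. A \<in> J \<Longrightarrow> B \<in> J \<Longrightarrow> \<not> crossing A B" by blast
    have "generated_by_bendings len I \<subseteq> generated_by_bendings len J"
      using J(2) by (intro generated_by_bendings_least[OF subgroup_generated_by_bendings[OF len(1,2)
              lopsided_nonvanishing[OF J(3)]]]) (auto intro: bending_flow_in_generated)
    then show "k \<in> bending_torus_dims len I"
      unfolding bending_torus_dims_def bending_torus_def using torus[OF J(3,4)] J(1,3) by blast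
  qed
qed


section \<open>Extremal families of lopsided sets\<close>

lemma partition_maximal_members:
  fixes I :: "'e::finite set set"
  assumes "bending_set len I"
  shows "partition_on UNIV (maximal_members I)"
proof (rule partition_onI)
  have I: "\<And>A B. A \<in> I \<Longrightarrow> B \<in> I \<Longrightarrow> nested A B" "\<And>e. {e} \<in> I" "{} \<notin> I"
    using assms by (auto simp: bending_set_def nested_def lopsided_def)
  have "\<exists>M\<in>maximal_members I. e \<in> M" for e
  proof -
    have "\<exists>M\<in>{A\<in>I. e \<in> A}. \<forall>B\<in>{A\<in>I. e \<in> A}. M \<le> B \<longrightarrow> M = B"
      using I(2)[of e] by (intro finite_has_maximal) auto
    then show ?thesis by (auto simp: maximal_members_def)
  qed
  then show "\<Union>(maximal_members I) = UNIV" by auto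
  show "disjnt p q" if "p \<in> maximal_members I" "q \<in> maximal_members I" "p \<noteq> q" for p q
    using that I(1)[of p q] by (auto simp: maximal_members_def nested_def disjnt_def)
  show "{} \<notin> maximal_members I" using I(3) by (auto simp: maximal_members_def)
qed



lemma partition_card_le:
  fixes L :: "'e::finite set set"
  assumes "partition_on UNIV L"
  shows "card L \<le> CARD('e)"
proof -
  have "(\<Sum>B\<in>L. 1) \<le> (\<Sum>B\<in>L. card B)"
    using assms by (intro sum_mono) (auto simp: partition_on_def Suc_le_eq card_gt_0_iff)
  then show ?thesis by (simp add: partition_card_sum[OF assms])
qed

lemma lopsided_subset:
  fixes len :: "'e::finite \<Rightarrow> real"
  assumes "\<And>e. len e > 0" "e0 \<in> B" "B \<subseteq> A" "len e0 > (\<Sum>e\<in>A - {e0}. len e)"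
  shows "lopsided len B"
proof -
  have "(\<Sum>e\<in>B - {e0}. len e) \<le> (\<Sum>e\<in>A - {e0}. len e)"
    using assms by (intro sum_mono2) (auto intro: less_imp_le)
  then show ?thesis unfolding lopsided_def using assms by (intro bexI[of _ e0]) auto
qed

text \<open>
  Let \<open>C1\<close> be the maximal proper member of the family that contains the dominant edge of \<open>A\<close>, and
  \<open>C2\<close> another maximal proper member.  If they do not fill \<open>A\<close>, their union could be added to the
  family.
\<close>

lemma maximal_family_binary:
  fixes len :: "'e::finite \<Rightarrow> real"
  assumes len: "\<And>e. len e > 0" and J: "\<And>A B. A \<in> J \<Longrightarrow> B \<in> J \<Longrightarrow> nested A B" "\<And>e. {e} \<in> J"
    and max: "\<And>D A. A \<in> J \<Longrightarrow> D \<subseteq> A \<Longrightarrow> lopsided len D \<Longrightarrow> (\<And>C. C \<in> J \<Longrightarrow> nested D C) \<Longrightarrow> D \<in> J"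
    and A: "A \<in> J" "lopsided len A" "card A \<ge> 2"
  shows "\<exists>C1\<in>J. \<exists>C2\<in>J. C1 \<inter> C2 = {} \<and> C1 \<noteq> {} \<and> C2 \<noteq> {} \<and> A = C1 \<union> C2"
proof -
  obtain e0 where e0: "e0 \<in> A" "len e0 > (\<Sum>e\<in>A - {e0}. len e)"
    using A(2) by (auto simp: lopsided_def)
  have maxl: "\<exists>C. C \<in> J \<and> C \<subset> A \<and> x \<in> C \<and> (\<forall>D\<in>J. D \<subset> A \<longrightarrow> C \<subseteq> D \<longrightarrow> D = C)"
    if "x \<in> A" for x
  proof -
    have "A \<noteq> {x}" using A(3) by auto
    then have "{x} \<in> {C\<in>J. C \<subset> A \<and> x \<in> C}" using that J(2) by auto
    then have "\<exists>C\<in>{C\<in>J. C \<subset> A \<and> x \<in> C}. \<forall>D\<in>{C\<in>J. C \<subset> A \<and> x \<in> C}. C \<le> D \<longrightarrow> C = D"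
      by (intro finite_has_maximal) auto
    then obtain C where C: "C \<in> {C\<in>J. C \<subset> A \<and> x \<in> C}"
      "\<forall>D\<in>{C\<in>J. C \<subset> A \<and> x \<in> C}. C \<le> D \<longrightarrow> C = D" by (elim bexE) (rule that)
    have "D = C" if "D \<in> J" "D \<subset> A" "C \<subseteq> D" for D
      using bspec[OF C(2), of D] C(1) that by auto
    then show ?thesis using C(1) by (intro exI[of _ C]) simp
  qed
  obtain C1 where C1: "C1 \<in> J" "C1 \<subset> A" "e0 \<in> C1" "\<forall>D\<in>J. D \<subset> A \<longrightarrow> C1 \<subseteq> D \<longrightarrow> D = C1"
    using maxl[OF e0(1)] by blast
  obtain x where x: "x \<in> A" "x \<notin> C1" using C1(2) by blast
  obtain C2 where C2: "C2 \<in> J" "C2 \<subset> A" "x \<in> C2" "\<forall>D\<in>J. D \<subset> A \<longrightarrow> C2 \<subseteq> D \<longrightarrow> D = C2"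
    using maxl[OF x(1)] by blast
  have disj: "C1 \<inter> C2 = {}"
    using J(1)[OF C1(1) C2(1)] C1 C2 x(2) unfolding nested_def by blast
  let ?D = "C1 \<union> C2"
  have "A = ?D"
  proof (rule ccontr)
    assume ne: "A \<noteq> ?D"
    then have sub: "?D \<subset> A" using C1(2) C2(2) by blast
    have "lopsided len ?D" using e0 C1(3) sub by (intro lopsided_subset[OF len, of e0 ?D A]) auto
    moreover have "nested ?D C" if C: "C \<in> J" for C
    proof -
      consider "A \<inter> C = {}" | "A \<subseteq> C" | "C \<subset> A" using J(1)[OF A(1) C] by (auto simp: nested_def)
      then show ?thesis
      proof cases
        case 3
        have "C \<subseteq> C1 \<or> C \<inter> C1 = {}" "C \<subseteq> C2 \<or> C \<inter> C2 = {}"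
          using J(1)[OF C C1(1)] J(1)[OF C C2(1)] bspec[OF C1(4) C] bspec[OF C2(4) C] 3
          unfolding nested_def by blast+
        then show ?thesis unfolding nested_def by blast
      qed (use sub in \<open>auto simp: nested_def\<close>)
    qed
    ultimately have "?D \<in> J" using max[OF A(1)] sub by blast
    then have "?D = C1" using C1(4) sub by blast
    then show False using C2(3) x(2) by blast
  qed
  then show ?thesis using C1(1,3) C2(1,3) disj by blast
qed

lemma card_maximal_family:
  fixes len :: "'e::finite \<Rightarrow> real"
  assumes len: "\<And>e. len e > 0" and J: "\<And>A B. A \<in> J \<Longrightarrow> B \<in> J \<Longrightarrow> nested A B" "\<And>e. {e} \<in> J"
    and lop: "\<And>A. A \<in> J \<Longrightarrow> lopsided len A"
    and max: "\<And>D A. A \<in> J \<Longrightarrow> D \<subseteq> A \<Longrightarrow> lopsided len D \<Longrightarrow> (\<And>C. C \<in> J \<Longrightarrow> nested D C) \<Longrightarrow> D \<in> J"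
    and A: "A \<in> J"
  shows "card A \<le> Suc (card {C\<in>J. C \<subseteq> A \<and> card C \<ge> 2})"
  using A
proof (induction "card A" arbitrary: A rule: less_induct)
  case less
  show ?case
  proof (cases "card A \<ge> 2")
    case True
    have "\<exists>C1\<in>J. \<exists>C2\<in>J. C1 \<inter> C2 = {} \<and> C1 \<noteq> {} \<and> C2 \<noteq> {} \<and> A = C1 \<union> C2"
    proof (rule maximal_family_binary[OF len _ _ _ less.prems lop[OF less.prems] True])
      show "nested X Y" if "X \<in> J" "Y \<in> J" for X Y using that by (rule J(1))
      show "{e} \<in> J" for e by (rule J(2))
      show "D \<in> J" if "X \<in> J" "D \<subseteq> X" "lopsided len D" "\<And>C. C \<in> J \<Longrightarrow> nested D C" for D X
        using that by (rule max)
    qed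
    then obtain C1 C2 where C: "C1 \<in> J" "C2 \<in> J" "C1 \<inter> C2 = {}" "C1 \<noteq> {}" "C2 \<noteq> {}"
      "A = C1 \<union> C2" by blast
    let ?N = "\<lambda>A. {C\<in>J. C \<subseteq> A \<and> card C \<ge> 2}"
    have cA: "card A = card C1 + card C2" using C by (simp add: card_Un_disjoint)
    moreover have "card C1 > 0" "card C2 > 0" using C by (simp_all add: card_gt_0_iff)
    ultimately have IH: "card C1 \<le> Suc (card (?N C1))" "card C2 \<le> Suc (card (?N C2))"
      using less.hyps C(1,2) by simp_all
    have disj: "?N C1 \<inter> ?N C2 = {}"
    proof -
      have False if "X \<subseteq> C1" "X \<subseteq> C2" "card X \<ge> 2" for X
      proof -
        have "X = {}" using that C(3) by blast
        then show False using that(3) by simp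
      qed
      then show ?thesis by blast
    qed
    have "A \<notin> ?N C1 \<union> ?N C2" using C(3-6) by blast
    then have "card (insert A (?N C1 \<union> ?N C2)) = Suc (card (?N C1) + card (?N C2))"
      using disj by (simp add: card_Un_disjoint)
    moreover have "insert A (?N C1 \<union> ?N C2) \<subseteq> ?N A" using less.prems True C(6) by auto
    then have "card (insert A (?N C1 \<union> ?N C2)) \<le> card (?N A)" by (intro card_mono) auto
    ultimately show ?thesis using IH cA by linarith
  qed auto
qed

text \<open>
  Refining the partition as far as possible by nested lopsided sets inside its blocks produces
  \<open>card B - 1\<close> sets with at least two elements inside each block \<open>B\<close>.  The normal form loses
  members only if there are two blocks, which are complementary: then the larger one is left out.
\<close>

lemma large_nested_family:
  fixes len :: "'e::finite \<Rightarrow> real"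
  assumes len: "\<And>e. len e > 0" and I: "bending_set len I" and n: "CARD('e) \<ge> 3"
    and L: "partition_on UNIV L" "\<And>B. B \<in> L \<Longrightarrow> lopsided len B" "coarser L (maximal_members I)"
      "card L \<ge> 2"
  shows "\<exists>J. I \<subseteq> J \<and> (\<forall>A\<in>J. lopsided len A) \<and> (\<forall>A\<in>J. \<forall>B\<in>J. nested A B) \<and>
    CARD('e) - max 3 (card L) \<le> card (normal_form e0 J)"
proof -
  have Inest: "\<And>A B. A \<in> I \<Longrightarrow> B \<in> I \<Longrightarrow> nested A B" and Ising: "\<And>e. {e} \<in> I"
    and Ilop: "\<And>A. A \<in> I \<Longrightarrow> lopsided len A"
    using I by (auto simp: bending_set_def nested_def)
  have cov: "\<Union>L = UNIV" and disj: "\<And>B B'. B \<in> L \<Longrightarrow> B' \<in> L \<Longrightarrow> B \<noteq> B' \<Longrightarrow> B \<inter> B' = {}"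
    and ne: "\<And>B. B \<in> L \<Longrightarrow> B \<noteq> {}"
    using L(1) by (auto simp: partition_on_def disjoint_def)
  have M: "partition_on UNIV (maximal_members I)" by (rule partition_maximal_members[OF I])
  have I_L: "A \<subseteq> B \<or> A \<inter> B = {}" if A: "A \<in> I" and B: "B \<in> L" for A B
  proof -
    obtain K' where K': "K' \<subseteq> maximal_members I" "B = \<Union>K'"
      using L(3) B by (auto simp: coarser_def)
    have "\<exists>m\<in>{C\<in>I. A \<subseteq> C}. \<forall>C\<in>{C\<in>I. A \<subseteq> C}. m \<le> C \<longrightarrow> m = C"
      using A by (intro finite_has_maximal) auto
    then obtain m where m: "m \<in> maximal_members I" "A \<subseteq> m"
      by (auto simp: maximal_members_def) blast
    have disj_m: "X \<inter> m = {}" if "X \<in> maximal_members I" "X \<noteq> m" for X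
      using M m(1) that by (auto simp: partition_on_def disjoint_def)
    show ?thesis
    proof (cases "m \<in> K'")
      case True
      then show ?thesis using m(2) K'(2) by blast
    next
      case False
      then have "X \<inter> m = {}" if "X \<in> K'" for X using that K'(1) disj_m[of X] by blast
      then have "m \<inter> B = {}" unfolding K'(2) by blast
      then show ?thesis using m(2) by blast
    qed
  qed
  define ok where "ok J \<longleftrightarrow> I \<union> L \<subseteq> J \<and> (\<forall>A\<in>J. lopsided len A \<and> (\<exists>B\<in>L. A \<subseteq> B)) \<and>
    (\<forall>A\<in>J. \<forall>B\<in>J. nested A B)" for J
  have "ok (I \<union> L)"
  proof -
    have "\<exists>B\<in>L. A \<subseteq> B" if A: "A \<in> I" for A
    proof -
      obtain e where "e \<in> A" using Ilop[OF A] by (auto simp: lopsided_def)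
      then obtain B where "B \<in> L" "e \<in> B" using cov by blast
      then show ?thesis using I_L[OF A] \<open>e \<in> A\<close> by blast
    qed
    moreover have "nested A B" if AB: "A \<in> I \<union> L" "B \<in> I \<union> L" for A B
    proof -
      have IL: "nested X Y" if "X \<in> I" "Y \<in> L" for X Y using I_L[OF that] by (auto simp: nested_def)
      have LL: "nested X Y" if "X \<in> L" "Y \<in> L" for X Y
        using disj[OF that] by (cases "X = Y") (auto simp: nested_def)
      from AB show ?thesis
        by (elim UnE) (simp_all add: IL LL Inest, simp add: nested_sym[of A B] IL)
    qed
    ultimately show ?thesis using Ilop L(2) by (auto simp: ok_def)
  qed
  then obtain J where okJ: "ok J" and Jmax: "\<And>J'. ok J' \<Longrightarrow> card J' \<le> card J"
    using ex_has_greatest_nat[of ok "I \<union> L" card "Suc (card (UNIV :: 'e set set))"]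
    by (metis card_mono finite less_Suc_eq_le subset_UNIV)
  have J: "I \<subseteq> J" "L \<subseteq> J" "\<And>A B. A \<in> J \<Longrightarrow> B \<in> J \<Longrightarrow> nested A B"
    "\<And>A. A \<in> J \<Longrightarrow> lopsided len A" "\<And>A. A \<in> J \<Longrightarrow> \<exists>B\<in>L. A \<subseteq> B"
    using okJ by (auto simp: ok_def)
  have max: "D \<in> J" if "A \<in> J" "D \<subseteq> A" "lopsided len D" "\<And>C. C \<in> J \<Longrightarrow> nested D C" for D A
  proof (rule ccontr)
    assume "D \<notin> J"
    have "\<exists>B\<in>L. D \<subseteq> B" using J(5)[OF that(1)] that(2) by blast
    moreover have "nested C D" if "C \<in> J" for C
      unfolding nested_sym[of C D] using \<open>\<And>C. C \<in> J \<Longrightarrow> nested D C\<close> that by blast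
    moreover have "nested D D" by (simp add: nested_def)
    ultimately have "ok (insert D J)"
      using okJ that(3,4) unfolding ok_def by (simp add: subset_insertI2)
    then show False using Jmax[of "insert D J"] \<open>D \<notin> J\<close> by simp
  qed
  let ?N = "\<lambda>A. {C\<in>J. C \<subseteq> A \<and> card C \<ge> 2}" and ?NJ = "{C\<in>J. card C \<ge> 2}"
  have block: "card B - 1 \<le> card (?N B)" if "B \<in> L" for B
  proof -
    have "card B \<le> Suc (card (?N B))"
    proof (rule card_maximal_family[OF len])
      show "nested X Y" if "X \<in> J" "Y \<in> J" for X Y using that by (rule J(3))
      show "{e} \<in> J" for e using Ising J(1) by blast
      show "lopsided len X" if "X \<in> J" for X using that by (rule J(4))
      show "D \<in> J" if "X \<in> J" "D \<subseteq> X" "lopsided len D" "\<And>C. C \<in> J \<Longrightarrow> nested D C" for D X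
        using that by (rule max)
      show "B \<in> J" using that J(2) by blast
    qed
    then show ?thesis by simp
  qed
  have count: "CARD('e) - card L \<le> card ?NJ"
  proof -
    have "CARD('e) - card L = (\<Sum>B\<in>L. card B - 1)" by (simp only: partition_card_sum_diff[OF L(1)])
    also have "\<dots> \<le> (\<Sum>B\<in>L. card (?N B))" by (intro sum_mono block)
    also have "\<dots> = card (\<Union>B\<in>L. ?N B)"
    proof (rule card_UN_disjoint[symmetric])
      show "\<forall>B\<in>L. \<forall>B'\<in>L. B \<noteq> B' \<longrightarrow> ?N B \<inter> ?N B' = {}"
      proof (intro ballI impI)
        fix B B' assume "B \<in> L" "B' \<in> L" "B \<noteq> B'"
        then have "B \<inter> B' = {}" by (rule disj)
        then have empty: "X = {}" if "X \<subseteq> B" "X \<subseteq> B'" for X using that by blast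
        have False if "X \<in> ?N B \<inter> ?N B'" for X using empty[of X] that by simp
        then show "?N B \<inter> ?N B' = {}" by blast
      qed
    qed auto
    also have "\<dots> \<le> card ?NJ" by (intro card_mono) auto
    finally show ?thesis .
  qed
  have two: "card X \<ge> 2" if "x \<in> X" "y \<in> X" "x \<noteq> y" for X :: "'e set" and x y
  proof -
    have "card {x, y} \<le> card X" using that by (intro card_mono) auto
    then show ?thesis using that(3) by simp
  qed
  \<comment> \<open>It suffices to find many members whose unions in pairs are proper.\<close>
  have reduce: "card F \<le> card (normal_form e0 J)"
    if F: "\<And>A. A \<in> F \<Longrightarrow> A \<in> J \<and> card A \<ge> 2 \<and> card (- A) \<ge> 2"
      "\<And>A A'. A \<in> F \<Longrightarrow> A' \<in> F \<Longrightarrow> A \<union> A' \<noteq> UNIV" for F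
  proof -
    have "inj_on (avoid e0) F"
    proof (rule inj_onI)
      fix A A' assume A: "A \<in> F" "A' \<in> F" "avoid e0 A = avoid e0 A'"
      then have "A = A' \<or> A = - A'" by (auto simp: avoid_def split: if_splits)
      then show "A = A'" using F(2)[OF A(1,2)] by auto
    qed
    then have "card F = card (avoid e0 ` F)" by (simp add: card_image)
    also have "\<dots> \<le> card (normal_form e0 J)" using F(1) by (intro card_mono) (auto simp: normal_form_def)
    finally show ?thesis .
  qed
  have "CARD('e) - max 3 (card L) \<le> card (normal_form e0 J)"
  proof (cases "card L \<ge> 3")
    case True
    have third: "\<exists>D\<in>L. D \<noteq> B \<and> D \<noteq> B'" if "B \<in> L" "B' \<in> L" for B B'
    proof (rule ccontr)
      assume "\<not> ?thesis"
      then have "L \<subseteq> {B, B'}" by blast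
      then have "card L \<le> card {B, B'}" by (intro card_mono) auto
      also have "\<dots> \<le> 2" by (simp add: card_insert_if)
      finally show False using True by simp
    qed
    have "card ?NJ \<le> card (normal_form e0 J)"
    proof (rule reduce)
      fix A assume A: "A \<in> ?NJ"
      then obtain B where B: "B \<in> L" "A \<subseteq> B" using J(5) by blast
      obtain D where D: "D \<in> L" "D \<noteq> B" using third[OF B(1) B(1)] by blast
      obtain D' where D': "D' \<in> L" "D' \<noteq> B" "D' \<noteq> D" using third[OF B(1) D(1)] by blast
      obtain x y where xy: "x \<in> D" "y \<in> D'" using ne D D' by blast
      have "x \<noteq> y" "x \<in> - A" "y \<in> - A"
        using xy B(2) disj[OF D(1) B(1) D(2)] disj[OF D'(1) B(1) D'(2)] disj[OF D'(1) D(1) D'(3)]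
        by blast+
      then have "card (- A) \<ge> 2" using two[of x "- A" y] by simp
      then show "A \<in> J \<and> card A \<ge> 2 \<and> card (- A) \<ge> 2" using A by simp
      fix A' assume "A' \<in> ?NJ"
      then obtain B' where B': "B' \<in> L" "A' \<subseteq> B'" using J(5) by blast
      obtain E where E: "E \<in> L" "E \<noteq> B" "E \<noteq> B'" using third[OF B(1) B'(1)] by blast
      obtain z where "z \<in> E" using ne[OF E(1)] by blast
      then have "z \<notin> A \<union> A'"
        using B(2) B'(2) disj[OF E(1) B(1) E(2)] disj[OF E(1) B'(1) E(3)] by blast
      then show "A \<union> A' \<noteq> UNIV" by blast
    qed
    then show ?thesis using count True by simp
  next
    case False
    then have "card L = 2" using L(4) by simp
    then obtain C D where CD: "L = {C, D}" "C \<noteq> D" "card D \<le> card C"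
      by (metis card_2_iff insert_commute nat_le_linear)
    have CDd: "C \<inter> D = {}" "C \<union> D = UNIV" "C \<noteq> {}" "D \<noteq> {}" using CD disj cov ne by auto
    then have "card C + card D = CARD('e)" by (metis card_Un_disjoint finite)
    then have C2: "card C \<ge> 2" using CD(3) n by linarith
    have "card (?NJ - {C}) \<le> card (normal_form e0 J)"
    proof (rule reduce)
      have sub: "A \<subset> C \<or> A \<subseteq> D" if "A \<in> ?NJ - {C}" for A using that J(5)[of A] CD(1) by blast
      fix A assume A: "A \<in> ?NJ - {C}"
      have "card (- A) \<ge> 2"
        using sub[OF A]
      proof
        assume "A \<subset> C"
        then obtain x y where xy: "x \<in> C" "x \<notin> A" "y \<in> D" using CDd(4) by blast
        then have "x \<noteq> y" "y \<in> - A" using CDd(1) \<open>A \<subset> C\<close> by blast+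
        then show ?thesis using two[of x "- A" y] xy(2) by simp
      next
        assume "A \<subseteq> D"
        then have "C \<subseteq> - A" using CDd by blast
        then have "card C \<le> card (- A)" by (intro card_mono) auto
        then show ?thesis using C2 by simp
      qed
      then show "A \<in> J \<and> card A \<ge> 2 \<and> card (- A) \<ge> 2" using A by simp
      fix A' assume A': "A' \<in> ?NJ - {C}"
      have CD_D: "\<not> C \<subseteq> D" "\<not> D \<subseteq> C" using CDd by blast+
      from sub[OF A] sub[OF A'] show "A \<union> A' \<noteq> UNIV"
      proof (elim disjE)
        assume "A \<subset> C" "A' \<subset> C"
        then show ?thesis using CD_D by blast
      next
        assume "A \<subset> C" "A' \<subseteq> D"
        then show ?thesis using CDd(1) by blast
      next
        assume "A \<subseteq> D" "A' \<subset> C"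
        then show ?thesis using CDd(1) by blast
      next
        assume "A \<subseteq> D" "A' \<subseteq> D"
        then show ?thesis using CD_D by blast
      qed
    qed
    moreover have "C \<in> ?NJ" using CD(1) J(2) C2 by auto
    ultimately show ?thesis using count \<open>card L = 2\<close> by (simp add: card_Diff_singleton)
  qed
  then show ?thesis using J by blast
qed


section \<open>The maximal dimension\<close>

lemma at_least_three_edges:
  fixes len :: "'e::finite \<Rightarrow> real"
  assumes "\<And>e. len e > 0" "generic len" "polt len \<noteq> {}"
  shows "CARD('e) \<ge> 3"
proof (rule ccontr)
  assume few: "\<not> CARD('e) \<ge> 3"
  obtain \<rho> where \<rho>: "\<rho> \<in> polt len" using assms(3) by blast
  obtain a b where ab: "\<rho> $ a \<times> \<rho> $ b \<noteq> 0" using polt_not_collinear[OF assms(1,2) \<rho>] by blast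
  then have "a \<noteq> b" by auto
  then have "card {a, b} = 2" by simp
  moreover have "card {a, b} \<le> CARD('e)" by (rule card_mono) auto
  ultimately have "{a, b} = UNIV" using few by (intro card_subset_eq) auto
  moreover have "ssum {a, b} \<rho> = \<rho> $ a + \<rho> $ b" using \<open>a \<noteq> b\<close> by simp
  ultimately have "\<rho> $ a + \<rho> $ b = 0" by (simp only: polt_sum[OF \<rho>])
  then have "\<rho> $ b = - \<rho> $ a" by (simp add: eq_neg_iff_add_eq_0 add.commute)
  then show False using ab by simp
qed

theorem theorem3p1:
  fixes len :: "'e::finite \<Rightarrow> real" and I :: "'e set set"
  assumes "\<And>e. len e > 0"
    and "generic len"
    and "Pol len \<noteq> {}"
    and "bending_set len I"
  shows "finite (bending_torus_dims len I) \<and> bending_torus_dims len I \<noteq> {} \<and>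
         int (Max (bending_torus_dims len I)) =
           int CARD('e) - max 3 (int (min_lopsided_blocks len I))"
proof -
  have polt: "polt len \<noteq> {}" using assms(3) by (auto simp: Pol_def)
  note len = assms(1,2) polt
  note n3 = at_least_three_edges[OF len]
  obtain e0 :: 'e where True by blast
  define N where "N = min_lopsided_blocks len I"
  let ?P = "\<lambda>L. partition_on UNIV L \<and> (\<forall>B\<in>L. lopsided len B) \<and> coarser L (maximal_members I)"
  have I: "\<And>A. A \<in> I \<Longrightarrow> lopsided len A" using assms(4) by (simp add: bending_set_def)
  have M: "?P (maximal_members I)"
    using partition_maximal_members[OF assms(4)] I
    by (auto simp: maximal_members_def coarser_def intro: exI[of _ "{_}"])
  have N_le: "N \<le> card L" if "?P L" for L
    unfolding N_def min_lopsided_blocks_def using that by (intro Least_le) blast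
  have "\<exists>L. ?P L \<and> card L = N"
  proof -
    have "\<exists>N L. partition_on UNIV L \<and> (\<forall>B\<in>L. lopsided len B) \<and>
        coarser L (maximal_members I) \<and> card L = N"
      using M by blast
    from LeastI_ex[OF this] show ?thesis
      unfolding N_def min_lopsided_blocks_def by blast
  qed
  then obtain L where L: "?P L" "card L = N" by blast
  have no_UNIV: "\<not> lopsided len UNIV" using lopsided_nonvanishing UNIV_vanishing[OF polt] by blast
  have ne: "\<not> lopsided len {}" by (simp add: lopsided_def)
  have N2: "N \<ge> 2"
  proof (rule ccontr)
    assume "\<not> N \<ge> 2"
    then have "card L = 0 \<or> card L = 1" using L(2) by linarith
    then have "L = {} \<or> (\<exists>B. L = {B})" by (auto simp: card_1_singleton_iff)
    moreover have "\<Union>L = UNIV" using L(1) by (simp add: partition_on_def)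
    ultimately have "UNIV \<in> L" by auto
    then show False using L(1) no_UNIV by blast
  qed
  have N_n: "N \<le> CARD('e)" using partition_card_le[of L] L by simp
  have dims: "bending_torus_dims len I = {card (normal_form e0 J) | J.
      I \<subseteq> J \<and> (\<forall>A\<in>J. lopsided len A) \<and> (\<forall>A\<in>J. \<forall>B\<in>J. \<not> crossing A B)}"
    by (rule bending_torus_dims_eq[OF len]) (rule I)
  have upper: "k \<le> CARD('e) - max 3 N" if k: "k \<in> bending_torus_dims len I" for k
  proof -
    obtain J where J: "k = card (normal_form e0 J)" "I \<subseteq> J" "\<And>A. A \<in> J \<Longrightarrow> lopsided len A"
      "\<And>A B. A \<in> J \<Longrightarrow> B \<in> J \<Longrightarrow> \<not> crossing A B"
      using k unfolding dims by blast
    show ?thesis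
    proof (cases "card (maximal_members I) \<ge> 3")
      case True
      have J': "UNIV \<notin> J" "{} \<notin> J" using J(3) no_UNIV ne by blast+
      have "maximal_members I \<subseteq> J" using J(2) by (auto simp: maximal_members_def)
      then obtain L where L: "partition_on UNIV L" "L \<subseteq> J" "coarser L (maximal_members I)"
        "card L \<ge> 3" "\<forall>A\<in>J. \<exists>B\<in>L. A \<subseteq> B \<or> - A \<subseteq> B"
      proof -
        have "\<exists>L. partition_on UNIV L \<and> L \<subseteq> J \<and> coarser L (maximal_members I) \<and> card L \<ge> 3 \<and>
            (\<forall>A\<in>J. \<exists>B\<in>L. A \<subseteq> B \<or> - A \<subseteq> B)"
          using M True \<open>maximal_members I \<subseteq> J\<close>
          by (intro partition_compatible[OF J(4) J', of "maximal_members I"]) simp_all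
        then show thesis by (elim exE conjE) (rule that)
      qed
      have "\<forall>B\<in>L. lopsided len B" using L(2) J(3) by blast
      then have "N \<le> card L" using L(1,3) by (intro N_le) simp
      moreover have "k \<le> CARD('e) - card L"
        unfolding J(1)
      proof (rule card_normal_form_le[OF J(4) L(1,4)])
        show "\<exists>B\<in>L. A \<subseteq> B \<or> - A \<subseteq> B" if "A \<in> J" for A using L(5) that by (rule bspec)
      qed
      ultimately show ?thesis using L(4) by linarith
    next
      case False
      \<comment> \<open>The maximal members themselves show that \<open>N\<close> is less than three.\<close>
      then have "N \<le> 3" using N_le[OF M] by linarith
      then show ?thesis
        unfolding J(1) using card_nested_system_le[OF nested_system_normal_form[OF J(4)] n3] by simp
    qed
  qed
  obtain J where J: "I \<subseteq> J" "\<forall>A\<in>J. lopsided len A" "\<forall>A\<in>J. \<forall>B\<in>J. nested A B"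
    "CARD('e) - max 3 N \<le> card (normal_form e0 J)"
    using large_nested_family[OF assms(1,4) n3, of L e0] L N2 by blast
  define m where "m = card (normal_form e0 J)"
  have "\<forall>A\<in>J. \<forall>B\<in>J. \<not> crossing A B" using J(3) by (auto simp: nested_def crossing_def)
  then have m: "m \<in> bending_torus_dims len I" unfolding dims m_def using J(1,2) by blast
  have fin: "finite (bending_torus_dims len I)"
    by (rule finite_subset[of _ "{..CARD('e) - max 3 N}"]) (use upper in auto)
  have "m = CARD('e) - max 3 N" using upper[OF m] J(4) by (simp add: m_def)
  then have "Max (bending_torus_dims len I) = CARD('e) - max 3 N"
    using m upper by (intro Max_eqI fin) auto
  moreover have "int (CARD('e) - max 3 N) = int CARD('e) - max 3 (int N)"
    using n3 N_n by (simp add: of_nat_diff max_def)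
  ultimately show ?thesis using fin m by (auto simp: N_def)
qed


end
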